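(* Let $\phi$ be a sign-normalized rank-two Drinfeld $\mathbf A$-module over $L$, with Anderson motive $M_\phi$ and attached point $V\in E(L)$. Then there exist elements $E_1,E_2\in M_\phi$ such that $$M_\phi=\mathbf A_L E_1\oplus V^{-1}\mathbf A_L E_2 .$$
   Context: Let $q$ be a prime power and $E: y^2+a_1xy+a_3y=x^3+a_2x^2+a_4x+a_6$ ($a_i\in\mathbb F_q$) an elliptic curve with point at infinity $\infty$; $\mathbf A=\mathbb F_q[x,y]$ is its coordinate ring. Let $\mathbb K=\mathbb F_q(\theta,\eta)$ be an isomorphic copy of $\mathbb F_q(x,y)$ via $x\mapsto\theta,\ y\mapsto\eta$; $L$ is an algebraically closed field containing $\mathbb K$; $\xi=(\theta,\eta)\in E(L)$; $\mathbf A_L=L\otimes_{\mathbb F_q}\mathbf A$; $\mathbf K_L$ is the function field of $E$ over $L$. For a divisor $D$ on $E_L$, $\mathcal L(D)$ is the Riemann–Roch space and $D^{-1}\mathbf A_L=\bigcup_{k\ge0}\mathcal L(D+k\infty)$. $\dotplus$ is the group law on $E(L)$, $P^\vee$ is the inverse of $P$, and $P^{(1)}=(a^q,b^q)$ for $P=(a,b)$. For $g\in\mathbf K_L$, $g^{(1)}$ is obtained by raising the coefficients in $L$ to the $q$-th power and fixing $x,y$. $L\{\tau\}$ is the twisted polynomial ring with $\tau c=c^q\tau$. A sign-normalized rank-two Drinfeld $\mathbf A$-module over $L$ is an $\mathbb F_q$-algebra homomorphism $\phi:\mathbf A\to L\{\tau\}$ with $\phi_x=\theta+g_1\tau+g_2\tau^2+g_3\tau^3+\tau^4$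 and $\phi_y=\eta+h_1\tau+\dots+h_5\tau^5+\tau^6$, $g_i,h_j\in L$. Its Anderson motive is $M_\phi=L\{\tau\}\cdot\mathbf s_\phi$, free of rank one over $L\{\tau\}$, with $\mathbf A$ acting by $a\cdot(\omega\mathbf s_\phi)=\omega\phi_a\mathbf s_\phi$; it is an $\mathbf A_L$-module with $\tau(gm)=g^{(1)}\tau m$. We regard $M_\phi\subset \mathbf K_L\otimes_{\mathbf A_L}M_\phi$. The attached point: $V=(\alpha,\beta)\in E(L)$ satisfies $V\dotplus(V^{(1)})^\vee=\xi$ and is such that $\wedge^2_{\mathbf A_L}M_\phi=V^{-1}\mathbf A_L\cdot S_0$ for some $S_0$ with $\tau S_0=-f_\alpha S_0$, where $f_\alpha=\frac{y-\eta-m(x-\theta)}{x-\alpha}$ and $m$ is the slope of the line through $\xi$, $V^{(1)}$, $V^\vee$; its divisor is $V^{(1)}+\xi-V-\infty$. *)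

theory Defs
  imports
    "HOL-Computational_Algebra.Computational_Algebra"
    "HOL-Library.Poly_Mapping"
    "HOL-Algebra.Module"
begin

text \<open>
  Throughout, \<open>'l\<close> is the algebraically closed field L, of characteristic p, and q is a power
  of p.  A bivariate polynomial is an element F of \<open>'l poly poly\<close>; the outer variable is y and
  the inner variable is x.
\<close>

subsection \<open>Weierstrass curves\<close>

text \<open>The subfield of L with q elements.\<close>

definition Fq :: "nat \<Rightarrow> 'l::field set" where
  "Fq q = {c. c ^ q = c}"

record 'l weierstrass =
  cf1 :: 'l
  cf2 :: 'l
  cf3 :: 'l
  cf4 :: 'l
  cf6 :: 'l

text \<open>\<open>y\<^sup>2 + a\<^sub>1 x y + a\<^sub>3 y - (x\<^sup>3 + a\<^sub>2 x\<^sup>2 + a\<^sub>4 x + a\<^sub>6)\<close>\<close>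

definition weierstrass_poly :: "'l::field weierstrass \<Rightarrow> 'l poly poly" where
  "weierstrass_poly E =
     [: - [: cf6 E, cf4 E, cf2 E, 1 :], [: cf3 E, cf1 E :], 1 :]"

definition eval2 :: "'l::comm_ring_1 poly poly \<Rightarrow> 'l \<Rightarrow> 'l \<Rightarrow> 'l" where
  "eval2 F a b = poly (poly F [:b:]) a"

datatype 'l point = Infinity | Affine 'l 'l

fun on_curve :: "'l::field weierstrass \<Rightarrow> 'l point \<Rightarrow> bool" where
  "on_curve E Infinity \<longleftrightarrow> True"
| "on_curve E (Affine a b) \<longleftrightarrow> eval2 (weierstrass_poly E) a b = 0"

text \<open>Smoothness is imposed at the affine L-points, L being algebraically closed; the point at
  infinity of a Weierstrass cubic is always smooth.\<close>

definition elliptic_curve_over_Fq :: "nat \<Rightarrow> 'l::field weierstrass \<Rightarrow> bool" where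
  "elliptic_curve_over_Fq q E \<longleftrightarrow>
     {cf1 E, cf2 E, cf3 E, cf4 E, cf6 E} \<subseteq> Fq q \<and>
     (\<forall>a b. on_curve E (Affine a b) \<longrightarrow>
        cf1 E * b - (3 * a ^ 2 + 2 * cf2 E * a + cf4 E) \<noteq> 0 \<or>
        2 * b + cf1 E * a + cf3 E \<noteq> 0)"

fun point_neg :: "'l::field weierstrass \<Rightarrow> 'l point \<Rightarrow> 'l point" where
  "point_neg E Infinity = Infinity"
| "point_neg E (Affine a b) = Affine a (- b - cf1 E * a - cf3 E)"

text \<open>Slope of the line through two affine points (the tangent line if they are equal); only
  meaningful if that line is not vertical.\<close>

definition line_slope :: "'l::field weierstrass \<Rightarrow> 'l \<times> 'l \<Rightarrow> 'l \<times> 'l \<Rightarrow> 'l" where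
  "line_slope E = (\<lambda>(a, b) (c, d).
     if a \<noteq> c then (d - b) / (c - a)
     else (3 * a ^ 2 + 2 * cf2 E * a + cf4 E - cf1 E * b) / (2 * b + cf1 E * a + cf3 E))"

fun point_add :: "'l::field weierstrass \<Rightarrow> 'l point \<Rightarrow> 'l point \<Rightarrow> 'l point" where
  "point_add E Infinity Q = Q"
| "point_add E (Affine a b) Infinity = Affine a b"
| "point_add E (Affine a b) (Affine c d) =
     (if Affine c d = point_neg E (Affine a b) then Infinity
      else let s = line_slope E (a, b) (c, d);
               x' = s ^ 2 + cf1 E * s - cf2 E - a - c
           in Affine x' (- (s + cf1 E) * x' - (b - s * a) - cf3 E))"

fun point_frob :: "nat \<Rightarrow> 'l::field point \<Rightarrow> 'l point" where
  "point_frob q Infinity = Infinity"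
| "point_frob q (Affine a b) = Affine (a ^ q) (b ^ q)"

subsection \<open>Coordinate ring and function field\<close>

text \<open>
  The coordinate ring of E over L is a ring \<open>'a\<close> together with a surjective homomorphism \<open>\<pi>\<close> from
  L[x,y] whose kernel is the ideal generated by the Weierstrass polynomial; this determines
  \<open>('a, \<pi>)\<close> up to unique isomorphism.  The function field is then \<open>'a fract\<close>, and the coordinate
  ring over \<open>F\<^sub>q\<close> is the image under \<open>\<pi>\<close> of the polynomials with coefficients in \<open>F\<^sub>q\<close>.
\<close>

definition coordinate_ring ::
    "'l::field weierstrass \<Rightarrow> ('l poly poly \<Rightarrow> 'a::idom) \<Rightarrow> bool" where
  "coordinate_ring E \<pi> \<longleftrightarrow>
     \<pi> 1 = 1 \<and> (\<forall>F G. \<pi> (F + G) = \<pi> F + \<pi> G) \<and> (\<forall>F G. \<pi> (F * G) = \<pi> F * \<pi> G) \<and>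
     surj \<pi> \<and> (\<forall>F. \<pi> F = 0 \<longleftrightarrow> weierstrass_poly E dvd F)"

definition const_A :: "('l::field poly poly \<Rightarrow> 'a::idom) \<Rightarrow> 'l \<Rightarrow> 'a" where
  "const_A \<pi> c = \<pi> [:[:c:]:]"

definition x_A :: "('l::field poly poly \<Rightarrow> 'a::idom) \<Rightarrow> 'a" where
  "x_A \<pi> = \<pi> [:[:0, 1:]:]"

definition y_A :: "('l::field poly poly \<Rightarrow> 'a::idom) \<Rightarrow> 'a" where
  "y_A \<pi> = \<pi> [:0, 1:]"

definition Fq_polys :: "nat \<Rightarrow> 'l::field poly poly set" where
  "Fq_polys q = {F. \<forall>i j. coeff (coeff F j) i \<in> Fq q}"

definition coord_ring_Fq :: "nat \<Rightarrow> ('l::field poly poly \<Rightarrow> 'a::idom) \<Rightarrow> 'a set" where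
  "coord_ring_Fq q \<pi> = \<pi> ` Fq_polys q"

text \<open>Evaluation at \<open>(\<theta>,\<eta>)\<close> is a well-defined injective map from the coordinate ring over \<open>F\<^sub>q\<close>
  to L, i.e. \<open>x \<mapsto> \<theta>, y \<mapsto> \<eta>\<close> identifies \<open>F\<^sub>q(x,y)\<close> with the subfield \<open>F\<^sub>q(\<theta>,\<eta>)\<close> of L.\<close>

definition generic_point ::
    "nat \<Rightarrow> ('l::field poly poly \<Rightarrow> 'a::idom) \<Rightarrow> 'l \<Rightarrow> 'l \<Rightarrow> bool" where
  "generic_point q \<pi> \<theta> \<eta> \<longleftrightarrow>
     (\<forall>F \<in> Fq_polys q. eval2 F \<theta> \<eta> = 0 \<longleftrightarrow> \<pi> F = 0)"

text \<open>The operation \<open>g \<mapsto> g\<^sup>(\<^sup>1\<^sup>)\<close>.  For \<open>coordinate_ring E \<pi>\<close> with E defined over \<open>F\<^sub>q\<close> it does not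
  depend on the chosen preimage of g in L[x,y].\<close>

definition twist :: "nat \<Rightarrow> ('l::field poly poly \<Rightarrow> 'a::idom) \<Rightarrow> 'a \<Rightarrow> 'a" where
  "twist q \<pi> g = \<pi> (map_poly (map_poly (\<lambda>c. c ^ q)) (inv_into UNIV \<pi> g))"

definition const_K :: "('l::field poly poly \<Rightarrow> 'a::idom) \<Rightarrow> 'l \<Rightarrow> 'a fract" where
  "const_K \<pi> c = to_fract (const_A \<pi> c)"

definition x_K :: "('l::field poly poly \<Rightarrow> 'a::idom) \<Rightarrow> 'a fract" where
  "x_K \<pi> = to_fract (x_A \<pi>)"

definition y_K :: "('l::field poly poly \<Rightarrow> 'a::idom) \<Rightarrow> 'a fract" where
  "y_K \<pi> = to_fract (y_A \<pi>)"

definition A_in_K :: "'a::idom fract set" where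
  "A_in_K = range to_fract"

subsection \<open>Local rings, orders of vanishing, Riemann-Roch spaces\<close>

text \<open>
  Affine charts of the projective curve: for an affine point the coordinate functions x, y and the
  coordinates of the point; for the point at infinity [0:1:0] the functions x/y, 1/y, which vanish
  there.
\<close>

fun chart_funs ::
    "('l::field poly poly \<Rightarrow> 'a::idom) \<Rightarrow> 'l point \<Rightarrow> 'a fract \<times> 'a fract" where
  "chart_funs \<pi> (Affine a b) = (x_K \<pi>, y_K \<pi>)"
| "chart_funs \<pi> Infinity = (x_K \<pi> / y_K \<pi>, 1 / y_K \<pi>)"

fun chart_coords :: "'l::field point \<Rightarrow> 'l \<times> 'l" where
  "chart_coords (Affine a b) = (a, b)"
| "chart_coords Infinity = (0, 0)"

definition chart_eval ::
    "('l::field poly poly \<Rightarrow> 'a::idom) \<Rightarrow> 'l point \<Rightarrow> 'l poly poly \<Rightarrow> 'a fract" where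
  "chart_eval \<pi> P F = (case chart_funs \<pi> P of (s, t) \<Rightarrow>
     eval2 (map_poly (map_poly (const_K \<pi>)) F) s t)"

definition value_at :: "'l::field point \<Rightarrow> 'l poly poly \<Rightarrow> 'l" where
  "value_at P F = (case chart_coords P of (a, b) \<Rightarrow> eval2 F a b)"

definition local_ring ::
    "('l::field poly poly \<Rightarrow> 'a::idom) \<Rightarrow> 'l point \<Rightarrow> 'a fract set" where
  "local_ring \<pi> P =
     {chart_eval \<pi> P F / chart_eval \<pi> P G | F G. value_at P G \<noteq> 0}"

definition max_ideal ::
    "('l::field poly poly \<Rightarrow> 'a::idom) \<Rightarrow> 'l point \<Rightarrow> 'a fract set" where
  "max_ideal \<pi> P =
     {chart_eval \<pi> P F / chart_eval \<pi> P G | F G. value_at P F = 0 \<and> value_at P G \<noteq> 0}"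

text \<open>The order at P of a nonzero rational function: the exponent n with \<open>g = u t\<^sup>n\<close>, for a
  uniformizer t and a unit u of the discrete valuation ring at P.\<close>

definition ord_at ::
    "('l::field poly poly \<Rightarrow> 'a::idom) \<Rightarrow> 'l point \<Rightarrow> 'a fract \<Rightarrow> int" where
  "ord_at \<pi> P g = (THE n. \<exists>t u.
     max_ideal \<pi> P = (\<lambda>h. t * h) ` local_ring \<pi> P \<and>
     u \<in> local_ring \<pi> P - max_ideal \<pi> P \<and> g = u * t powi n)"

definition riemann_roch_space ::
    "'l::field weierstrass \<Rightarrow> ('l poly poly \<Rightarrow> 'a::idom) \<Rightarrow> ('l point \<Rightarrow> int) \<Rightarrow> 'a fract set"
  where
  "riemann_roch_space E \<pi> D =
     {g. g = 0 \<or> (\<forall>P. on_curve E P \<longrightarrow> ord_at \<pi> P g + D P \<ge> 0)}"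

definition point_divisor :: "'l point \<Rightarrow> 'l point \<Rightarrow> int" where
  "point_divisor P = (\<lambda>Q. if Q = P then 1 else 0)"

text \<open>The fractional ideal \<open>D\<^sup>-\<^sup>1 A\<^sub>L\<close>.\<close>

definition inverse_ideal ::
    "'l::field weierstrass \<Rightarrow> ('l poly poly \<Rightarrow> 'a::idom) \<Rightarrow> ('l point \<Rightarrow> int) \<Rightarrow> 'a fract set"
  where
  "inverse_ideal E \<pi> D =
     (\<Union>k::nat. riemann_roch_space E \<pi> (\<lambda>Q. D Q + int k * point_divisor Infinity Q))"

subsection \<open>Formal linear combinations, extension of scalars, exterior square\<close>

text \<open>\<open>'s \<Rightarrow>\<^sub>0 'r\<close> is the free \<open>'r\<close>-module on the symbols \<open>'s\<close>; \<open>Poly_Mapping.single s r\<close> is r times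
  the symbol s.\<close>

definition fscale :: "'r::comm_ring_1 \<Rightarrow> ('s \<Rightarrow>\<^sub>0 'r) \<Rightarrow> ('s \<Rightarrow>\<^sub>0 'r)" where
  "fscale r u = Poly_Mapping.map ((*) r) u"

lemma lookup_fscale: "Poly_Mapping.lookup (fscale r u) s = r * Poly_Mapping.lookup u s"
  by (simp add: fscale_def Poly_Mapping.map.rep_eq when_def)

lemma module_fscale: "Modules.module fscale"
  by standard
    (auto intro!: poly_mapping_eqI simp: lookup_fscale lookup_add algebra_simps)

definition fspan :: "('s \<Rightarrow>\<^sub>0 'r::comm_ring_1) set \<Rightarrow> ('s \<Rightarrow>\<^sub>0 'r) set" where
  "fspan B = Modules.module.span fscale B"

text \<open>
  For a module N over \<open>'a\<close>, the extension of scalars of N to K = \<open>'a fract\<close> is the free K-module on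
  the symbols \<open>1 \<otimes> n\<close>, modulo the K-span of the relations below.  Its elements are represented by
  cosets of the span, \<open>base_class N u\<close> being the class of the formal sum u.
\<close>

definition base_rels :: "('a::idom, 'n) module \<Rightarrow> ('n \<Rightarrow>\<^sub>0 'a fract) set" where
  "base_rels N = fspan
     ({Poly_Mapping.single (m \<oplus>\<^bsub>N\<^esub> n) 1 - Poly_Mapping.single m 1 - Poly_Mapping.single n 1 | m n.
         m \<in> carrier N \<and> n \<in> carrier N} \<union>
      {Poly_Mapping.single (a \<odot>\<^bsub>N\<^esub> n) 1 - Poly_Mapping.single n (to_fract a) | a n.
         n \<in> carrier N})"

definition base_class ::
    "('a::idom, 'n) module \<Rightarrow> ('n \<Rightarrow>\<^sub>0 'a fract) \<Rightarrow> ('n \<Rightarrow>\<^sub>0 'a fract) set" where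
  "base_class N u = {v. v - u \<in> base_rels N}"

definition tensor ::
    "('a::idom, 'n) module \<Rightarrow> 'a fract \<Rightarrow> 'n \<Rightarrow> ('n \<Rightarrow>\<^sub>0 'a fract) set" where
  "tensor N g n = base_class N (Poly_Mapping.single n g)"

text \<open>The image of N under \<open>n \<mapsto> 1 \<otimes> n\<close>.\<close>

definition lattice_of :: "('a::idom, 'n) module \<Rightarrow> ('n \<Rightarrow>\<^sub>0 'a fract) set set" where
  "lattice_of N = tensor N 1 ` carrier N"

text \<open>The submodule \<open>I \<cdot> e\<close> of the extension of scalars, for a fractional ideal I and e in N.\<close>

definition ideal_times ::
    "('a::idom, 'n) module \<Rightarrow> 'a fract set \<Rightarrow> 'n \<Rightarrow> ('n \<Rightarrow>\<^sub>0 'a fract) set set" where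
  "ideal_times N I e = (\<lambda>g. tensor N g e) ` I"

definition coset_plus :: "'u::plus set \<Rightarrow> 'u set \<Rightarrow> 'u set" where
  "coset_plus C D = {c + d | c d. c \<in> C \<and> d \<in> D}"

definition internal_direct_sum ::
    "('a::idom, 'n) module \<Rightarrow> ('n \<Rightarrow>\<^sub>0 'a fract) set set \<Rightarrow> ('n \<Rightarrow>\<^sub>0 'a fract) set set
       \<Rightarrow> ('n \<Rightarrow>\<^sub>0 'a fract) set set \<Rightarrow> bool" where
  "internal_direct_sum N S P Q \<longleftrightarrow>
     S = {coset_plus C D | C D. C \<in> P \<and> D \<in> Q} \<and> P \<inter> Q = {base_class N 0}"

text \<open>The exterior square: the free module on the symbols \<open>m \<and> n\<close>, represented by the pairs (m, n),
  modulo bilinearity and \<open>m \<and> m = 0\<close>.  The record type \<open>module\<close> extends that of rings; the fields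
  \<open>mult\<close> and \<open>one\<close> play no role.\<close>

definition ext_rels :: "('a::idom, 'm) module \<Rightarrow> ('m \<times> 'm \<Rightarrow>\<^sub>0 'a) set" where
  "ext_rels M = fspan
     ({Poly_Mapping.single (m \<oplus>\<^bsub>M\<^esub> m', n) 1 - Poly_Mapping.single (m, n) 1
         - Poly_Mapping.single (m', n) 1 | m m' n.
         m \<in> carrier M \<and> m' \<in> carrier M \<and> n \<in> carrier M} \<union>
      {Poly_Mapping.single (m, n \<oplus>\<^bsub>M\<^esub> n') 1 - Poly_Mapping.single (m, n) 1
         - Poly_Mapping.single (m, n') 1 | m n n'.
         m \<in> carrier M \<and> n \<in> carrier M \<and> n' \<in> carrier M} \<union>
      {Poly_Mapping.single (a \<odot>\<^bsub>M\<^esub> m, n) 1 - Poly_Mapping.single (m, n) a | a m n.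
         m \<in> carrier M \<and> n \<in> carrier M} \<union>
      {Poly_Mapping.single (m, a \<odot>\<^bsub>M\<^esub> n) 1 - Poly_Mapping.single (m, n) a | a m n.
         m \<in> carrier M \<and> n \<in> carrier M} \<union>
      {Poly_Mapping.single (m, m) 1 | m. m \<in> carrier M})"

definition ext_class ::
    "('a::idom, 'm) module \<Rightarrow> ('m \<times> 'm \<Rightarrow>\<^sub>0 'a) \<Rightarrow> ('m \<times> 'm \<Rightarrow>\<^sub>0 'a) set" where
  "ext_class M u = {v. v - u \<in> ext_rels M}"

definition ext_square ::
    "('a::idom, 'm) module \<Rightarrow> ('a, ('m \<times> 'm \<Rightarrow>\<^sub>0 'a) set) module" where
  "ext_square M =
     \<lparr> carrier = {ext_class M u | u. Poly_Mapping.keys u \<subseteq> carrier M \<times> carrier M},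
       mult = undefined, one = undefined,
       zero = ext_class M 0,
       add = coset_plus,
       smult = (\<lambda>a C. coset_plus (fscale a ` C) (ext_rels M)) \<rparr>"

text \<open>The semilinear operator on the exterior square with \<open>a (m \<and> n) \<mapsto> \<sigma>(a) (\<tau> m \<and> \<tau> n)\<close>, for a
  \<open>\<sigma>\<close>-semilinear operator \<open>\<tau>\<close> on M.\<close>

definition ext_lift ::
    "('a::idom \<Rightarrow> 'a) \<Rightarrow> ('m \<Rightarrow> 'm) \<Rightarrow> ('m \<times> 'm \<Rightarrow>\<^sub>0 'a) \<Rightarrow> ('m \<times> 'm \<Rightarrow>\<^sub>0 'a)" where
  "ext_lift \<sigma> \<tau> u = (\<Sum>(m, n) \<in> Poly_Mapping.keys u.
     Poly_Mapping.single (\<tau> m, \<tau> n) (\<sigma> (Poly_Mapping.lookup u (m, n))))"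

definition ext_tau ::
    "('a::idom, 'm) module \<Rightarrow> ('a \<Rightarrow> 'a) \<Rightarrow> ('m \<Rightarrow> 'm)
       \<Rightarrow> ('m \<times> 'm \<Rightarrow>\<^sub>0 'a) set \<Rightarrow> ('m \<times> 'm \<Rightarrow>\<^sub>0 'a) set" where
  "ext_tau M \<sigma> \<tau> C = coset_plus (ext_lift \<sigma> \<tau> ` C) (ext_rels M)"

subsection \<open>Drinfeld modules and their motives\<close>

text \<open>A twisted polynomial \<open>\<Sum>\<^sub>i c\<^sub>i \<tau>\<^sup>i\<close> is stored as the element of \<open>'l poly\<close> with the coefficients
  \<open>c\<^sub>i\<close>; addition and left multiplication by constants are those of \<open>'l poly\<close>, but the product is
  the following one, determined by \<open>\<tau> c = c\<^sup>q \<tau>\<close>.\<close>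

definition tmult :: "nat \<Rightarrow> 'l::field poly \<Rightarrow> 'l poly \<Rightarrow> 'l poly" where
  "tmult q f g = (\<Sum>i\<le>degree f. \<Sum>j\<le>degree g.
     monom (coeff f i * coeff g j ^ (q ^ i)) (i + j))"

text \<open>Only the values of \<open>\<phi>\<close> on the coordinate ring over \<open>F\<^sub>q\<close> matter.\<close>

definition sign_normalized_drinfeld_rank2 ::
    "nat \<Rightarrow> ('l::field poly poly \<Rightarrow> 'a::idom) \<Rightarrow> 'l \<Rightarrow> 'l \<Rightarrow> ('a \<Rightarrow> 'l poly) \<Rightarrow> bool" where
  "sign_normalized_drinfeld_rank2 q \<pi> \<theta> \<eta> \<phi> \<longleftrightarrow>
     (\<forall>a \<in> coord_ring_Fq q \<pi>. \<forall>b \<in> coord_ring_Fq q \<pi>.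
        \<phi> (a + b) = \<phi> a + \<phi> b \<and> \<phi> (a * b) = tmult q (\<phi> a) (\<phi> b)) \<and>
     (\<forall>c \<in> Fq q. \<phi> (const_A \<pi> c) = [:c:]) \<and>
     (\<exists>g1 g2 g3. \<phi> (x_A \<pi>) = [:\<theta>, g1, g2, g3, 1:]) \<and>
     (\<exists>h1 h2 h3 h4 h5. \<phi> (y_A \<pi>) = [:\<eta>, h1, h2, h3, h4, h5, 1:])"

text \<open>
  The Anderson motive is the left module of twisted polynomials, the generator \<open>s\<^sub>\<phi>\<close> being 1.
  An element c of L and an element a of the coordinate ring over \<open>F\<^sub>q\<close> act by
  \<open>\<omega> \<mapsto> c \<omega> \<phi>\<^sub>a\<close>; so \<open>g = \<Sum> c\<^sub>i\<^sub>j x\<^sup>i y\<^sup>j\<close> acts by the formula below, whose value does not depend on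
  the chosen preimage of g in L[x,y] if \<open>\<phi>\<close> is a Drinfeld module.
\<close>

definition motive_act ::
    "nat \<Rightarrow> ('l::field poly poly \<Rightarrow> 'a::idom) \<Rightarrow> ('a \<Rightarrow> 'l poly) \<Rightarrow> 'a \<Rightarrow> 'l poly \<Rightarrow> 'l poly" where
  "motive_act q \<pi> \<phi> g \<omega> = (let F = inv_into UNIV \<pi> g in
     \<Sum>j\<le>degree F. \<Sum>i\<le>degree (coeff F j).
       Polynomial.smult (coeff (coeff F j) i) (tmult q \<omega> (\<phi> (x_A \<pi> ^ i * y_A \<pi> ^ j))))"

definition motive ::
    "nat \<Rightarrow> ('l::field poly poly \<Rightarrow> 'a::idom) \<Rightarrow> ('a \<Rightarrow> 'l poly) \<Rightarrow> ('a, 'l poly) module" where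
  "motive q \<pi> \<phi> =
     \<lparr> carrier = UNIV, mult = undefined, one = undefined, zero = 0, add = (+),
       smult = motive_act q \<pi> \<phi> \<rparr>"

definition motive_tau :: "nat \<Rightarrow> 'l::field poly \<Rightarrow> 'l poly" where
  "motive_tau q \<omega> = tmult q [:0, 1:] \<omega>"

text \<open>\<open>f\<^sub>\<alpha>\<close> is \<open>(y - \<eta> - m (x - \<theta>)) / (x - \<alpha>)\<close>, with m the slope of the line through \<open>\<xi>\<close> and
  \<open>V\<^sup>(\<^sup>1\<^sup>)\<close>; the third point of E on this line is the inverse of V.\<close>

definition shtuka_function ::
    "nat \<Rightarrow> 'l::field weierstrass \<Rightarrow> ('l poly poly \<Rightarrow> 'a::idom) \<Rightarrow> 'l \<Rightarrow> 'l \<Rightarrow> 'l \<Rightarrow> 'l \<Rightarrow> 'a fract"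
  where
  "shtuka_function q E \<pi> \<theta> \<eta> \<alpha> \<beta> =
     (let m = line_slope E (\<theta>, \<eta>) (\<alpha> ^ q, \<beta> ^ q) in
      (y_K \<pi> - const_K \<pi> \<eta> - const_K \<pi> m * (x_K \<pi> - const_K \<pi> \<theta>))
        / (x_K \<pi> - const_K \<pi> \<alpha>))"

text \<open>\<open>V = (\<alpha>,\<beta>)\<close> is the point attached to \<open>\<phi>\<close>.  The generator \<open>S\<^sub>0\<close> lies in the exterior square
  itself, because \<open>V\<^sup>-\<^sup>1 A\<^sub>L\<close> contains 1.\<close>

definition attached_point ::
    "nat \<Rightarrow> 'l::field weierstrass \<Rightarrow> ('l poly poly \<Rightarrow> 'a::idom) \<Rightarrow> 'l \<Rightarrow> 'l \<Rightarrow> ('a \<Rightarrow> 'l poly)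
       \<Rightarrow> 'l \<Rightarrow> 'l \<Rightarrow> bool" where
  "attached_point q E \<pi> \<theta> \<eta> \<phi> \<alpha> \<beta> \<longleftrightarrow>
     (let V = Affine \<alpha> \<beta>; M = motive q \<pi> \<phi>; N = ext_square M in
      on_curve E V \<and>
      point_add E V (point_neg E (point_frob q V)) = Affine \<theta> \<eta> \<and>
      (\<exists>S0 \<in> carrier N.
         lattice_of N = ideal_times N (inverse_ideal E \<pi> (point_divisor V)) S0 \<and>
         tensor N 1 (ext_tau M (twist q \<pi>) (motive_tau q) S0)
           = tensor N (- shtuka_function q E \<pi> \<theta> \<eta> \<alpha> \<beta>) S0))"

end

theory Submission
  imports Defs "HOL-Library.Product_Plus"
begin

text \<open>
  The statement is Steinitz's theorem for the projective module \<open>M = M\<^sub>\<phi>\<close> of rank two over the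
  Dedekind domain \<open>A = A\<^sub>L\<close>: such a module is isomorphic to \<open>A \<oplus> \<Lambda>\<^sup>2 M\<close>, and \<open>\<Lambda>\<^sup>2 M\<close> is \<open>V\<^sup>-\<^sup>1 A\<close> up to a
  factor in \<open>K = Frac A\<close> by the choice of V. The shape of the motive makes a direct proof
  possible.

  The degree in \<open>\<tau>\<close> shows that the submodule generated by \<open>1\<close> and \<open>\<tau>\<close> is free and has codimension 2 in
  M (\<open>act_parity\<close>, \<open>motive_generators\<close>). Coordinates in this basis embed M as a lattice \<open>\<Lambda>\<close> in \<open>K\<^sup>2\<close>, and
  the determinant identifies \<open>\<Lambda>\<^sup>2 M\<close> with the fractional ideal W generated by all \<open>m \<and> n\<close>, where m
  and n run through \<open>\<Lambda>\<close>. The property of the attached point becomes \<open>W = c V\<^sup>-\<^sup>1\<close> with \<open>c \<noteq> 0\<close>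
  (\<open>wedge_ideal_of_ext_square\<close>).

  Let \<open>e = (1, 0)\<close> be the image of 1 and let I be the ideal with \<open>K e \<inter> \<Lambda> = I e\<close>. All elements of
  \<open>I e\<close> have even degree, and 2 is the only even degree that \<open>A e\<close> misses; so I is either A or \<open>P\<^sup>-\<^sup>1\<close>
  for a point P (\<open>coeff_ideal_one\<close>). As I and W are invertible, the ideal \<open>H = e \<and> \<Lambda>\<close> satisfies
  \<open>I H = W\<close> (\<open>coeff_ideal_wedge_image\<close>), and \<open>\<Lambda> = I e + H f\<close> for some f with \<open>e \<and> f = 1\<close>. Finally \<open>I \<oplus> H\<close>
  is turned into \<open>A \<oplus> I H\<close> by a unimodular matrix (\<open>steinitz_rank_two\<close>), whose entries are easy to
  find because I involves at most one point (\<open>comaximal_generators\<close>). The result is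
  \<open>\<Lambda> = A e' + V\<^sup>-\<^sup>1 (c g)\<close>.

  The facts on the curve that this uses are elementary consequences of the identity
  \<open>(y - b) (y - b') = (x - a) Q\<close> on E, for a point \<open>(a, b)\<close> with conjugate \<open>(a, b')\<close>: the ideal of a
  point is invertible (\<open>point_inverse_invertible\<close>), proper ideals have zeros (\<open>nullstellensatz\<close>),
  and the local rings at the affine points are discrete valuation rings, so that the ideal
  \<open>V\<^sup>-\<^sup>1 A\<close>, defined by orders of vanishing, is the inverse of the ideal of V (\<open>inverse_ideal_point\<close>).
\<close>

section \<open>Fractional ideals of an integral domain\<close>

text \<open>
  Fractional ideals are treated as submodules of the field of fractions K; finiteness enters
  through explicit assumptions of invertibility.
\<close>

interpretation frac: Modules.module "\<lambda>(a::'a::idom) (g::'a fract). to_fract a * g"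
  by standard (auto simp: algebra_simps)

(* Together with mult.assoc this simplification rule does not terminate. *)
declare frac.scale_scale [simp del]

lemma frac_subspaceI:
  assumes "0 \<in> S" "\<And>g h. g \<in> S \<Longrightarrow> h \<in> S \<Longrightarrow> g + h \<in> S" "\<And>a g. g \<in> S \<Longrightarrow> to_fract a * g \<in> S"
  shows "frac.subspace S"
  using assms by (simp add: frac.subspace_def)

lemma A_in_K_iff: "g \<in> A_in_K \<longleftrightarrow> (\<exists>a. g = to_fract a)"
  by (auto simp: A_in_K_def)

lemma to_fract_in_A [simp, intro]: "to_fract a \<in> A_in_K"
  by (simp add: A_in_K_def)

lemma zero_in_A [simp]: "0 \<in> A_in_K" and one_in_A [simp]: "1 \<in> A_in_K"
  using to_fract_0 to_fract_1 by (metis to_fract_in_A)+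

lemma A_mult: "g \<in> A_in_K \<Longrightarrow> h \<in> A_in_K \<Longrightarrow> g * h \<in> A_in_K"
  by (metis A_in_K_iff to_fract_mult)

lemma A_uminus: "g \<in> A_in_K \<Longrightarrow> - g \<in> A_in_K"
  by (metis A_in_K_iff to_fract_uminus)

lemma subspace_A: "frac.subspace A_in_K"
  by (rule frac_subspaceI) (auto simp: A_in_K_iff simp flip: to_fract_add to_fract_mult)

lemma subspace_A_mult: "frac.subspace S \<Longrightarrow> a \<in> A_in_K \<Longrightarrow> g \<in> S \<Longrightarrow> a * g \<in> S"
  by (auto simp: A_in_K_iff frac.subspace_scale)

lemma fract_cases_quotient:
  fixes g :: "'a::idom fract"
  obtains n d where "d \<noteq> 0" "to_fract d * g = to_fract n"
  by (cases g) (auto simp: Fract_conv_to_fract field_simps)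

definition ideal_mult :: "'a::idom fract set \<Rightarrow> 'a fract set \<Rightarrow> 'a fract set" where
  "ideal_mult S T = frac.span {s * t | s t. s \<in> S \<and> t \<in> T}"

lemma subspace_ideal_mult [simp]: "frac.subspace (ideal_mult S T)"
  by (simp add: ideal_mult_def)

lemma ideal_multI: "s \<in> S \<Longrightarrow> t \<in> T \<Longrightarrow> s * t \<in> ideal_mult S T"
  unfolding ideal_mult_def by (rule frac.span_base) blast

lemma ideal_mult_subset_iff:
  "frac.subspace U \<Longrightarrow> ideal_mult S T \<subseteq> U \<longleftrightarrow> (\<forall>s\<in>S. \<forall>t\<in>T. s * t \<in> U)"
  unfolding ideal_mult_def
  by (rule iffI, use frac.span_superset in fastforce, rule frac.span_minimal) auto

lemma ideal_mult_mono: "S \<subseteq> S' \<Longrightarrow> T \<subseteq> T' \<Longrightarrow> ideal_mult S T \<subseteq> ideal_mult S' T'"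
  unfolding ideal_mult_def by (rule frac.span_mono) blast

lemma ideal_mult_commute: "ideal_mult S T = ideal_mult T S"
proof -
  have "ideal_mult S T \<subseteq> ideal_mult T S" for S T :: "'a fract set"
  proof (subst ideal_mult_subset_iff; safe?)
    show "s * t \<in> ideal_mult T S" if "s \<in> S" "t \<in> T" for s t
      using ideal_multI[OF that(2,1)] by (simp add: mult.commute)
  qed simp
  then show ?thesis by blast
qed

lemma ideal_mult_one: "frac.subspace S \<Longrightarrow> ideal_mult A_in_K S = S"
  by (rule antisym, subst ideal_mult_subset_iff, simp_all add: subspace_A_mult)
    (metis ideal_multI mult_1 one_in_A subsetI)

lemma ideal_mult_one_right: "frac.subspace S \<Longrightarrow> ideal_mult S A_in_K = S"
  using ideal_mult_one ideal_mult_commute by metis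

text \<open>
  Most inclusions between products of ideals are obtained by observing that \<open>{g. g T \<subseteq> U}\<close> is
  again a submodule, so that a containment only has to be tested on products of generators.
\<close>

lemma frac_subspace_colon: "frac.subspace U \<Longrightarrow> frac.subspace {g. \<forall>t\<in>T. g * t \<in> U}"
  by (auto intro!: frac_subspaceI simp: frac.subspace_0 frac.subspace_add distrib_right mult.assoc
      frac.subspace_scale)

lemma ideal_mult_assoc_subset: "ideal_mult (ideal_mult S T) U \<subseteq> ideal_mult S (ideal_mult T U)"
proof -
  have "ideal_mult S T \<subseteq> {g. \<forall>u\<in>U. g * u \<in> ideal_mult S (ideal_mult T U)}"
    by (subst ideal_mult_subset_iff)
      (auto intro!: frac_subspace_colon ideal_multI simp: mult.assoc)
  then show ?thesis
    by (subst ideal_mult_subset_iff) auto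
qed

lemma ideal_mult_assoc: "ideal_mult (ideal_mult S T) U = ideal_mult S (ideal_mult T U)"
  using ideal_mult_assoc_subset[of S T U] ideal_mult_assoc_subset[of U T S]
  by (simp add: ideal_mult_commute subset_antisym)

lemma ideal_mult_left_commute: "ideal_mult S (ideal_mult T U) = ideal_mult T (ideal_mult S U)"
  by (metis ideal_mult_assoc ideal_mult_commute)

lemmas ideal_mult_ac = ideal_mult_assoc ideal_mult_commute ideal_mult_left_commute

section \<open>Rank two lattices with an invertible exterior square\<close>

definition vscale :: "'a::idom fract \<Rightarrow> 'a fract \<times> 'a fract \<Rightarrow> 'a fract \<times> 'a fract" where
  "vscale u v = (u * fst v, u * snd v)"

definition wedge :: "'a::idom fract \<times> 'a fract \<Rightarrow> 'a fract \<times> 'a fract \<Rightarrow> 'a fract" where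
  "wedge v w = fst v * snd w - snd v * fst w"

interpretation plane: Modules.module "\<lambda>(a::'a::idom). vscale (to_fract a)"
  by standard (simp_all add: vscale_def prod_eq_iff distrib_left distrib_right mult.assoc)

lemma vscale_simps:
  "vscale u (v + w) = vscale u v + vscale u w" "vscale (u + u') v = vscale u v + vscale u' v"
  "vscale u (vscale u' v) = vscale (u * u') v" "vscale 0 v = 0" "vscale 1 v = v"
  by (simp_all add: vscale_def distrib_left distrib_right mult.assoc prod_eq_iff)

lemma vscale_commute: "vscale u (vscale v x) = vscale v (vscale u x)"
  by (simp add: vscale_simps mult.commute)

lemma wedge_simps:
  "wedge (v + v') w = wedge v w + wedge v' w" "wedge v (w + w') = wedge v w + wedge v w'"
  "wedge (vscale u v) w = u * wedge v w" "wedge v (vscale u w) = u * wedge v w" "wedge v v = 0"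
  "wedge 0 w = 0" "wedge v 0 = 0"
  by (simp_all add: wedge_def vscale_def algebra_simps)

lemma plane_expand:
  assumes "wedge v w = 1"
  shows "m = vscale (wedge m w) v + vscale (wedge v m) w"
proof -
  have 1: "fst m = (fst v * snd w - snd v * fst w) * fst m"
    and 2: "snd m = (fst v * snd w - snd v * fst w) * snd m"
    using assms by (simp_all add: wedge_def)
  show ?thesis
    by (rule prod_eqI; subst 1 2) (simp_all add: vscale_def wedge_def algebra_simps)
qed

text \<open>
  For a lattice \<open>\<Lambda>\<close> in \<open>K\<^sup>2\<close>, the determinant identifies \<open>K \<otimes> \<Lambda>\<^sup>2 \<Lambda>\<close> with K, and the following is the
  image of \<open>\<Lambda>\<^sup>2 \<Lambda>\<close>.
\<close>

definition wedge_ideal :: "('a::idom fract \<times> 'a fract) set \<Rightarrow> 'a fract set" where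
  "wedge_ideal \<Lambda> = frac.span {wedge m n | m n. m \<in> \<Lambda> \<and> n \<in> \<Lambda>}"

text \<open>
  The ideal I with \<open>K e \<inter> \<Lambda> = I e\<close>.
\<close>

definition coeff_ideal :: "('a::idom fract \<times> 'a fract) set \<Rightarrow> 'a fract \<times> 'a fract \<Rightarrow> 'a fract set" where
  "coeff_ideal \<Lambda> e = {u. vscale u e \<in> \<Lambda>}"

lemma subspace_coeff_ideal: "plane.subspace \<Lambda> \<Longrightarrow> frac.subspace (coeff_ideal \<Lambda> e)"
  by (rule frac_subspaceI)
    (auto simp: coeff_ideal_def vscale_simps plane.subspace_0 plane.subspace_add
      simp flip: vscale_simps(3) intro: plane.subspace_scale)

lemma subspace_wedge_image: "plane.subspace \<Lambda> \<Longrightarrow> frac.subspace (wedge e ` \<Lambda>)"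
proof (rule frac_subspaceI)
  assume L: "plane.subspace \<Lambda>"
  show "0 \<in> wedge e ` \<Lambda>"
    using plane.subspace_0[OF L] by (metis imageI wedge_simps(7))
  show "g + h \<in> wedge e ` \<Lambda>" if "g \<in> wedge e ` \<Lambda>" "h \<in> wedge e ` \<Lambda>" for g h
    using that by (elim imageE) (simp add: plane.subspace_add[OF L] flip: wedge_simps(2))
  show "to_fract a * g \<in> wedge e ` \<Lambda>" if "g \<in> wedge e ` \<Lambda>" for g a
    using that by (elim imageE) (simp add: plane.subspace_scale[OF L] flip: wedge_simps(4))
qed

lemma plane_subspace_A: "plane.subspace \<Lambda> \<Longrightarrow> a \<in> A_in_K \<Longrightarrow> m \<in> \<Lambda> \<Longrightarrow> vscale a m \<in> \<Lambda>"
  by (auto simp: A_in_K_iff plane.subspace_scale)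

text \<open>
  Write I for the coefficient ideal of e, H for \<open>e \<and> \<Lambda>\<close> and W for the ideal of all \<open>m \<and> n\<close>. The
  sequence \<open>0 \<rightarrow> I e \<rightarrow> \<Lambda> \<rightarrow> H \<rightarrow> 0\<close> suggests \<open>I H = W\<close>, but to split it one would already need H to be
  invertible. The argument below needs only that I and W are.

  The inclusion \<open>I H \<subseteq> W\<close> is clear, so \<open>\<aa> = I H W\<^sup>-\<^sup>1\<close> is an integral ideal. If it were proper, some h
  outside A would satisfy \<open>h \<aa> \<subseteq> A\<close>, that is \<open>d H \<subseteq> A\<close> for all d in \<open>h I W\<^sup>-\<^sup>1\<close>. By the Pluecker
  relation \<open>(m \<and> n) e = (e \<and> n) m - (e \<and> m) n\<close>, then \<open>d W e \<subseteq> \<Lambda>\<close>, so \<open>h I W\<^sup>-\<^sup>1 W \<subseteq> I\<close>; cancelling the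
  invertible ideals W and I leaves \<open>h \<in> A\<close>.

  The hypothesis that proper nonzero ideals have denominators outside A replaces the general
  theory of Dedekind domains.
\<close>

lemma coeff_ideal_wedge_image:
  fixes \<Lambda> :: "('a::idom fract \<times> 'a fract) set"
  assumes dedekind: "\<And>\<aa>::'a fract set. frac.subspace \<aa> \<Longrightarrow> \<aa> \<subseteq> A_in_K \<Longrightarrow> \<exists>g\<in>\<aa>. g \<noteq> 0 \<Longrightarrow> 1 \<notin> \<aa> \<Longrightarrow>
      \<exists>h. h \<notin> A_in_K \<and> (\<forall>g\<in>\<aa>. h * g \<in> A_in_K)"
    and L: "plane.subspace \<Lambda>" and e: "e \<in> \<Lambda>" and m: "m \<in> \<Lambda>" "wedge e m \<noteq> 0"
    and B: "ideal_mult (coeff_ideal \<Lambda> e) B' = A_in_K"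
    and J: "ideal_mult (wedge_ideal \<Lambda>) J' = A_in_K"
  shows "ideal_mult (coeff_ideal \<Lambda> e) (wedge e ` \<Lambda>) = wedge_ideal \<Lambda>"
proof -
  define I where "I = coeff_ideal \<Lambda> e"
  define H where "H = wedge e ` \<Lambda>"
  define W where "W = wedge_ideal \<Lambda>"
  define \<aa> where "\<aa> = ideal_mult (ideal_mult I H) J'"
  have sI: "frac.subspace I" and sH: "frac.subspace H" and sW: "frac.subspace W"
    unfolding I_def H_def W_def wedge_ideal_def
    by (simp_all add: subspace_coeff_ideal[OF L] subspace_wedge_image[OF L])
  have IB: "ideal_mult I B' = A_in_K" and WJ: "ideal_mult W J' = A_in_K"
    using B J by (simp_all add: I_def W_def)
  have "ideal_mult I H \<subseteq> W"
    unfolding ideal_mult_subset_iff[OF sW]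
    unfolding I_def H_def W_def wedge_ideal_def coeff_ideal_def
    by (safe, rule frac.span_base) (metis (mono_tags, lifting) mem_Collect_eq wedge_simps(3))
  then have sub: "\<aa> \<subseteq> A_in_K"
    using ideal_mult_mono[of "ideal_mult I H" W J' J'] WJ by (simp add: \<aa>_def)
  have "1 \<in> I"
    using e by (simp add: I_def coeff_ideal_def vscale_simps)
  have "1 \<in> \<aa>"
  proof (rule ccontr)
    assume no: "1 \<notin> \<aa>"
    have nz: "\<exists>g\<in>\<aa>. g \<noteq> 0"
    proof -
      have "\<exists>t\<in>J'. t \<noteq> 0"
      proof (rule ccontr)
        assume "\<not> (\<exists>t\<in>J'. t \<noteq> 0)"
        then have "ideal_mult W J' \<subseteq> {0}"
          by (subst ideal_mult_subset_iff) (auto intro: frac_subspaceI)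
        then show False
          unfolding WJ using one_in_A by (metis singletonD subsetD zero_neq_one)
      qed
      then obtain t where t: "t \<in> J'" "t \<noteq> 0" by blast
      have "1 * wedge e m * t \<in> \<aa>"
        unfolding \<aa>_def using \<open>1 \<in> I\<close> t m by (intro ideal_multI) (auto simp: H_def)
      then show ?thesis
        using t m by (intro bexI[of _ "1 * wedge e m * t"]) simp_all
    qed
    obtain h where h: "h \<notin> A_in_K" "\<And>g. g \<in> \<aa> \<Longrightarrow> h * g \<in> A_in_K"
      using dedekind[OF _ sub nz no] by (auto simp: \<aa>_def)
    have key: "h * s * t * w \<in> I" if "s \<in> I" "t \<in> J'" "w \<in> W" for s t w
    proof -
      have "W \<subseteq> {w. \<forall>d\<in>{h * s * t}. w * d \<in> I}"
        unfolding W_def wedge_ideal_def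
      proof (rule frac.span_minimal)
        show "frac.subspace {w. \<forall>d\<in>{h * s * t}. w * d \<in> I}"
          by (rule frac_subspace_colon[OF sI])
        have "wedge a b * (h * s * t) \<in> I" if ab: "a \<in> \<Lambda>" "b \<in> \<Lambda>" for a b
        proof -
          let ?d = "h * s * t"
          have dH: "?d * wedge e c \<in> A_in_K" if "c \<in> \<Lambda>" for c
          proof -
            have "s * wedge e c * t \<in> \<aa>"
              unfolding \<aa>_def using that \<open>s \<in> I\<close> \<open>t \<in> J'\<close> by (intro ideal_multI) (auto simp: H_def)
            then show ?thesis
              using h(2)[of "s * wedge e c * t"] by (simp add: mult_ac)
          qed
          \<comment> \<open>The Pluecker relation, multiplied by d.\<close>
          have "vscale (wedge a b * ?d) e =
              vscale (?d * wedge e b) a + vscale (- 1) (vscale (?d * wedge e a) b)"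
            by (rule prod_eqI) (simp_all add: vscale_def wedge_def algebra_simps)
          also have "\<dots> \<in> \<Lambda>"
            using ab dH by (intro plane.subspace_add[OF L] plane_subspace_A[OF L])
              (auto simp: A_uminus)
          finally show ?thesis by (simp add: I_def coeff_ideal_def)
        qed
        then show "{wedge a b |a b. a \<in> \<Lambda> \<and> b \<in> \<Lambda>} \<subseteq> {w. \<forall>d\<in>{h * s * t}. w * d \<in> I}"
          by auto
      qed
      then show ?thesis using \<open>w \<in> W\<close> by (auto simp: mult_ac)
    qed
    have hI: "h * s \<in> I" if "s \<in> I" for s
    proof -
      have "ideal_mult W J' \<subseteq> {g. \<forall>d\<in>{h * s}. g * d \<in> I}"
        unfolding ideal_mult_subset_iff[OF frac_subspace_colon[OF sI]]
      proof clarsimp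
        fix w t assume "w \<in> W" "t \<in> J'"
        moreover have "w * t * (h * s) = h * s * t * w" by (simp add: mult_ac)
        ultimately show "w * t * (h * s) \<in> I"
          using key[OF that] by (simp only:)
      qed
      then show ?thesis
        unfolding WJ using one_in_A by fastforce
    qed
    have "ideal_mult I B' \<subseteq> {g. \<forall>d\<in>{h}. g * d \<in> A_in_K}"
    proof (subst ideal_mult_subset_iff)
      show "\<forall>s\<in>I. \<forall>t\<in>B'. s * t \<in> {g. \<forall>d\<in>{h}. g * d \<in> A_in_K}"
        using ideal_multI[OF hI, of _ _ B'] unfolding IB by (auto simp: mult_ac)
    qed (rule frac_subspace_colon[OF subspace_A])
    then show False
      unfolding IB using one_in_A h(1) by fastforce
  qed
  then have "\<aa> = A_in_K"
    using sub subspace_A_mult[of \<aa> _ 1] by (metis \<aa>_def mult.right_neutral subsetI subset_antisym subspace_ideal_mult)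
  then have "W = ideal_mult \<aa> W"
    by (simp add: ideal_mult_one sW)
  also have "\<dots> = ideal_mult (ideal_mult W J') (ideal_mult I H)"
    by (simp add: \<aa>_def ideal_mult_ac)
  finally show ?thesis
    unfolding WJ by (simp add: ideal_mult_one I_def W_def H_def)
qed


text \<open>
  Steinitz's theorem in rank two. Since \<open>H = e \<and> \<Lambda>\<close> is invertible by the preceding lemma, there is
  f with \<open>e \<and> f = 1\<close> and \<open>\<Lambda> = I e + H f\<close>. If \<open>p + j r = 1\<close> with p in \<open>I\<^sup>-\<^sup>1\<close>, j in H and r in \<open>R = H\<^sup>-\<^sup>1\<close>,
  then the unimodular change of basis \<open>e' = e + j f\<close>, \<open>g = p f - r e\<close> turns \<open>I e + H f\<close> into
  \<open>A e' + I H g\<close>, and \<open>I H\<close> is the ideal of all \<open>m \<and> n\<close>. That such j and r exist is the hypothesis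
  \<open>comaximal\<close>.
\<close>

lemma steinitz_rank_two:
  fixes \<Lambda> :: "('a::idom fract \<times> 'a fract) set"
  assumes dedekind: "\<And>\<aa>::'a fract set. frac.subspace \<aa> \<Longrightarrow> \<aa> \<subseteq> A_in_K \<Longrightarrow> \<exists>g\<in>\<aa>. g \<noteq> 0 \<Longrightarrow> 1 \<notin> \<aa> \<Longrightarrow>
      \<exists>h. h \<notin> A_in_K \<and> (\<forall>g\<in>\<aa>. h * g \<in> A_in_K)"
    and L: "plane.subspace \<Lambda>" and e: "e \<in> \<Lambda>" and m: "m \<in> \<Lambda>" "wedge e m \<noteq> 0"
    and B: "ideal_mult (coeff_ideal \<Lambda> e) B' = A_in_K"
    and J: "ideal_mult (wedge_ideal \<Lambda>) J' = A_in_K"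
    and comaximal: "\<And>H R. frac.subspace R \<Longrightarrow> ideal_mult H R = A_in_K \<Longrightarrow>
      \<exists>j\<in>H. \<exists>r\<in>R. \<forall>b\<in>coeff_ideal \<Lambda> e. (1 - j * r) * b \<in> A_in_K"
  shows "\<exists>e'\<in>\<Lambda>. \<exists>g. wedge e' g = 1 \<and>
    \<Lambda> = {vscale a e' + vscale w g | a w. a \<in> A_in_K \<and> w \<in> wedge_ideal \<Lambda>}"
proof -
  define I where "I = coeff_ideal \<Lambda> e"
  define H where "H = wedge e ` \<Lambda>"
  define W where "W = wedge_ideal \<Lambda>"
  define R where "R = ideal_mult I J'"
  have sI: "frac.subspace I" and sH: "frac.subspace H" and sW: "frac.subspace W"
    and sR: "frac.subspace R"
    unfolding I_def H_def W_def wedge_ideal_def R_def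
    by (simp_all add: subspace_coeff_ideal[OF L] subspace_wedge_image[OF L])
  have IH: "ideal_mult I H = W"
    unfolding I_def H_def W_def by (rule coeff_ideal_wedge_image) (fact assms)+
  have HR: "ideal_mult H R = A_in_K"
    using J by (simp add: R_def W_def[symmetric] IH[symmetric] ideal_mult_ac)
  have WR: "ideal_mult W R = I"
    using J by (simp add: R_def W_def[symmetric] ideal_mult_left_commute[of W I] ideal_mult_one_right sI)
  have HR_A: "h * r \<in> A_in_K" if "h \<in> H" "r \<in> R" for h r
    using ideal_multI[OF that] by (simp add: HR)
  \<comment> \<open>A splitting of \<open>\<Lambda> \<rightarrow> H\<close>: writing \<open>1 = \<Sum> j\<^sub>i r\<^sub>i\<close> with \<open>j\<^sub>i = e \<and> n\<^sub>i\<close>, the vector is \<open>f = \<Sum> r\<^sub>i n\<^sub>i\<close>.\<close>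
  have "ideal_mult H R \<subseteq> {w. \<exists>f. wedge e f = w \<and> (\<forall>h\<in>H. vscale h f \<in> \<Lambda>)}"
  proof (subst ideal_mult_subset_iff, rule frac_subspaceI; safe?)
    show "\<exists>f. wedge e f = 0 \<and> (\<forall>h\<in>H. vscale h f \<in> \<Lambda>)"
      using plane.subspace_0[OF L] by (intro exI[of _ 0]) (simp add: wedge_def vscale_def zero_prod_def)
    show "\<exists>f. wedge e f = to_fract a * wedge e f' \<and> (\<forall>h\<in>H. vscale h f \<in> \<Lambda>)"
      if "\<forall>h\<in>H. vscale h f' \<in> \<Lambda>" for a f'
      using that plane.subspace_scale[OF L, of _ a]
      by (intro exI[of _ "vscale (to_fract a) f'"]) (simp add: wedge_simps vscale_commute[of _ "to_fract a"])
    show "\<exists>f. wedge e f = wedge e f1 + wedge e f2 \<and> (\<forall>h\<in>H. vscale h f \<in> \<Lambda>)"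
      if "\<forall>h\<in>H. vscale h f1 \<in> \<Lambda>" "\<forall>h\<in>H. vscale h f2 \<in> \<Lambda>" for f1 f2
      using that plane.subspace_add[OF L]
      by (intro exI[of _ "f1 + f2"]) (simp add: wedge_simps vscale_simps)
    show "\<exists>f. wedge e f = j * r \<and> (\<forall>h\<in>H. vscale h f \<in> \<Lambda>)" if jr: "j \<in> H" "r \<in> R" for j r
    proof -
      obtain n where "n \<in> \<Lambda>" "j = wedge e n"
        using jr by (auto simp: H_def)
      then show ?thesis
        using HR_A[OF _ jr(2)]
        by (intro exI[of _ "vscale r n"])
          (auto simp: wedge_simps vscale_simps mult.commute plane_subspace_A[OF L])
    qed
  qed
  then obtain f where f: "wedge e f = 1" "\<And>h. h \<in> H \<Longrightarrow> vscale h f \<in> \<Lambda>"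
    unfolding HR using one_in_A by blast
  obtain j r where j: "j \<in> H" and r: "r \<in> R" and
    p: "\<And>b. b \<in> I \<Longrightarrow> (1 - j * r) * b \<in> A_in_K"
    using comaximal[OF sR HR] unfolding I_def by blast
  let ?p = "1 - j * r"
  let ?e = "e + vscale j f" and ?g = "vscale ?p f + vscale (- r) e"
  have fe: "wedge f e = - 1"
    using f(1) by (simp add: wedge_def algebra_simps)
  have eg: "wedge ?e ?g = 1"
    by (simp add: wedge_simps f fe)
  have "wedge e n \<in> H" if "n \<in> \<Lambda>" for n
    using that by (simp add: H_def)
  have coord: "wedge n f \<in> I" if "n \<in> \<Lambda>" for n
  proof -
    have "vscale (wedge n f) e = n + vscale (- 1) (vscale (wedge e n) f)"
      using plane_expand[OF f(1), of n] by (simp add: vscale_simps vscale_def prod_eq_iff)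
    also have "\<dots> \<in> \<Lambda>"
      using that f(2)[of "wedge e n"] plane_subspace_A[OF L A_uminus[OF one_in_A]]
      by (intro plane.subspace_add[OF L]) (auto simp: H_def)
    finally show ?thesis by (simp add: I_def coeff_ideal_def)
  qed
  have "1 \<in> I"
    using e by (simp add: I_def coeff_ideal_def vscale_simps)
  have HW: "h \<in> W" if "h \<in> H" for h
    using ideal_multI[OF \<open>1 \<in> I\<close> that] by (simp add: IH)
  have pW: "w * ?p \<in> H" if "w \<in> W" for w
  proof -
    have "ideal_mult I H \<subseteq> {w. \<forall>d\<in>{?p}. w * d \<in> H}"
      unfolding ideal_mult_subset_iff[OF frac_subspace_colon[OF sH]]
      using subspace_A_mult[OF sH p] by (simp add: mult_ac)
    then show ?thesis using that IH by auto
  qed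
  have "\<Lambda> = {vscale a ?e + vscale w ?g | a w. a \<in> A_in_K \<and> w \<in> W}"
  proof (rule antisym; rule subsetI)
    fix n assume n: "n \<in> \<Lambda>"
    have "wedge n ?g = ?p * wedge n f + wedge e n * r"
      by (simp add: wedge_simps) (simp add: wedge_def algebra_simps)
    then have "wedge n ?g \<in> A_in_K"
      using p[OF coord[OF n]] HR_A[OF _ r, of "wedge e n"] n
      by (auto simp: H_def intro!: frac.subspace_add[OF subspace_A])
    moreover have "wedge ?e n = wedge e n + - (wedge n f * j)"
      by (simp add: wedge_simps) (simp add: wedge_def algebra_simps)
    then have "wedge ?e n \<in> W"
      using HW[of "wedge e n"] n ideal_multI[OF coord[OF n] j]
      by (simp only: IH) (auto simp: H_def intro!: frac.subspace_diff[OF sW])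
    ultimately show "n \<in> {vscale a ?e + vscale w ?g | a w. a \<in> A_in_K \<and> w \<in> W}"
      using plane_expand[OF eg, of n] by blast
  next
    fix n assume "n \<in> {vscale a ?e + vscale w ?g | a w. a \<in> A_in_K \<and> w \<in> W}"
    then obtain a w where a: "a \<in> A_in_K" and w: "w \<in> W" and n: "n = vscale a ?e + vscale w ?g"
      by blast
    have "vscale (- (w * r)) e \<in> \<Lambda>"
      using frac.subspace_neg[OF sI, of "w * r"] ideal_multI[OF w r]
      by (simp add: WR) (simp add: I_def coeff_ideal_def)
    then have "vscale w ?g \<in> \<Lambda>"
      using f(2)[OF pW[OF w]] plane.subspace_add[OF L] by (simp add: vscale_simps)
    moreover have "?e \<in> \<Lambda>"
      using e f(2)[OF j] plane.subspace_add[OF L] by blast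
    ultimately show "n \<in> \<Lambda>"
      unfolding n using plane.subspace_add[OF L plane_subspace_A[OF L a]] by blast
  qed
  moreover have "?e \<in> \<Lambda>"
    using e f(2)[OF j] plane.subspace_add[OF L] by blast
  ultimately show ?thesis
    using eg unfolding W_def by blast
qed

section \<open>The affine coordinate ring of a smooth Weierstrass curve\<close>

lemma eval2_simps [simp]:
  "eval2 0 a b = 0" "eval2 1 a b = 1" "eval2 (F + G) a b = eval2 F a b + eval2 G a b"
  "eval2 (F - G) a b = eval2 F a b - eval2 G a b"
  "eval2 (- F) a b = - eval2 F a b" "eval2 (F * G) a b = eval2 F a b * eval2 G a b"
  "eval2 (pCons f F) a b = poly f a + b * eval2 F a b"
  by (simp_all add: eval2_def)

text \<open>
  The polynomial presentation gives the Nullstellensatz (\<open>nullstellensatz\<close>), and smoothness makes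
  the ideals of the points invertible (\<open>point_inverse_invertible\<close>).
\<close>

locale smooth_weierstrass =
  fixes E :: "'l::alg_closed_field weierstrass" and \<pi> :: "'l poly poly \<Rightarrow> 'a::idom"
  assumes coordinate_ring: "coordinate_ring E \<pi>"
    and smooth: "\<And>a b. on_curve E (Affine a b) \<Longrightarrow>
      cf1 E * b - (3 * a ^ 2 + 2 * cf2 E * a + cf4 E) \<noteq> 0 \<or> 2 * b + cf1 E * a + cf3 E \<noteq> 0"
begin

abbreviation "X \<equiv> x_A \<pi>"
abbreviation "Y \<equiv> y_A \<pi>"
abbreviation "C \<equiv> const_A \<pi>"

lemma pi_hom [simp]: "\<pi> 1 = 1" "\<pi> (F + G) = \<pi> F + \<pi> G" "\<pi> (F * G) = \<pi> F * \<pi> G"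
  and pi_eq_0_iff: "\<pi> F = 0 \<longleftrightarrow> weierstrass_poly E dvd F"
  and pi_surj: "surj \<pi>"
  using coordinate_ring by (simp_all add: coordinate_ring_def)

lemma pi_hom' [simp]: "\<pi> 0 = 0" "\<pi> (- F) = - \<pi> F" "\<pi> (F - G) = \<pi> F - \<pi> G"
proof -
  show z: "\<pi> 0 = 0" by (simp add: pi_eq_0_iff)
  have m: "\<pi> (- F) = - \<pi> F" for F
    using pi_hom(2)[of F "- F"] z by (simp add: eq_neg_iff_add_eq_0 add.commute)
  then show "\<pi> (- F) = - \<pi> F" "\<pi> (F - G) = \<pi> F - \<pi> G"
    using pi_hom(2)[of F "- G"] by simp_all
qed

definition emb :: "'l poly \<Rightarrow> 'a" where
  "emb u = \<pi> [:u:]"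

lemma emb_hom [simp]: "emb 0 = 0" "emb 1 = 1" "emb (u + v) = emb u + emb v"
  "emb (u - v) = emb u - emb v" "emb (- u) = - emb u" "emb (u * v) = emb u * emb v"
  by (simp_all add: emb_def mult.commute flip: pi_hom pi_hom') (simp_all add: one_pCons)

lemma C_emb: "C c = emb [:c:]"
  by (simp add: const_A_def emb_def)

lemma C_hom [simp]: "C 0 = 0" "C 1 = 1" "C (c + d) = C c + C d" "C (c - d) = C c - C d"
  "C (- c) = - C c" "C (c * d) = C c * C d"
  by (simp_all add: C_emb mult.commute flip: emb_hom) (simp_all add: one_pCons)

lemma emb_pCons: "emb (pCons c u) = C c + X * emb u"
  unfolding C_emb x_A_def emb_def
  by (simp only: pi_hom(2,3)[symmetric]) simp

lemma pi_pCons: "\<pi> (pCons u F) = emb u + Y * \<pi> F"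
  unfolding emb_def y_A_def
  by (simp only: pi_hom(2,3)[symmetric]) simp

lemma emb_linear: "emb [:- a, 1:] = X - C a"
  by (simp add: emb_pCons)

lemma pi_linear_eq_0: "emb u + Y * emb v = 0 \<Longrightarrow> u = 0 \<and> v = 0"
proof -
  assume "emb u + Y * emb v = 0"
  then have "\<pi> [:u, v:] = 0"
    by (simp add: pi_pCons)
  then have "weierstrass_poly E dvd [:u, v:]"
    by (simp add: pi_eq_0_iff)
  moreover have "degree (weierstrass_poly E) = 2"
    by (simp add: weierstrass_poly_def)
  moreover have "degree [:u, v:] \<le> 1"
    using degree_pCons_le[of u "[:v:]"] by simp
  ultimately have "[:u, v:] = 0"
    using dvd_imp_degree_le[of "weierstrass_poly E" "[:u, v:]"] by fastforce
  then show ?thesis by simp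
qed

lemma emb_eq_0_iff [simp]: "emb u = 0 \<longleftrightarrow> u = 0"
  using pi_linear_eq_0[of u 0] by auto

lemma C_eq_0_iff [simp]: "C c = 0 \<longleftrightarrow> c = 0"
  by (simp add: C_emb)

lemma X_minus_C_nonzero [simp]: "X - C a \<noteq> 0"
  using emb_eq_0_iff[of "[:- a, 1:]"] by (simp add: emb_linear del: emb_eq_0_iff)

definition lin_poly :: "'l poly" where
  "lin_poly = [:cf3 E, cf1 E:]"

definition rhs_poly :: "'l poly" where
  "rhs_poly = [:cf6 E, cf4 E, cf2 E, 1:]"

lemma weierstrass_equation:
  "Y * Y = emb rhs_poly - Y * emb lin_poly"
proof -
  have "\<pi> (weierstrass_poly E) = - emb rhs_poly + Y * (emb lin_poly + Y)"
    unfolding weierstrass_poly_def pi_pCons rhs_poly_def lin_poly_def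
    by (simp del: minus_pCons)
  moreover have "\<pi> (weierstrass_poly E) = 0"
    by (simp only: pi_eq_0_iff dvd_refl)
  moreover have "Y * Y = (- emb rhs_poly + Y * (emb lin_poly + Y)) + emb rhs_poly - Y * emb lin_poly"
    by (simp add: algebra_simps)
  ultimately show ?thesis by simp
qed

lemma A_cases:
  obtains u v where "g = emb u + Y * emb v"
proof -
  have "\<exists>u v. \<pi> F = emb u + Y * emb v" for F
  proof (induction F)
    case 0
    show ?case by (intro exI[of _ 0]) simp
  next
    case (pCons f F)
    then obtain u v where "\<pi> F = emb u + Y * emb v" by blast
    then have "\<pi> (pCons f F) = emb f + Y * emb u + (Y * Y) * emb v"
      by (simp add: pi_pCons algebra_simps)
    also have "\<dots> = emb (f + rhs_poly * v) + Y * emb (u - lin_poly * v)"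
      unfolding weierstrass_equation by (simp add: algebra_simps)
    finally show ?case by blast
  qed
  then show ?thesis
    using that surjD[OF pi_surj] by metis
qed

text \<open>
  Multiplication by the conjugate under \<open>y \<mapsto> - y - a\<^sub>1 x - a\<^sub>3\<close> sends \<open>u + v y\<close> into \<open>L[x]\<close>. Every
  nonzero ideal of A therefore contains a nonzero polynomial in x, which splits into linear
  factors.
\<close>

lemma norm_exists:
  assumes "d \<noteq> 0"
  obtains n d' where "n \<noteq> 0" "emb n = d * d'"
proof -
  obtain u v where d: "d = emb u + Y * emb v" by (rule A_cases)
  define w where "w = emb u - Y * emb v - emb lin_poly * emb v"
  have w: "w = emb (u - lin_poly * v) + Y * emb (- v)"
    by (simp add: w_def)
  have "w \<noteq> 0"
  proof
    assume "w = 0"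
    then have "u = 0 \<and> v = 0"
      unfolding w using pi_linear_eq_0[of "u - lin_poly * v" "- v"] by auto
    then show False using assms d by simp
  qed
  have "d * w = emb u * emb u - emb u * emb v * emb lin_poly
      - (Y * Y) * (emb v * emb v) - Y * emb lin_poly * emb v * emb v"
    unfolding d w_def by (simp add: algebra_simps)
  also have "\<dots> = emb (u * u - u * v * lin_poly - rhs_poly * (v * v))"
    unfolding weierstrass_equation by (simp add: algebra_simps)
  finally have n: "emb (u * u - u * v * lin_poly - rhs_poly * (v * v)) = d * w" ..
  show thesis
    by (rule that[OF _ n]) (use n assms \<open>w \<noteq> 0\<close> emb_eq_0_iff in \<open>metis mult_eq_0_iff\<close>)
qed

section \<open>Points and their ideals\<close>

definition residue :: "'l \<Rightarrow> 'l \<Rightarrow> 'a \<Rightarrow> 'l" where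
  "residue a b g = eval2 (inv_into UNIV \<pi> g) a b"

lemma residue_pi:
  assumes "on_curve E (Affine a b)"
  shows "residue a b (\<pi> F) = eval2 F a b"
proof -
  have "\<pi> (inv_into UNIV \<pi> (\<pi> F) - F) = 0"
    using f_inv_into_f[of "\<pi> F" \<pi> UNIV] by simp
  then obtain G where "inv_into UNIV \<pi> (\<pi> F) - F = weierstrass_poly E * G"
    unfolding pi_eq_0_iff by (rule dvdE)
  then have "eval2 (inv_into UNIV \<pi> (\<pi> F)) a b - eval2 F a b = 0"
    using assms by (simp flip: eval2_simps(4)) 
  then show ?thesis by (simp add: residue_def)
qed

lemma residue_hom:
  assumes "on_curve E (Affine a b)"
  shows "residue a b (g + h) = residue a b g + residue a b h"
    "residue a b (g * h) = residue a b g * residue a b h"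
    "residue a b (g - h) = residue a b g - residue a b h"
    "residue a b 0 = 0" "residue a b 1 = 1" "residue a b (- g) = - residue a b g"
    "residue a b X = a" "residue a b Y = b" "residue a b (C c) = c"
proof -
  obtain G H where gh: "g = \<pi> G" "h = \<pi> H"
    using surjD[OF pi_surj] by metis
  show "residue a b (g + h) = residue a b g + residue a b h"
    "residue a b (g * h) = residue a b g * residue a b h"
    "residue a b (g - h) = residue a b g - residue a b h"
    unfolding gh by (simp_all add: residue_pi[OF assms] flip: pi_hom pi_hom')
  show "residue a b 0 = 0" "residue a b 1 = 1"
    using residue_pi[OF assms, of 0] residue_pi[OF assms, of 1] by simp_all
  show "residue a b (- g) = - residue a b g"
    using residue_pi[OF assms, of "- G"] by (simp add: gh residue_pi[OF assms])
  show "residue a b X = a" "residue a b Y = b" "residue a b (C c) = c"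
    unfolding x_A_def y_A_def const_A_def residue_pi[OF assms] by simp_all
qed

text \<open>
  The kernel of evaluation at a point is generated by \<open>x - a\<close> and \<open>y - b\<close>.
\<close>

lemma taylor:
  assumes "on_curve E (Affine a b)"
  obtains r s where "g = C (residue a b g) + (X - C a) * r + (Y - C b) * s"
proof -
  have 1: "\<exists>r. emb f = C (poly f a) + (X - C a) * r" for f
  proof (induction f)
    case 0
    show ?case by (intro exI[of _ 0]) simp
  next
    case (pCons c f)
    then obtain r where "emb f = C (poly f a) + (X - C a) * r" by blast
    then have "emb (pCons c f) = C (poly (pCons c f) a) + (X - C a) * (emb f + C a * r)"
      by (simp only: emb_pCons poly_pCons C_hom) (simp add: algebra_simps)
    then show ?case by blast
  qed
  have "\<exists>r s. \<pi> F = C (eval2 F a b) + (X - C a) * r + (Y - C b) * s" for F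
  proof (induction F)
    case 0
    show ?case by (intro exI[of _ 0]) simp
  next
    case (pCons f F)
    then obtain r s where IH: "\<pi> F = C (eval2 F a b) + (X - C a) * r + (Y - C b) * s" by blast
    obtain r' where "emb f = C (poly f a) + (X - C a) * r'" using 1 by blast
    have "\<pi> (pCons f F) = emb f + C b * \<pi> F + (Y - C b) * \<pi> F"
      by (simp add: pi_pCons algebra_simps)
    also have "\<dots> = C (eval2 (pCons f F) a b) + (X - C a) * (r' + C b * r) + (Y - C b) * (\<pi> F + C b * s)"
      by (simp only: IH \<open>emb f = _\<close> eval2_simps C_hom) (simp add: algebra_simps)
    finally show ?case by blast
  qed
  then show thesis
    using that residue_pi[OF assms] surjD[OF pi_surj] by metis
qed

definition y_conj :: "'l \<Rightarrow> 'l \<Rightarrow> 'l" where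
  "y_conj a b = - b - cf1 E * a - cf3 E"

text \<open>
  The Q in the identity \<open>(y - b) (y - b') = (x - a) Q\<close> on the curve, for the conjugate \<open>b'\<close> of b: it
  is the divided difference of the cubic in x, corrected by the term \<open>a\<^sub>1 y\<close>. At \<open>(a, b)\<close> its value
  is the negative of the partial derivative of the Weierstrass polynomial by x.
\<close>

definition cofactor :: "'l \<Rightarrow> 'a" where
  "cofactor a = X * X + C a * X + C a * C a + C (cf2 E) * (X + C a) + C (cf4 E) - C (cf1 E) * Y"

lemma on_curve_iff:
  "on_curve E (Affine a b) \<longleftrightarrow>
    b * b + cf1 E * a * b + cf3 E * b = a * a * a + cf2 E * a * a + cf4 E * a + cf6 E"
  by (simp add: weierstrass_poly_def algebra_simps)

lemma on_curve_y_conj: "on_curve E (Affine a b) \<Longrightarrow> on_curve E (Affine a (y_conj a b))"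
  unfolding on_curve_iff y_conj_def by (simp add: algebra_simps)

lemma conjugate_product:
  assumes "on_curve E (Affine a b)"
  shows "(Y - C b) * (Y - C (y_conj a b)) = (X - C a) * cofactor a"
proof -
  have "C (b * b + cf1 E * a * b + cf3 E * b) = C (a * a * a + cf2 E * a * a + cf4 E * a + cf6 E)"
    using assms by (simp only: on_curve_iff)
  moreover have "Y * Y + C (cf1 E) * X * Y + C (cf3 E) * Y
      = X * X * X + C (cf2 E) * X * X + C (cf4 E) * X + C (cf6 E)"
    using weierstrass_equation by (simp add: rhs_poly_def lin_poly_def emb_pCons algebra_simps)
  moreover have "(Y - C b) * (Y - C (y_conj a b)) - (X - C a) * cofactor a
    = (Y * Y + C (cf1 E) * X * Y + C (cf3 E) * Y)
      - (X * X * X + C (cf2 E) * X * X + C (cf4 E) * X + C (cf6 E))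
      - (C (b * b + cf1 E * a * b + cf3 E * b) - C (a * a * a + cf2 E * a * a + cf4 E * a + cf6 E))"
    unfolding y_conj_def cofactor_def C_hom by (simp add: algebra_simps)
  ultimately show ?thesis by simp
qed

text \<open>
  This is \<open>1 = p + p' (y - b') / (x - a)\<close> multiplied by \<open>x - a\<close>, and it says that \<open>(x - a, y - b)\<close> is
  invertible. Its product with the fractional ideal generated by 1 and \<open>(y - b') / (x - a)\<close>
  contains \<open>y - b\<close>, \<open>y - b'\<close>, \<open>x - a\<close> and the cofactor Q. If \<open>b \<noteq> b'\<close>, the difference of the first two
  is a unit. If \<open>b = b'\<close>, then Q is a unit modulo \<open>(x - a, y - b)\<close> by smoothness.
\<close>

lemma point_ideal_comaximal:
  assumes "on_curve E (Affine a b)"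
  obtains p p' where "residue a b p = 0" "residue a b p' = 0"
    "(X - C a) = p * (X - C a) + p' * (Y - C (y_conj a b))"
proof (cases "b = y_conj a b")
  case False
  let ?k = "C (1 / (b - y_conj a b))"
  have "?k * (C b - C (y_conj a b)) = C (1 / (b - y_conj a b) * (b - y_conj a b))"
    by (simp only: C_hom)
  then have "?k * (C b - C (y_conj a b)) = 1"
    using False by simp
  then have "X - C a = (?k * (C b - C (y_conj a b))) * (X - C a)"
    by simp
  then have "X - C a = - ?k * (Y - C b) * (X - C a) + ?k * (X - C a) * (Y - C (y_conj a b))"
    by (simp add: algebra_simps)
  moreover have "residue a b (- ?k * (Y - C b)) = 0" "residue a b (?k * (X - C a)) = 0"
    by (simp_all add: residue_hom[OF assms] del: C_hom)
  ultimately show thesis by (rule that[rotated -1])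
next
  case True
  define c where "c = residue a b (cofactor a)"
  have "c = - (cf1 E * b - (3 * a ^ 2 + 2 * cf2 E * a + cf4 E))"
    unfolding c_def cofactor_def residue_hom[OF assms] by (simp add: power2_eq_square)
  moreover have "2 * b + cf1 E * a + cf3 E = 0"
    using True by (simp add: y_conj_def algebra_simps eq_neg_iff_add_eq_0)
  ultimately have "c \<noteq> 0"
    using smooth[OF assms] by simp
  obtain r s where rs: "cofactor a = C c + (X - C a) * r + (Y - C b) * s"
    unfolding c_def by (rule taylor[OF assms])
  let ?k = "C (1 / c)" let ?p = "- ?k * ((X - C a) * r + (Y - C b) * s)" let ?p' = "?k * (Y - C b)"
  have "?k * C c = 1"
    using \<open>c \<noteq> 0\<close> by (simp flip: C_hom(6))
  then have "X - C a = (X - C a) * (?k * (cofactor a - ((X - C a) * r + (Y - C b) * s)))"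
    by (simp add: rs)
  also have "\<dots> = ?p * (X - C a) + ?k * ((X - C a) * cofactor a)"
    by (simp add: algebra_simps)
  finally have "X - C a = ?p * (X - C a) + ?p' * (Y - C (y_conj a b))"
    unfolding conjugate_product[OF assms, symmetric] by (simp only: mult.assoc)
  moreover have "residue a b ?p = 0" "residue a b ?p' = 0"
    by (simp_all add: residue_hom[OF assms] del: C_hom)
  ultimately show thesis by (rule that[rotated -1])
qed

definition point_ideal :: "'l \<Rightarrow> 'l \<Rightarrow> 'a fract set" where
  "point_ideal a b = to_fract ` {g. residue a b g = 0}"

definition point_inverse :: "'l \<Rightarrow> 'l \<Rightarrow> 'a fract set" where
  "point_inverse a b = {g. to_fract (X - C a) * g \<in> A_in_K \<and> to_fract (Y - C b) * g \<in> A_in_K}"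

text \<open>
  The function \<open>(y - b') / (x - a)\<close>, whose only affine pole is a simple one at \<open>(a, b)\<close>.
\<close>

definition pole_fun :: "'l \<Rightarrow> 'l \<Rightarrow> 'a fract" where
  "pole_fun a b = to_fract (Y - C (y_conj a b)) / to_fract (X - C a)"

lemma subspace_point_inverse: "frac.subspace (point_inverse a b)"
  unfolding point_inverse_def
proof (rule frac_subspaceI; clarsimp simp del: to_fract_diff)
  show "to_fract (X - C a) * (g + h) \<in> A_in_K \<and> to_fract (Y - C b) * (g + h) \<in> A_in_K"
    if "to_fract (X - C a) * g \<in> A_in_K" "to_fract (Y - C b) * g \<in> A_in_K"
      "to_fract (X - C a) * h \<in> A_in_K" "to_fract (Y - C b) * h \<in> A_in_K" for g h
    using that by (simp only: distrib_left frac.subspace_add[OF subspace_A])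
  show "to_fract (X - C a) * (to_fract r * g) \<in> A_in_K \<and>
      to_fract (Y - C b) * (to_fract r * g) \<in> A_in_K"
    if "to_fract (X - C a) * g \<in> A_in_K" "to_fract (Y - C b) * g \<in> A_in_K" for r g
    unfolding mult.left_commute[of _ "to_fract r"]
    using that by (simp only: frac.subspace_scale[OF subspace_A])
qed

lemma point_inverse_mult:
  assumes "on_curve E (Affine a b)" "p \<in> point_ideal a b" "g \<in> point_inverse a b"
  shows "p * g \<in> A_in_K"
proof -
  obtain p' where p': "p = to_fract p'" "residue a b p' = 0"
    using assms(2) by (auto simp: point_ideal_def)
  obtain r s where "p' = (X - C a) * r + (Y - C b) * s"
    using taylor[OF assms(1), of p'] p'(2) by auto
  then have "p * g = to_fract r * (to_fract (X - C a) * g) + to_fract s * (to_fract (Y - C b) * g)"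
    using p'(1) by (simp only: to_fract_add to_fract_mult) (simp add: algebra_simps)
  then show ?thesis
    using assms(3) unfolding point_inverse_def
    by (auto intro!: frac.subspace_add[OF subspace_A] frac.subspace_scale[OF subspace_A]
        simp del: to_fract_diff)
qed

lemma pole_fun_facts:
  assumes "on_curve E (Affine a b)"
  shows "pole_fun a b \<in> point_inverse a b" "pole_fun a b \<notin> A_in_K"
    and "\<exists>p\<in>point_ideal a b. \<exists>p'\<in>point_ideal a b. 1 = p + p' * pole_fun a b"
proof -
  let ?x = "to_fract (X - C a)"
  have nz: "?x \<noteq> 0"
    using X_minus_C_nonzero by (simp only: to_fract_eq_0_iff not_False_eq_True)
  have "?x * pole_fun a b = to_fract (Y - C (y_conj a b))"
    using nz by (simp add: pole_fun_def del: to_fract_diff)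
  moreover have "to_fract (Y - C b) * pole_fun a b = to_fract (cofactor a)"
    using nz conjugate_product[OF assms]
    by (simp add: pole_fun_def nonzero_divide_eq_eq mult.commute del: to_fract_diff flip: to_fract_mult)
  ultimately show mem: "pole_fun a b \<in> point_inverse a b"
    by (simp add: point_inverse_def del: to_fract_diff)
  obtain p p' where p: "residue a b p = 0" "residue a b p' = 0"
    "(X - C a) = p * (X - C a) + p' * (Y - C (y_conj a b))"
    using point_ideal_comaximal[OF assms] .
  have "?x = to_fract p * ?x + to_fract p' * to_fract (Y - C (y_conj a b))"
    using arg_cong[OF p(3), of to_fract] by (simp only: to_fract_add to_fract_mult)
  then have one: "1 = to_fract p + to_fract p' * pole_fun a b"
    using nz by (simp add: pole_fun_def field_simps del: to_fract_diff)
  then show "\<exists>p\<in>point_ideal a b. \<exists>p'\<in>point_ideal a b. 1 = p + p' * pole_fun a b"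
    using p(1,2) by (auto simp: point_ideal_def)
  show "pole_fun a b \<notin> A_in_K"
  proof
    assume "pole_fun a b \<in> A_in_K"
    then obtain h where "pole_fun a b = to_fract h" by (auto simp: A_in_K_iff)
    with one have "1 = p + p' * h"
      by (simp flip: to_fract_1 to_fract_add to_fract_mult del: to_fract_1)
    then have "residue a b 1 = residue a b (p + p' * h)"
      by simp
    then show False
      using p(1,2) by (simp add: residue_hom[OF assms])
  qed
qed

lemma point_inverse_one: "1 \<in> point_inverse a b"
  by (simp add: point_inverse_def del: to_fract_diff)

lemma point_inverse_invertible:
  assumes "on_curve E (Affine a b)"
  shows "ideal_mult (point_inverse a b) (point_ideal a b) = A_in_K"
proof (rule antisym)
  show "ideal_mult (point_inverse a b) (point_ideal a b) \<subseteq> A_in_K"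
    unfolding ideal_mult_subset_iff[OF subspace_A]
    using point_inverse_mult[OF assms] mult.commute by metis
  obtain p p' where p: "p \<in> point_ideal a b" "p' \<in> point_ideal a b" "1 = p + p' * pole_fun a b"
    using pole_fun_facts(3)[OF assms] by blast
  have "1 \<in> ideal_mult (point_inverse a b) (point_ideal a b)"
    using frac.subspace_add[OF subspace_ideal_mult ideal_multI[OF point_inverse_one p(1)]
        ideal_multI[OF pole_fun_facts(1)[OF assms] p(2)]]
    by (simp add: p(3)[symmetric] mult.commute)
  then show "A_in_K \<subseteq> ideal_mult (point_inverse a b) (point_ideal a b)"
    using subspace_A_mult[OF subspace_ideal_mult, of _ 1] by auto
qed

text \<open>
  So \<open>P\<^sup>-\<^sup>1 = A + L h\<close>: the inverse of a point exceeds A by one dimension.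
\<close>

lemma point_inverse_expand:
  assumes "on_curve E (Affine a b)" "g \<in> point_inverse a b"
  obtains r c where "g = to_fract r + to_fract (C c) * pole_fun a b"
proof -
  obtain p p' where p: "p \<in> point_ideal a b" "p' \<in> point_ideal a b" "1 = p + p' * pole_fun a b"
    using pole_fun_facts(3)[OF assms(1)] by blast
  obtain r s where rs: "p * g = to_fract r" "p' * g = to_fract s"
    using point_inverse_mult[OF assms(1) p(1) assms(2)] point_inverse_mult[OF assms(1) p(2) assms(2)]
    by (auto simp: A_in_K_iff)
  have "s - C (residue a b s) \<in> {g. residue a b g = 0}"
    by (simp add: residue_hom[OF assms(1)])
  then have "to_fract (s - C (residue a b s)) * pole_fun a b \<in> A_in_K"
    by (intro point_inverse_mult[OF assms(1) _ pole_fun_facts(1)[OF assms(1)]])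
      (simp only: point_ideal_def imageI)
  then obtain t where "to_fract (s - C (residue a b s)) * pole_fun a b = to_fract t"
    by (auto simp: A_in_K_iff)
  then have t: "to_fract s * pole_fun a b = to_fract t + to_fract (C (residue a b s)) * pole_fun a b"
    by (simp add: algebra_simps)
  have "g = (p + p' * pole_fun a b) * g"
    using p(3) by simp
  also have "\<dots> = p * g + (p' * g) * pole_fun a b"
    by (simp add: algebra_simps)
  also have "\<dots> = to_fract (r + t) + to_fract (C (residue a b s)) * pole_fun a b"
    unfolding rs t by simp
  finally show thesis by (rule that)
qed

text \<open>
  Every nonzero torsion module over A contains an element whose annihilator is the ideal of a
  point; here the module is generated by the class of g modulo S. A nonzero polynomial in x
  annihilates it. Removing linear factors one after the other leads to a nonzero multiple killed
  by some \<open>x - a\<close>; on it \<open>(y - b) (y - b')\<close> vanishes, for a point \<open>(a, b)\<close> with conjugate \<open>(a, b')\<close>, so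
  either that multiple or its product with \<open>y - b\<close> is killed by one of the two points.

  With S an ideal and \<open>g = 1\<close> this yields the Nullstellensatz, and with \<open>S = A\<close> the existence of a
  point at which a given function has a pole.
\<close>

lemma socle_point:
  fixes S :: "'a fract set"
  assumes S: "frac.subspace S" and g: "g \<notin> S" and d: "d \<noteq> 0" "to_fract d * g \<in> S"
  shows "\<exists>r a b. on_curve E (Affine a b) \<and> to_fract r * g \<notin> S \<and>
    to_fract (X - C a) * (to_fract r * g) \<in> S \<and> to_fract (Y - C b) * (to_fract r * g) \<in> S"
proof -
  have step: "\<exists>r a b. on_curve E (Affine a b) \<and> to_fract r * g \<notin> S \<and>
    to_fract (X - C a) * (to_fract r * g) \<in> S \<and> to_fract (Y - C b) * (to_fract r * g) \<in> S"
    if "n \<noteq> 0" "to_fract (emb n) * g \<in> S" for n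
    using that
  proof (induction "degree n" arbitrary: n rule: less_induct)
    case less
    show ?case
    proof (cases "degree n = 0")
      case True
      then obtain c where n: "n = [:c:]" by (auto elim: degree_eq_zeroE)
      have "to_fract (C (1 / c)) * (to_fract (emb n) * g) = to_fract (C (1 / c) * C c) * g"
        by (simp add: n C_emb)
      also have "C (1 / c) * C c = 1"
        using less.prems(1) by (simp add: n flip: C_hom(6))
      finally have "to_fract (C (1 / c)) * (to_fract (emb n) * g) = g"
        by (simp only: to_fract_1 mult_1)
      then have "g \<in> S"
        using frac.subspace_scale[OF S less.prems(2), of "C (1 / c)"] by (simp only:)
      then show ?thesis using g by simp
    next
      case False
      then obtain a where "poly n a = 0"
        using alg_closed_imp_poly_has_root[of n] by auto
      then obtain n' where n': "n = [:- a, 1:] * n'"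
        by (auto simp: poly_eq_0_iff_dvd)
      have deg: "n' \<noteq> 0" "degree n' < degree n"
        using less.prems(1) degree_mult_eq[of "[:- a, 1:]" n'] unfolding n' by fastforce+
      show ?thesis
      proof (cases "to_fract (emb n') * g \<in> S")
        case True
        then show ?thesis using less.hyps deg by blast
      next
        case no: False
        let ?g = "to_fract (emb n') * g"
        have xg: "to_fract (X - C a) * ?g \<in> S"
          using less.prems(2) unfolding n' by (simp only: emb_hom emb_linear to_fract_mult mult.assoc)
        have "degree [:- (poly rhs_poly a), cf1 E * a + cf3 E, 1:] > 0"
          by simp
        then obtain b where "poly [:- (poly rhs_poly a), cf1 E * a + cf3 E, 1:] b = 0"
          using alg_closed_imp_poly_has_root by blast
        then have b: "on_curve E (Affine a b)"
          unfolding on_curve_iff by (simp add: rhs_poly_def algebra_simps)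
        show ?thesis
        proof (cases "to_fract (Y - C b) * ?g \<in> S")
          case True
          then show ?thesis using b no xg by blast
        next
          case no': False
          have e: "to_fract (Y - C b) * ?g = to_fract ((Y - C b) * emb n') * g"
            by (simp add: mult.assoc del: to_fract_diff)
          have "to_fract (X - C a) * (to_fract (Y - C b) * ?g) \<in> S"
            using frac.subspace_scale[OF S xg, of "Y - C b"] by (simp only: mult.left_commute)
          moreover have "to_fract (Y - C (y_conj a b)) * (to_fract (Y - C b) * ?g)
              = to_fract ((Y - C b) * (Y - C (y_conj a b))) * ?g"
            by (simp only: mult_ac to_fract_mult)
          then have "to_fract (Y - C (y_conj a b)) * (to_fract (Y - C b) * ?g)
              = to_fract (cofactor a) * (to_fract (X - C a) * ?g)"
            unfolding conjugate_product[OF b] by (simp only: mult_ac to_fract_mult)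
          then have "to_fract (Y - C (y_conj a b)) * (to_fract (Y - C b) * ?g) \<in> S"
            using frac.subspace_scale[OF S xg] by (simp only:)
          ultimately show ?thesis
            using no' on_curve_y_conj[OF b] unfolding e by blast
        qed
      qed
    qed
  qed
  obtain n d' where "n \<noteq> 0" "emb n = d * d'"
    using norm_exists[OF d(1)] by blast
  moreover have "to_fract (d * d') * g \<in> S"
    using frac.subspace_scale[OF S d(2), of d'] by (simp add: mult_ac)
  ultimately show ?thesis
    using step by metis
qed

lemma nullstellensatz:
  fixes \<aa> :: "'a fract set"
  assumes S: "frac.subspace \<aa>" and sub: "\<aa> \<subseteq> A_in_K" and nz: "\<exists>g\<in>\<aa>. g \<noteq> 0" and one: "1 \<notin> \<aa>"
  shows "\<exists>a b. on_curve E (Affine a b) \<and> \<aa> \<subseteq> point_ideal a b"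
proof -
  obtain d where d: "to_fract d \<in> \<aa>" "d \<noteq> 0"
    using nz sub by (force simp: A_in_K_iff)
  obtain r a b where P: "on_curve E (Affine a b)" and r: "to_fract r \<notin> \<aa>"
    and x: "to_fract (X - C a) * to_fract r \<in> \<aa>" and y: "to_fract (Y - C b) * to_fract r \<in> \<aa>"
    using socle_point[OF S one d(2)] d(1) by auto
  have "g \<in> point_ideal a b" if g: "g \<in> \<aa>" for g
  proof -
    obtain s where s: "g = to_fract s" using sub g A_in_K_iff by blast
    obtain u v where uv: "s = C (residue a b s) + (X - C a) * u + (Y - C b) * v"
      using taylor[OF P] .
    have "residue a b s = 0"
    proof (rule ccontr)
      assume nz: "residue a b s \<noteq> 0"
      have "C (residue a b s) * r = r * s - u * ((X - C a) * r) - v * ((Y - C b) * r)"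
        by (subst (2) uv) (simp add: algebra_simps)
      then have "to_fract (C (residue a b s) * r) \<in> \<aa>"
        using frac.subspace_scale[OF S g, of r] frac.subspace_scale[OF S x, of u]
          frac.subspace_scale[OF S y, of v] unfolding s
        by (simp only: to_fract_diff to_fract_mult frac.subspace_diff[OF S])
      then have "to_fract (C (1 / residue a b s) * (C (residue a b s) * r)) \<in> \<aa>"
        using frac.subspace_scale[OF S] by (simp only: to_fract_mult)
      also have "C (1 / residue a b s) * (C (residue a b s) * r) = r"
        using nz by (simp flip: C_hom(6) mult.assoc)
      finally show False using r by simp
    qed
    then show ?thesis by (simp add: s point_ideal_def)
  qed
  then show ?thesis using P by blast
qed

text \<open>
  The denominator is the function with a simple pole at a point where the ideal vanishes.
\<close>

lemma proper_ideal_denominator: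
  fixes \<aa> :: "'a fract set"
  assumes S: "frac.subspace \<aa>" and sub: "\<aa> \<subseteq> A_in_K" and nz: "\<exists>g\<in>\<aa>. g \<noteq> 0" and one: "1 \<notin> \<aa>"
  shows "\<exists>h. h \<notin> A_in_K \<and> (\<forall>g\<in>\<aa>. h * g \<in> A_in_K)"
proof -
  obtain a b where "on_curve E (Affine a b)" "\<aa> \<subseteq> point_ideal a b"
    using nullstellensatz[OF assms] by blast
  then show ?thesis
    using pole_fun_facts(1,2)[of a b] point_inverse_mult[of a b _ "pole_fun a b"]
    by (intro exI[of _ "pole_fun a b"]) (auto simp: mult.commute)
qed

lemma subspace_point_ideal:
  assumes "on_curve E (Affine a b)"
  shows "frac.subspace (point_ideal a b)"
  unfolding point_ideal_def
  by (rule frac_subspaceI)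
    (auto simp: residue_hom[OF assms] image_iff simp flip: to_fract_add to_fract_mult to_fract_0)

text \<open>
  Steinitz's theorem in general requires an element that avoids finitely many primes. When I is
  A or the inverse of a single point P this is immediate: not all \<open>j r\<close> lie in P, since they
  generate the unit ideal, and after scaling by a constant \<open>1 - j r\<close> lies in \<open>P = I\<^sup>-\<^sup>1\<close>.
\<close>

lemma comaximal_generators:
  assumes I: "I = A_in_K \<or> (\<exists>a b. on_curve E (Affine a b) \<and> I = point_inverse a b)"
    and R: "frac.subspace R" and HR: "ideal_mult H R = A_in_K"
  shows "\<exists>j\<in>H. \<exists>r\<in>R. \<forall>u\<in>I. (1 - j * r) * u \<in> A_in_K"
  using I
proof
  assume "I = A_in_K"
  have "H \<noteq> {}"
  proof
    assume "H = {}"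
    then have "A_in_K \<subseteq> {0 :: 'a fract}"
      using HR by (simp add: ideal_mult_def)
    then show False
      using one_in_A by (metis singletonD subsetD zero_neq_one)
  qed
  then obtain j where "j \<in> H" by blast
  then show ?thesis
    using frac.subspace_0[OF R] \<open>I = A_in_K\<close> by (intro bexI[of _ j] bexI[of _ 0]) simp_all
next
  assume "\<exists>a b. on_curve E (Affine a b) \<and> I = point_inverse a b"
  then obtain a b where P: "on_curve E (Affine a b)" and I: "I = point_inverse a b" by blast
  have "\<exists>j\<in>H. \<exists>r\<in>R. j * r \<notin> point_ideal a b"
  proof (rule ccontr)
    assume "\<not> ?thesis"
    then have "1 \<in> point_ideal a b"
      using ideal_mult_subset_iff[OF subspace_point_ideal[OF P], of H R] HR one_in_A by blast
    then obtain g where "to_fract g = 1" "residue a b g = 0"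
      by (auto simp: point_ideal_def)
    then show False
      using residue_hom(5)[OF P] by (metis to_fract_1 to_fract_eq_iff zero_neq_one)
  qed
  then obtain j r where jr: "j \<in> H" "r \<in> R" "j * r \<notin> point_ideal a b" by blast
  then obtain s where s: "j * r = to_fract s" "residue a b s \<noteq> 0"
    using ideal_multI[OF jr(1,2)] HR by (auto simp: A_in_K_iff point_ideal_def)
  define k where "k = C (1 / residue a b s)"
  have "residue a b (1 - k * s) = 0"
    using s(2) by (simp add: k_def residue_hom[OF P])
  then have "to_fract (1 - k * s) \<in> point_ideal a b"
    unfolding point_ideal_def by blast
  moreover have "1 - j * (to_fract k * r) = to_fract (1 - k * s)"
    by (simp add: mult.left_commute[of j] s(1))
  ultimately have "\<forall>u\<in>I. (1 - j * (to_fract k * r)) * u \<in> A_in_K"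
    unfolding I using point_inverse_mult[OF P] by metis
  then show ?thesis
    using jr(1) frac.subspace_scale[OF R jr(2)] by blast
qed

lemma L_inverse: "c \<noteq> 0 \<Longrightarrow> to_fract (C (1 / c)) * to_fract (C c) = 1"
  by (simp flip: C_hom(6) to_fract_mult)

lemma frac_subspace_L_cancel:
  assumes S: "frac.subspace S" and "c \<noteq> 0" and g: "to_fract (C c) * g \<in> S"
  shows "g \<in> S"
proof -
  have "to_fract (C (1 / c)) * (to_fract (C c) * g) \<in> S"
    by (rule frac.subspace_scale[OF S g])
  then show ?thesis
    by (simp only: mult.assoc[symmetric] L_inverse[OF \<open>c \<noteq> 0\<close>] mult_1)
qed

text \<open>
  An ideal \<open>S = A + L u\<close> other than A has a multiple of u outside A killed by a point P modulo A.
  Hence S meets \<open>P\<^sup>-\<^sup>1 = A + L h\<close> outside A, and two modules that exceed A by one dimension and meet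
  outside A are equal.
\<close>

lemma colength_one_ideal:
  assumes S: "frac.subspace S" and one: "1 \<in> S" and u: "u \<in> S"
    and gen: "\<And>g. g \<in> S \<Longrightarrow> \<exists>r c. g = to_fract r + to_fract (C c) * u"
  shows "S = A_in_K \<or> (\<exists>a b. on_curve E (Affine a b) \<and> S = point_inverse a b)"
proof (cases "u \<in> A_in_K")
  case True
  have "g \<in> A_in_K" if "g \<in> S" for g
    using gen[OF that] True by (auto intro!: frac.subspace_add[OF subspace_A] A_mult)
  moreover have "A_in_K \<subseteq> S"
    using subspace_A_mult[OF S _ one] by auto
  ultimately show ?thesis by blast
next
  case False
  obtain n d where "d \<noteq> 0" "to_fract d * u = to_fract n"
    by (rule fract_cases_quotient)
  then obtain r a b where P: "on_curve E (Affine a b)" and r: "to_fract r * u \<notin> A_in_K"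
    and "to_fract (X - C a) * (to_fract r * u) \<in> A_in_K" "to_fract (Y - C b) * (to_fract r * u) \<in> A_in_K"
    using socle_point[OF subspace_A False, of d] by auto
  then have "to_fract r * u \<in> point_inverse a b"
    unfolding point_inverse_def by blast
  then obtain s c where sc: "to_fract r * u = to_fract s + to_fract (C c) * pole_fun a b"
    using point_inverse_expand[OF P] by blast
  have "c \<noteq> 0"
    using r sc by auto
  have A: "to_fract s \<in> S" for s
    using subspace_A_mult[OF S _ one, of "to_fract s"] by simp
  have "to_fract (C c) * pole_fun a b = to_fract r * u - to_fract s"
    by (simp add: sc)
  also have "\<dots> \<in> S"
    by (intro frac.subspace_diff[OF S] frac.subspace_scale[OF S] u A)
  finally have h: "pole_fun a b \<in> S"
    using frac_subspace_L_cancel[OF S \<open>c \<noteq> 0\<close>] by blast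
  have "point_inverse a b \<subseteq> S"
  proof
    fix g assume "g \<in> point_inverse a b"
    then obtain r c where "g = to_fract r + to_fract (C c) * pole_fun a b"
      using point_inverse_expand[OF P] by blast
    then show "g \<in> S"
      using h A by (simp add: frac.subspace_add[OF S] frac.subspace_scale[OF S])
  qed
  moreover have "S \<subseteq> point_inverse a b"
  proof -
    note Q = subspace_point_inverse[of a b]
    have A': "to_fract s \<in> point_inverse a b" for s
      using frac.subspace_scale[OF Q point_inverse_one, of s] by simp
    obtain r c where rc: "pole_fun a b = to_fract r + to_fract (C c) * u"
      using gen[OF h] by blast
    then have "c \<noteq> 0"
      using pole_fun_facts(2)[OF P] by auto
    have "to_fract (C c) * u = pole_fun a b - to_fract r"
      by (simp add: rc)
    also have "\<dots> \<in> point_inverse a b"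
      by (intro frac.subspace_diff[OF Q] pole_fun_facts(1)[OF P] A')
    finally have "u \<in> point_inverse a b"
      using frac_subspace_L_cancel[OF Q \<open>c \<noteq> 0\<close>] by blast
    then show ?thesis
      using gen A' by (metis frac.subspace_add[OF Q] frac.subspace_scale[OF Q] subsetI)
  qed
  ultimately show ?thesis using P by blast
qed

text \<open>
  The ideal of denominators of g has no zeros on the curve, hence contains 1.
\<close>

lemma regular_everywhere:
  fixes g :: "'a fract"
  assumes "\<And>a b. on_curve E (Affine a b) \<Longrightarrow> \<exists>s. residue a b s \<noteq> 0 \<and> to_fract s * g \<in> A_in_K"
  shows "g \<in> A_in_K"
proof (rule ccontr)
  assume no: "g \<notin> A_in_K"
  define \<aa> where "\<aa> = {s \<in> A_in_K. s * g \<in> A_in_K}"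
  have "\<aa> = A_in_K \<inter> {s. \<forall>t\<in>{g}. s * t \<in> A_in_K}"
    by (auto simp: \<aa>_def)
  then have sub: "frac.subspace \<aa>"
    using frac.subspace_inter[OF subspace_A frac_subspace_colon[OF subspace_A, of "{g}"]] by simp
  obtain n d where d: "d \<noteq> 0" "to_fract d * g = to_fract n"
    by (rule fract_cases_quotient)
  then have "to_fract d \<in> \<aa>" "to_fract d \<noteq> 0"
    by (simp_all add: \<aa>_def)
  moreover have "\<aa> \<subseteq> A_in_K" "1 \<notin> \<aa>"
    using no by (auto simp: \<aa>_def)
  ultimately obtain a b where P: "on_curve E (Affine a b)" "\<aa> \<subseteq> point_ideal a b"
    using nullstellensatz[OF sub] by blast
  obtain s where s: "residue a b s \<noteq> 0" "to_fract s * g \<in> A_in_K"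
    using assms[OF P(1)] by blast
  then have "to_fract s \<in> point_ideal a b"
    using P(2) by (auto simp: \<aa>_def)
  then show False
    using s(1) by (auto simp: point_ideal_def)
qed

section \<open>Local rings and orders of vanishing\<close>

lemma chart_eval_affine: "chart_eval \<pi> (Affine a b) F = to_fract (\<pi> F)"
proof -
  have 1: "poly (map_poly (const_K \<pi>) f) (x_K \<pi>) = to_fract (emb f)" for f
    by (induction f) (simp_all add: map_poly_pCons const_K_def x_K_def emb_pCons)
  have "eval2 (map_poly (map_poly (const_K \<pi>)) F) (x_K \<pi>) (y_K \<pi>) = to_fract (\<pi> F)"
    by (induction F) (simp_all add: map_poly_pCons 1 pi_pCons y_K_def)
  then show ?thesis
    by (simp add: chart_eval_def)
qed

lemma local_ring_affine:
  assumes "on_curve E (Affine a b)"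
  shows "local_ring \<pi> (Affine a b) = {to_fract f / to_fract g | f g. residue a b g \<noteq> 0}"
    and "max_ideal \<pi> (Affine a b) =
      {to_fract f / to_fract g | f g. residue a b f = 0 \<and> residue a b g \<noteq> 0}"
proof -
  have v: "value_at (Affine a b) F = residue a b (\<pi> F)" for F
    by (simp add: value_at_def residue_pi[OF assms])
  have s: "\<exists>F. g = \<pi> F" for g
    using pi_surj by (auto simp: surj_def)
  show "local_ring \<pi> (Affine a b) = {to_fract f / to_fract g | f g. residue a b g \<noteq> 0}"
    unfolding local_ring_def v chart_eval_affine by (safe; metis s)
  show "max_ideal \<pi> (Affine a b) =
      {to_fract f / to_fract g | f g. residue a b f = 0 \<and> residue a b g \<noteq> 0}"
    unfolding max_ideal_def v chart_eval_affine by (safe; metis s)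
qed

end

locale curve_point = smooth_weierstrass E \<pi>
  for E :: "'l::alg_closed_field weierstrass" and \<pi> :: "'l poly poly \<Rightarrow> 'a::idom" +
  fixes a b :: 'l
  assumes on_curve: "on_curve E (Affine a b)"
begin

abbreviation "O_P \<equiv> local_ring \<pi> (Affine a b)"
abbreviation "m_P \<equiv> max_ideal \<pi> (Affine a b)"

definition loc_units :: "'a fract set" where
  "loc_units = {to_fract f / to_fract g | f g. residue a b f \<noteq> 0 \<and> residue a b g \<noteq> 0}"

lemmas loc_eq = local_ring_affine(1)[OF on_curve]
lemmas max_eq = local_ring_affine(2)[OF on_curve]
lemmas res_hom = residue_hom[OF on_curve]

lemma res_nonzero: "residue a b g \<noteq> 0 \<Longrightarrow> g \<noteq> 0"
  using res_hom(4) by blast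

lemma locI: "residue a b g \<noteq> 0 \<Longrightarrow> to_fract f / to_fract g \<in> O_P"
  and maxI: "residue a b f = 0 \<Longrightarrow> residue a b g \<noteq> 0 \<Longrightarrow> to_fract f / to_fract g \<in> m_P"
  and loc_unitsI: "residue a b f \<noteq> 0 \<Longrightarrow> residue a b g \<noteq> 0 \<Longrightarrow> to_fract f / to_fract g \<in> loc_units"
  unfolding loc_eq max_eq loc_units_def by blast+

lemma loc_mult: "g \<in> O_P \<Longrightarrow> h \<in> O_P \<Longrightarrow> g * h \<in> O_P"
proof -
  assume "g \<in> O_P" "h \<in> O_P"
  then obtain f k f' k' where "g = to_fract f / to_fract k" "residue a b k \<noteq> 0"
    "h = to_fract f' / to_fract k'" "residue a b k' \<noteq> 0"
    unfolding loc_eq by blast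
  then show ?thesis
    using locI[of "k * k'" "f * f'"] by (simp add: res_hom)
qed

lemma max_mult: "g \<in> m_P \<Longrightarrow> h \<in> O_P \<Longrightarrow> g * h \<in> m_P"
proof -
  assume "g \<in> m_P" "h \<in> O_P"
  then obtain f k f' k' where "g = to_fract f / to_fract k" "residue a b f = 0" "residue a b k \<noteq> 0"
    "h = to_fract f' / to_fract k'" "residue a b k' \<noteq> 0"
    unfolding loc_eq max_eq by blast
  then show ?thesis
    using maxI[of "f * f'" "k * k'"] by (simp add: res_hom)
qed

lemma to_fract_in_loc: "to_fract f \<in> O_P"
  using locI[of 1 f] res_hom(5) by simp

lemma loc_units_iff: "loc_units = O_P - m_P"
proof -
  have "g \<notin> m_P" if "g \<in> loc_units" for g
  proof
    assume "g \<in> m_P"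
    with that obtain f k f' k' where 1: "g = to_fract f / to_fract k" "residue a b f \<noteq> 0"
      "residue a b k \<noteq> 0" "g = to_fract f' / to_fract k'" "residue a b f' = 0" "residue a b k' \<noteq> 0"
      unfolding loc_units_def max_eq by blast
    then have "to_fract (f * k') = to_fract (f' * k)"
      using res_nonzero[OF 1(3)] res_nonzero[OF 1(6)] by (simp add: frac_eq_eq)
    then have "residue a b (f * k') = residue a b (f' * k)"
      by (simp only: to_fract_eq_iff)
    then show False
      using 1 by (simp add: res_hom)
  qed
  then show ?thesis
    unfolding loc_units_def loc_eq max_eq by blast
qed

lemma loc_units_closed:
  "1 \<in> loc_units" "u \<in> loc_units \<Longrightarrow> v \<in> loc_units \<Longrightarrow> u * v \<in> loc_units"
  "u \<in> loc_units \<Longrightarrow> inverse u \<in> loc_units" "u \<in> loc_units \<Longrightarrow> u \<noteq> 0"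
  "u \<in> loc_units \<Longrightarrow> u \<in> O_P" "residue a b f \<noteq> 0 \<Longrightarrow> to_fract f \<in> loc_units"
proof -
  show 1: "to_fract f \<in> loc_units" if "residue a b f \<noteq> 0" for f
    using that loc_unitsI[of f 1] res_hom(5) by simp
  show "1 \<in> loc_units"
    using 1[of 1] res_hom(5) by simp
  show "u * v \<in> loc_units" if uv: "u \<in> loc_units" "v \<in> loc_units"
  proof -
    obtain f k f' k' where "u = to_fract f / to_fract k" "residue a b f \<noteq> 0" "residue a b k \<noteq> 0"
      "v = to_fract f' / to_fract k'" "residue a b f' \<noteq> 0" "residue a b k' \<noteq> 0"
      using uv unfolding loc_units_def by blast
    then show ?thesis
      using loc_unitsI[of "f * f'" "k * k'"] by (simp add: res_hom)
  qed
  show "inverse u \<in> loc_units" if "u \<in> loc_units"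
    using that loc_unitsI unfolding loc_units_def by (fastforce simp: inverse_divide)
  show "u \<noteq> 0" if "u \<in> loc_units"
    using that res_nonzero unfolding loc_units_def by auto
  show "u \<in> O_P" if "u \<in> loc_units"
    using that unfolding loc_units_iff by simp
qed

lemma loc_units_powi: "u \<in> loc_units \<Longrightarrow> u powi n \<in> loc_units"
proof -
  assume u: "u \<in> loc_units"
  have "v ^ k \<in> loc_units" if "v \<in> loc_units" for v k
    by (induction k) (use that in \<open>simp_all add: loc_units_closed\<close>)
  then show ?thesis
    using u loc_units_closed(3) by (simp add: power_int_def)
qed

definition is_uniformizer :: "'a fract \<Rightarrow> bool" where
  "is_uniformizer t \<longleftrightarrow> m_P = (\<lambda>h. t * h) ` O_P"

lemma to_fract_in_max: "residue a b f = 0 \<Longrightarrow> to_fract f \<in> m_P"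
  using maxI[of f 1] res_hom(5) by simp

lemma X_in_max: "to_fract (X - C a) \<in> m_P" and Y_in_max: "to_fract (Y - C b) \<in> m_P"
  by (auto intro!: to_fract_in_max simp: res_hom simp del: to_fract_diff)

lemma uniformizer_facts:
  assumes "is_uniformizer t"
  shows "t \<noteq> 0" "t \<in> m_P" "g \<in> m_P \<Longrightarrow> \<exists>h\<in>O_P. g = t * h"
proof -
  show "g \<in> m_P \<Longrightarrow> \<exists>h\<in>O_P. g = t * h" for g
    using assms by (auto simp: is_uniformizer_def)
  then obtain h where "to_fract (X - C a) = t * h"
    using X_in_max by blast
  then show "t \<noteq> 0"
    using X_minus_C_nonzero[of a] by (metis mult_zero_left to_fract_eq_0_iff)
  show "t \<in> m_P"
    using assms to_fract_in_loc[of 1] unfolding is_uniformizer_def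
    by (metis imageI mult.right_neutral to_fract_1)
qed

lemma is_uniformizerI:
  assumes "t \<in> m_P" "l \<in> O_P" "l' \<in> O_P" "to_fract (X - C a) = t * l" "to_fract (Y - C b) = t * l'"
  shows "is_uniformizer t"
  unfolding is_uniformizer_def
proof (rule antisym; rule subsetI)
  fix g assume "g \<in> (\<lambda>h. t * h) ` O_P"
  then show "g \<in> m_P" using max_mult[OF assms(1)] by blast
next
  fix g assume "g \<in> m_P"
  then obtain f k where g: "g = to_fract f / to_fract k" "residue a b f = 0" "residue a b k \<noteq> 0"
    unfolding max_eq by blast
  obtain r s where f: "f = (X - C a) * r + (Y - C b) * s"
    using taylor[OF on_curve, of f] g(2) by auto
  obtain m n where l: "l = to_fract m / to_fract n" "residue a b n \<noteq> 0"
    using assms(2) unfolding loc_eq by blast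
  obtain m' n' where l': "l' = to_fract m' / to_fract n'" "residue a b n' \<noteq> 0"
    using assms(3) unfolding loc_eq by blast
  have "to_fract f = (t * l) * to_fract r + (t * l') * to_fract s"
    by (simp only: f to_fract_add to_fract_mult assms(4,5))
  also have "\<dots> = t * (to_fract (m * r * n' + m' * s * n) / to_fract (n * n'))"
    using res_nonzero[OF l(2)] res_nonzero[OF l'(2)] by (simp add: l(1) l'(1) field_simps)
  finally have "g = t * (to_fract (m * r * n' + m' * s * n) / to_fract (n * n' * k))"
    by (simp add: g(1))
  moreover have "to_fract (m * r * n' + m' * s * n) / to_fract (n * n' * k) \<in> O_P"
    using g(3) l(2) l'(2) by (intro locI) (simp add: res_hom)
  ultimately show "g \<in> (\<lambda>h. t * h) ` O_P" by blast
qed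

lemma conjugate_quotient:
  "to_fract (Y - C b) * to_fract (Y - C (y_conj a b)) = to_fract (X - C a) * to_fract (cofactor a)"
  using conjugate_product[OF on_curve] by (simp only: to_fract_mult[symmetric])

text \<open>
  From \<open>(y - b) (y - b') = (x - a) Q\<close>: if \<open>b \<noteq> b'\<close>, then \<open>y - b'\<close> is a unit at the point and \<open>x - a\<close> is
  a uniformizer. Otherwise Q is a unit, \<open>y - b\<close> is a uniformizer, and \<open>x - a\<close> is a unit times its
  square.
\<close>

lemma uniformizer_exists:
  obtains t k u where "is_uniformizer t" "u \<in> loc_units" "to_fract (X - C a) = u * t ^ k"
proof (cases "b = y_conj a b")
  case False
  let ?t = "to_fract (X - C a)" and ?c = "to_fract (Y - C (y_conj a b))"
  have "?c \<in> loc_units"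
    using False by (intro loc_units_closed) (simp add: res_hom)
  then have i: "inverse ?c \<in> loc_units" "?c \<noteq> 0"
    using loc_units_closed by blast+
  have "to_fract (Y - C b) = ?t * (to_fract (cofactor a) * inverse ?c)"
    using conjugate_quotient i(2) by (simp add: field_simps del: to_fract_diff)
  then have "is_uniformizer ?t"
    using X_in_max to_fract_in_loc[of 1] i(1)
    by (intro is_uniformizerI[of ?t 1 "to_fract (cofactor a) * inverse ?c"])
      (auto intro: loc_mult to_fract_in_loc loc_units_closed simp del: to_fract_diff)
  then show thesis
    using loc_units_closed(1) by (intro that[of ?t 1 1]) (simp_all del: to_fract_diff)
next
  case True
  let ?t = "to_fract (Y - C b)" and ?c = "to_fract (cofactor a)"
  have "residue a b (cofactor a) = - (cf1 E * b - (3 * a ^ 2 + 2 * cf2 E * a + cf4 E))"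
    unfolding cofactor_def res_hom by (simp add: power2_eq_square)
  moreover have "2 * b + cf1 E * a + cf3 E = 0"
    using True by (simp add: y_conj_def algebra_simps eq_neg_iff_add_eq_0)
  ultimately have "?c \<in> loc_units"
    using smooth[OF on_curve] by (intro loc_units_closed) simp
  then have i: "inverse ?c \<in> loc_units" "?c \<noteq> 0"
    using loc_units_closed by blast+
  have x: "to_fract (X - C a) = inverse ?c * ?t ^ 2"
    using conjugate_quotient i(2) True by (simp add: field_simps power2_eq_square del: to_fract_diff)
  then have "is_uniformizer ?t"
    using Y_in_max to_fract_in_loc[of 1] i(1)
    by (intro is_uniformizerI[of ?t "?t * inverse ?c" 1])
      (auto intro: loc_mult to_fract_in_loc loc_units_closed simp: power2_eq_square
        simp del: to_fract_diff)
  then show thesis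
    using x i(1) by (intro that)
qed

text \<open>
  A divisor of a unit times a power of t is of the same form. This bounds the order of a
  function by that of a multiple, and replaces Krull's intersection theorem in the construction
  of the valuation.
\<close>

lemma unit_power_factor:
  assumes t: "is_uniformizer t" and "d \<in> O_P" "d' \<in> O_P" "d * d' = u * t ^ k" "u \<in> loc_units"
  shows "\<exists>v\<in>loc_units. \<exists>j. d = v * t ^ j"
  using assms(2-5)
proof (induction k arbitrary: d)
  case 0
  have "d \<notin> m_P"
    using max_mult[OF _ \<open>d' \<in> O_P\<close>, of d] 0 by (auto simp: loc_units_iff)
  then show ?case
    using 0 by (intro bexI[of _ d] exI[of _ 0]) (simp_all add: loc_units_iff)
next
  case (Suc k)
  show ?case
  proof (cases "d \<in> m_P")
    case False
    then show ?thesis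
      using Suc.prems by (intro bexI[of _ d] exI[of _ 0]) (simp_all add: loc_units_iff)
  next
    case True
    then obtain e where e: "e \<in> O_P" "d = t * e"
      using uniformizer_facts(3)[OF t] by blast
    have "e * d' = u * t ^ k"
      using Suc.prems(3) uniformizer_facts(1)[OF t] by (simp add: e(2) mult_ac)
    then obtain v j where "v \<in> loc_units" "e = v * t ^ j"
      using Suc.IH[OF e(1) Suc.prems(2) _ Suc.prems(4)] by blast
    then show ?thesis
      using e(2) by (intro bexI[of _ v] exI[of _ "Suc j"]) simp_all
  qed
qed

text \<open>
  d divides its norm, a polynomial \<open>(x - a)\<^sup>k m(x)\<close> with \<open>m(a) \<noteq> 0\<close>.
\<close>

lemma unit_power_A:
  assumes t: "is_uniformizer t" and x: "to_fract (X - C a) = w * t ^ k" "w \<in> loc_units" and "d \<noteq> 0"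
  shows "\<exists>v\<in>loc_units. \<exists>j. to_fract d = v * t ^ j"
proof -
  obtain n d' where n: "n \<noteq> 0" "emb n = d * d'"
    using norm_exists[OF \<open>d \<noteq> 0\<close>] by blast
  obtain m where m: "n = [:- a, 1:] ^ order a n * m" "\<not> [:- a, 1:] dvd m"
    using order_decomp[OF n(1)] by blast
  have emb_power: "emb (p ^ i) = emb p ^ i" for p i
    by (induction i) simp_all
  have emb_residue: "residue a b (emb p) = poly p a" for p
    by (induction p) (simp_all add: res_hom emb_pCons)
  have "residue a b (emb m) \<noteq> 0"
    using m(2) by (simp add: emb_residue poly_eq_0_iff_dvd)
  then have unit: "w ^ order a n * to_fract (emb m) \<in> loc_units"
    using loc_units_powi[OF x(2), of "int (order a n)"]
    by (intro loc_units_closed) simp_all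
  have pw: "to_fract (g ^ i) = to_fract g ^ i" for g :: 'a and i
    by (induction i) simp_all
  have "to_fract d * to_fract d' = to_fract (emb ([:- a, 1:] ^ order a n * m))"
    using n(2) m(1) by simp
  also have "\<dots> = (w ^ order a n * to_fract (emb m)) * t ^ (k * order a n)"
    unfolding emb_hom emb_power emb_linear to_fract_mult pw x
    by (simp add: power_mult_distrib power_mult mult_ac)
  finally show ?thesis
    by (intro unit_power_factor[OF t to_fract_in_loc to_fract_in_loc _ unit])
qed

lemma unit_power_K:
  assumes "g \<noteq> 0"
  obtains t v n where "is_uniformizer t" "v \<in> loc_units" "g = v * t powi n"
proof -
  obtain t k w where t: "is_uniformizer t" "w \<in> loc_units" "to_fract (X - C a) = w * t ^ k"
    by (rule uniformizer_exists)
  note t0 = uniformizer_facts(1)[OF t(1)]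
  obtain n d where d: "d \<noteq> 0" "to_fract d * g = to_fract n"
    by (rule fract_cases_quotient)
  then have "n \<noteq> 0" using assms by auto
  obtain v i where v: "v \<in> loc_units" "to_fract d = v * t ^ i"
    using unit_power_A[OF t(1,3,2) d(1)] by blast
  obtain v' i' where v': "v' \<in> loc_units" "to_fract n = v' * t ^ i'"
    using unit_power_A[OF t(1,3,2) \<open>n \<noteq> 0\<close>] by blast
  have nz: "v \<noteq> 0" using v(1) loc_units_closed(4) by blast
  have "g = to_fract n / to_fract d"
    using d by (simp add: field_simps)
  also have "\<dots> = (v' * inverse v) * t powi (int i' - int i)"
    using nz t0 by (simp add: v(2) v'(2) power_int_diff field_simps)
  finally show thesis
    by (rule that[OF t(1) loc_units_closed(2)[OF v'(1) loc_units_closed(3)[OF v(1)]]])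
qed

lemma unit_power_in_loc_iff:
  assumes t: "is_uniformizer t" and v: "v \<in> loc_units"
  shows "v * t powi n \<in> O_P \<longleftrightarrow> n \<ge> 0" "v * t powi n \<in> loc_units \<longleftrightarrow> n = 0"
proof -
  note t0 = uniformizer_facts(1)[OF t]
  have "t \<in> O_P"
    using uniformizer_facts(2)[OF t] unfolding max_eq loc_eq by blast
  then have t_loc: "t ^ k \<in> O_P" for k
    by (induction k) (use to_fract_in_loc[of 1] loc_mult in simp_all)
  have pos: "u * t powi k \<in> m_P" if "k > 0" "u \<in> loc_units" for k u
  proof -
    have "u * t powi k = t * (u * t ^ (nat k - 1))"
      using that t0 by (simp add: power_int_def mult.left_commute flip: power_Suc)
    then show ?thesis
      using that max_mult[OF uniformizer_facts(2)[OF t]] loc_mult t_loc loc_units_closed(5) by metis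
  qed
  have nonneg: "u * t powi k \<in> O_P" if "k \<ge> 0" "u \<in> loc_units" for k u
    using that loc_mult t_loc loc_units_closed(5) by (simp add: power_int_def)
  have neg: "v * t powi n \<notin> O_P" if "n < 0"
  proof
    assume l: "v * t powi n \<in> O_P"
    have "(inverse v * t powi (- n)) * (v * t powi n) = 1"
      using t0 loc_units_closed(4)[OF v] by (simp add: power_int_minus field_simps)
    moreover have "(inverse v * t powi (- n)) * (v * t powi n) \<in> m_P"
      using that v by (intro max_mult pos l loc_units_closed(3)) simp_all
    ultimately show False
      using loc_units_closed(1) by (simp add: loc_units_iff)
  qed
  show "v * t powi n \<in> O_P \<longleftrightarrow> n \<ge> 0"
    using neg nonneg[OF _ v] by force
  show "v * t powi n \<in> loc_units \<longleftrightarrow> n = 0"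
    using neg pos[OF _ v] v by (cases n "0 :: int" rule: linorder_cases) (auto simp: loc_units_iff)
qed

lemma ord_at_eq:
  assumes t: "is_uniformizer t" and v: "v \<in> loc_units"
  shows "ord_at \<pi> (Affine a b) (v * t powi n) = n"
proof -
  have "n' = n" if t': "is_uniformizer t'" and v': "v' \<in> loc_units" and eq: "v * t powi n = v' * t' powi n'"
    for t' v' n'
  proof -
    note t0 = uniformizer_facts(1)[OF t] and t'0 = uniformizer_facts(1)[OF t']
    obtain h where h: "h \<in> O_P" "t' = t * h"
      using uniformizer_facts(2)[OF t'] uniformizer_facts(3)[OF t] by blast
    obtain h' where h': "h' \<in> O_P" "t = t' * h'"
      using uniformizer_facts(2)[OF t] uniformizer_facts(3)[OF t'] by blast
    have "h * h' = 1"
      using h(2) h'(2) t0 by (metis mult.assoc mult_cancel_left2 mult_cancel_left1)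
    then have "h \<notin> m_P"
      using max_mult[OF _ h'(1), of h] loc_units_closed(1) by (auto simp: loc_units_iff)
    then have hu: "h \<in> loc_units"
      using h(1) by (simp add: loc_units_iff)
    have "v' * h powi n' = v * t powi (n - n')"
      using eq t0 by (simp add: h(2) power_int_mult_distrib power_int_diff field_simps)
    moreover have "v' * h powi n' \<in> loc_units"
      by (intro loc_units_closed(2) v' loc_units_powi hu)
    ultimately show ?thesis
      using unit_power_in_loc_iff(2)[OF t v, of "n - n'"] by simp
  qed
  then show ?thesis
    unfolding ord_at_def using t v
    by (intro the_equality) (auto simp: is_uniformizer_def loc_units_iff)
qed

lemma ord_at_nonneg_iff:
  assumes "g \<noteq> 0"
  shows "ord_at \<pi> (Affine a b) g \<ge> 0 \<longleftrightarrow> g \<in> O_P"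
    "ord_at \<pi> (Affine a b) g \<ge> - 1 \<longleftrightarrow> (\<forall>p\<in>m_P. p * g \<in> O_P)"
proof -
  obtain t v n where t: "is_uniformizer t" and v: "v \<in> loc_units" and g: "g = v * t powi n"
    using unit_power_K[OF assms] .
  note t0 = uniformizer_facts(1)[OF t]
  show "ord_at \<pi> (Affine a b) g \<ge> 0 \<longleftrightarrow> g \<in> O_P"
    unfolding g ord_at_eq[OF t v] unit_power_in_loc_iff(1)[OF t v] ..
  have "(\<forall>p\<in>m_P. p * g \<in> O_P) \<longleftrightarrow> t * g \<in> O_P"
  proof
    assume tg: "t * g \<in> O_P"
    show "\<forall>p\<in>m_P. p * g \<in> O_P"
    proof
      fix p assume "p \<in> m_P"
      then obtain h where h: "h \<in> O_P" "p = t * h"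
        using uniformizer_facts(3)[OF t] by blast
      show "p * g \<in> O_P"
        using loc_mult[OF h(1) tg] by (simp add: h(2) mult_ac)
    qed
  qed (use uniformizer_facts(2)[OF t] in blast)
  also have "t * g = v * t powi (n + 1)"
    using t0 by (simp add: g power_int_add)
  finally show "ord_at \<pi> (Affine a b) g \<ge> - 1 \<longleftrightarrow> (\<forall>p\<in>m_P. p * g \<in> O_P)"
    unfolding unit_power_in_loc_iff(1)[OF t v] unfolding g ord_at_eq[OF t v] by auto
qed

end

context smooth_weierstrass
begin

text \<open>
  Any order at infinity is allowed for k large enough, so membership is a condition at the
  affine points only. The product of a function satisfying it with an element of the ideal of
  the point is regular everywhere, hence lies in A.
\<close>

lemma inverse_ideal_point:
  assumes V: "on_curve E (Affine a b)"
  shows "inverse_ideal E \<pi> (point_divisor (Affine a b)) = point_inverse a b"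
proof -
  have "g \<in> inverse_ideal E \<pi> (point_divisor (Affine a b)) \<longleftrightarrow> g \<in> point_inverse a b" for g
  proof (cases "g = 0")
    case True
    then show ?thesis
      using frac.subspace_0[OF subspace_point_inverse]
      by (simp add: inverse_ideal_def riemann_roch_space_def)
  next
    case nz: False
    have "g \<in> inverse_ideal E \<pi> (point_divisor (Affine a b)) \<longleftrightarrow>
      (\<forall>c d. on_curve E (Affine c d) \<longrightarrow>
        ord_at \<pi> (Affine c d) g + (if c = a \<and> d = b then 1 else 0) \<ge> 0)" (is "_ \<longleftrightarrow> ?R")
    proof
      assume "g \<in> inverse_ideal E \<pi> (point_divisor (Affine a b))"
      then obtain k where k: "\<And>P. on_curve E P \<Longrightarrow> ord_at \<pi> P g +
          (point_divisor (Affine a b) P + int k * point_divisor Infinity P) \<ge> 0"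
        using nz unfolding inverse_ideal_def riemann_roch_space_def by blast
      show ?R
        using k[of "Affine _ _"] by (fastforce simp: point_divisor_def)
    next
      assume R: ?R
      define k where "k = nat (- ord_at \<pi> Infinity g)"
      have "ord_at \<pi> P g + (point_divisor (Affine a b) P + int k * point_divisor Infinity P) \<ge> 0"
        if "on_curve E P" for P
        using R that by (cases P) (auto simp: point_divisor_def k_def)
      then show "g \<in> inverse_ideal E \<pi> (point_divisor (Affine a b))"
        unfolding inverse_ideal_def riemann_roch_space_def by blast
    qed
    also have "\<dots> \<longleftrightarrow> g \<in> point_inverse a b"
    proof
      assume R: ?R
      have "to_fract r * g \<in> A_in_K" if r: "residue a b r = 0" for r
      proof (rule regular_everywhere)
        fix c d assume P: "on_curve E (Affine c d)"
        interpret curve_point E \<pi> c d by unfold_locales (rule P)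
        have "to_fract r * g \<in> O_P"
        proof (cases "c = a \<and> d = b")
          case True
          then show ?thesis
            using R P r ord_at_nonneg_iff(2)[OF nz] to_fract_in_max by fastforce
        next
          case False
          then have "g \<in> O_P"
            using R[rule_format, OF P] ord_at_nonneg_iff(1)[OF nz] by (simp split: if_splits)
          then show ?thesis by (intro loc_mult to_fract_in_loc)
        qed
        then obtain f k where "to_fract r * g = to_fract f / to_fract k" "residue c d k \<noteq> 0"
          unfolding loc_eq by blast
        then show "\<exists>s. residue c d s \<noteq> 0 \<and> to_fract s * (to_fract r * g) \<in> A_in_K"
          using res_nonzero by (intro exI[of _ k]) auto
      qed
      then show "g \<in> point_inverse a b"
        unfolding point_inverse_def by (auto simp: residue_hom[OF V] simp del: to_fract_diff)
    next
      assume g: "g \<in> point_inverse a b"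
      show ?R
      proof (intro allI impI)
        fix c d assume P: "on_curve E (Affine c d)"
        interpret curve_point E \<pi> c d by unfold_locales (rule P)
        show "ord_at \<pi> (Affine c d) g + (if c = a \<and> d = b then 1 else 0) \<ge> 0"
        proof (cases "c = a \<and> d = b")
          case True
          have "p * g \<in> O_P" if "p \<in> m_P" for p
          proof -
            obtain f k where p: "p = to_fract f / to_fract k" "residue a b f = 0" "residue a b k \<noteq> 0"
              using \<open>p \<in> m_P\<close> True unfolding max_eq by blast
            have "to_fract f * g \<in> A_in_K"
              using p(2) by (intro point_inverse_mult[OF V _ g]) (auto simp: point_ideal_def)
            then obtain s where "to_fract f * g = to_fract s" by (auto simp: A_in_K_iff)
            then have "p * g = to_fract s / to_fract k"
              by (simp add: p(1))
            then show ?thesis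
              using p(3) True unfolding loc_eq by blast
          qed
          then show ?thesis
            using True ord_at_nonneg_iff(2)[OF nz] by fastforce
        next
          case False
          have "\<exists>r s. residue c d r \<noteq> 0 \<and> to_fract r * g = to_fract s"
          proof (cases "c = a")
            case False
            have "residue c d (X - C a) \<noteq> 0" using False by (simp add: res_hom)
            then show ?thesis
              using g unfolding point_inverse_def A_in_K_iff by blast
          next
            case True
            have "residue c d (Y - C b) \<noteq> 0" using True \<open>\<not> (c = a \<and> d = b)\<close> unfolding res_hom by simp
            then show ?thesis
              using g unfolding point_inverse_def A_in_K_iff by blast
          qed
          then obtain r s where r: "residue c d r \<noteq> 0" "to_fract r * g = to_fract s" by blast
          then have "g = to_fract s / to_fract r"
            using res_nonzero[OF r(1)] by (simp add: field_simps)
          then have "g \<in> O_P"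
            unfolding loc_eq using r(1) by blast
          then show ?thesis
            using ord_at_nonneg_iff(1)[OF nz] by auto
        qed
      qed
    qed
    finally show ?thesis .
  qed
  then show ?thesis by blast
qed

end

section \<open>Modules over polynomial rings from commuting operators\<close>

text \<open>
  The action of \<open>\<Sum> c\<^sub>i X\<^sup>i\<close> when X acts by the operator m. Applied twice, first for x over L and
  then for y over \<open>L[x]\<close>, it makes the twisted polynomials a module over \<open>L[x,y]\<close>.
\<close>

definition poly_act :: "('r::comm_ring_1 \<Rightarrow> 'm::ab_group_add \<Rightarrow> 'm) \<Rightarrow> ('m \<Rightarrow> 'm) \<Rightarrow> 'r poly \<Rightarrow> 'm \<Rightarrow> 'm" where
  "poly_act scale m f w = (\<Sum>i\<le>degree f. scale (coeff f i) ((m ^^ i) w))"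

locale module_endomorphism = Modules.module scale
  for scale :: "'r::comm_ring_1 \<Rightarrow> 'm::ab_group_add \<Rightarrow> 'm" +
  fixes m :: "'m \<Rightarrow> 'm"
  assumes endo_add: "m (v + w) = m v + m w" and endo_scale: "m (scale c v) = scale c (m v)"
begin

abbreviation "act \<equiv> poly_act scale m"

lemma act_0 [simp]: "act 0 w = 0"
  by (simp add: poly_act_def)

lemma act_pCons: "act (pCons c f) w = scale c w + act f (m w)"
proof (cases "f = 0")
  case True
  then show ?thesis by (simp add: poly_act_def)
next
  case False
  then show ?thesis
    by (simp add: poly_act_def sum.atMost_Suc_shift funpow_Suc_right del: sum.atMost_Suc funpow.simps)
qed

lemma act_add_right: "act f (v + w) = act f v + act f w"
  by (induction f arbitrary: v w) (simp_all add: act_pCons endo_add scale_right_distrib)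

lemma act_endo: "act f (m w) = m (act f w)"
proof (induction f arbitrary: w)
  case 0
  show ?case using endo_add[of 0 0] by simp
qed (simp add: act_pCons endo_add endo_scale)

lemma act_add_left: "act (f + g) w = act f w + act g w"
  by (induction f g arbitrary: w rule: poly_induct2) (simp_all add: act_pCons scale_left_distrib)

lemma act_smult: "act (Polynomial.smult c f) w = scale c (act f w)"
  by (induction f arbitrary: w) (simp_all add: act_pCons scale_right_distrib)

lemma act_mult: "act (f * g) w = act f (act g w)"
  by (induction f arbitrary: w)
    (simp_all add: act_pCons act_add_left act_smult act_endo)

lemma act_const: "act [:c:] w = scale c w"
  by (simp add: act_pCons)

lemma module_act: "Modules.module act"
  by standard (simp_all add: act_add_right act_add_left act_mult one_pCons act_const)

end

section \<open>Twisted polynomials\<close>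

text \<open>
  Left multiplication by \<open>\<tau>\<close>.
\<close>

definition tshift :: "nat \<Rightarrow> 'l::field poly \<Rightarrow> 'l poly" where
  "tshift q g = pCons 0 (map_poly (\<lambda>c. c ^ q) g)"

text \<open>
  The type argument L ties the locale to the field whose Frobenius is meant.
\<close>

locale frobenius_power =
  fixes q :: nat and L :: "'l::field itself"
  assumes prime_char: "prime CHAR('l)" and q_power: "\<exists>n>0. q = CHAR('l) ^ n"
begin

lemma q_pos: "q > 0"
  using q_power prime_char by (auto simp: prime_gt_0_nat)

lemma frob_add: "(c + d :: 'l) ^ q = c ^ q + d ^ q"
  using q_power freshmans_dream'[OF prime_char] by blast

lemma zero_power_q [simp]: "(0::'l) ^ q = 0"
  using q_pos by simp

lemma map_frob_add: "map_poly (\<lambda>c. c ^ q) (f + g :: 'l poly) = map_poly (\<lambda>c. c ^ q) f + map_poly (\<lambda>c. c ^ q) g"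
  by (rule poly_eqI) (simp add: coeff_map_poly frob_add)

lemma map_frob_smult: "map_poly (\<lambda>c. c ^ q) (Polynomial.smult c f :: 'l poly) = Polynomial.smult (c ^ q) (map_poly (\<lambda>c. c ^ q) f)"
  by (rule poly_eqI) (simp add: coeff_map_poly power_mult_distrib)

lemma tshift_add: "tshift q (f + g :: 'l poly) = tshift q f + tshift q g"
  by (simp add: tshift_def map_frob_add)

lemma tshift_smult: "tshift q (Polynomial.smult c f :: 'l poly) = Polynomial.smult (c ^ q) (tshift q f)"
  by (simp add: tshift_def map_frob_smult)

lemma tshift_0 [simp]: "tshift q (0 :: 'l poly) = 0"
  by (simp add: tshift_def)

lemma degree_tshift: "g \<noteq> 0 \<Longrightarrow> degree (tshift q (g :: 'l poly)) = Suc (degree g)" "tshift q g = 0 \<longleftrightarrow> g = 0"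
proof -
  have z: "map_poly (\<lambda>c. c ^ q) g = 0 \<longleftrightarrow> g = 0" for g :: "'l poly"
    using q_pos by (auto simp: poly_eq_iff coeff_map_poly)
  show "g \<noteq> 0 \<Longrightarrow> degree (tshift q g) = Suc (degree g)"
    using q_pos z[of g] by (simp add: tshift_def degree_map_poly)
  show "tshift q g = 0 \<longleftrightarrow> g = 0"
    by (simp add: tshift_def z)
qed

lemma coeff_tshift_power:
  "coeff ((tshift q ^^ i) (g :: 'l poly)) k = (if k < i then 0 else coeff g (k - i) ^ (q ^ i))"
proof (induction i arbitrary: k)
  case (Suc i)
  then show ?case
    by (cases k) (simp_all add: tshift_def coeff_map_poly q_pos mult.commute flip: power_mult)
qed simp

lemma tmult_eq: "tmult q f (g :: 'l poly) = (\<Sum>i\<le>degree f. Polynomial.smult (coeff f i) ((tshift q ^^ i) g))"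
proof -
  have "(\<Sum>j\<le>degree g. monom (c * coeff g j ^ q ^ i) (i + j)) = Polynomial.smult c ((tshift q ^^ i) g)"
    for i c
  proof (rule poly_eqI)
    fix k
    have "coeff (\<Sum>j\<le>degree g. monom (c * coeff g j ^ q ^ i) (i + j)) k =
        (\<Sum>j\<le>degree g. if j = k - i \<and> i \<le> k then c * coeff g j ^ q ^ i else 0)"
      by (auto simp: coeff_sum intro!: sum.cong)
    also have "\<dots> = coeff (Polynomial.smult c ((tshift q ^^ i) g)) k"
      using q_pos by (auto simp: coeff_tshift_power sum.delta' coeff_eq_0 cong: conj_cong)
    finally show "coeff (\<Sum>j\<le>degree g. monom (c * coeff g j ^ q ^ i) (i + j)) k =
        coeff (Polynomial.smult c ((tshift q ^^ i) g)) k" .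
  qed
  then show ?thesis by (simp add: tmult_def)
qed

lemma tmult_0 [simp]: "tmult q 0 (g :: 'l poly) = 0"
  by (simp add: tmult_eq)

text \<open>
  From \<open>(c + f \<tau>) g = c g + f (\<tau> g)\<close>. With this recursion the ring axioms follow by induction on
  the left factor.
\<close>

lemma tmult_pCons: "tmult q (pCons c f) (g :: 'l poly) = Polynomial.smult c g + tmult q f (tshift q g)"
proof (cases "f = 0")
  case False
  then show ?thesis
    by (simp add: tmult_eq sum.atMost_Suc_shift funpow_Suc_right del: sum.atMost_Suc funpow.simps)
qed (simp add: tmult_eq)

lemma tmult_add_left: "tmult q (f + f') (g :: 'l poly) = tmult q f g + tmult q f' g"
  by (induction f f' arbitrary: g rule: poly_induct2) (simp_all add: tmult_pCons smult_add_left)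

lemma tmult_smult_left: "tmult q (Polynomial.smult c f) (g :: 'l poly) = Polynomial.smult c (tmult q f g)"
  by (induction f arbitrary: g) (simp_all add: tmult_pCons smult_add_right)

lemma tmult_add_right: "tmult q f (g + g' :: 'l poly) = tmult q f g + tmult q f g'"
  by (induction f arbitrary: g g') (simp_all add: tmult_pCons smult_add_right tshift_add)

lemma tmult_0_right: "tmult q f (0 :: 'l poly) = 0"
  by (induction f) (simp_all add: tmult_pCons)

lemma tmult_pCons_0_right: "tmult q f (pCons 0 g :: 'l poly) = pCons 0 (tmult q f g)"
proof (induction f arbitrary: g)
  case (pCons c f)
  have "tshift q (pCons 0 g) = pCons 0 (tshift q g)" for g :: "'l poly"
    by (simp add: tshift_def map_poly_pCons)
  then show ?case
    using pCons by (simp add: tmult_pCons)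
qed simp

lemma tmult_const_right:
  fixes c :: 'l
  assumes "c \<in> Fq q"
  shows "tmult q f [:c:] = Polynomial.smult c f"
proof (induction f)
  case (pCons d f)
  have "tshift q [:c:] = pCons 0 [:c:]"
    using assms by (simp add: tshift_def map_poly_pCons Fq_def)
  then show ?case
    using pCons by (simp add: tmult_pCons tmult_pCons_0_right mult.commute)
qed simp

lemma tshift_tmult: "tshift q (tmult q f (g :: 'l poly)) = tmult q (map_poly (\<lambda>c. c ^ q) f) (tshift q g)"
  by (induction f arbitrary: g)
    (simp_all add: tmult_pCons tshift_add tshift_smult map_poly_pCons)

lemma tmult_assoc: "tmult q (tmult q f g) (h :: 'l poly) = tmult q f (tmult q g h)"
proof (induction f arbitrary: g h)
  case (pCons c f)
  have "tmult q (tshift q g) h = tshift q (tmult q g h)"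
    unfolding tshift_tmult by (simp add: tshift_def tmult_pCons)
  then show ?case
    using pCons by (simp add: tmult_pCons tmult_add_left tmult_smult_left)
qed simp

lemma degree_tmult:
  assumes "f \<noteq> 0" "g \<noteq> (0 :: 'l poly)"
  shows "tmult q f g \<noteq> 0 \<and> degree (tmult q f g) = degree f + degree g"
  using assms
proof (induction f arbitrary: g)
  case (pCons c f)
  show ?case
  proof (cases "f = 0")
    case True
    then show ?thesis using pCons by (simp add: tmult_pCons)
  next
    case False
    have "tmult q f (tshift q g) \<noteq> 0"
      and deg: "degree (tmult q f (tshift q g)) = degree f + Suc (degree g)"
      using pCons.IH[OF False, of "tshift q g"] pCons.prems(2) degree_tshift by auto
    moreover have "degree (Polynomial.smult c g) < degree (tmult q f (tshift q g))"
      using deg degree_smult_le[of c g] by simp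
    ultimately show ?thesis
      using False deg by (auto simp: tmult_pCons degree_add_eq_right add_eq_0_iff)
  qed
qed simp

end

section \<open>The motive as a module over the coordinate ring\<close>

locale drinfeld_motive = smooth_weierstrass E \<pi> + frobenius_power q "TYPE('l)"
  for E :: "'l::alg_closed_field weierstrass" and \<pi> :: "'l poly poly \<Rightarrow> 'a::idom" and q +
  fixes \<theta> \<eta> :: 'l and \<phi> :: "'a \<Rightarrow> 'l poly"
  assumes curve_Fq: "{cf1 E, cf2 E, cf3 E, cf4 E, cf6 E} \<subseteq> Fq q"
    and drinfeld: "sign_normalized_drinfeld_rank2 q \<pi> \<theta> \<eta> \<phi>"
begin

lemma phi_add: "a \<in> coord_ring_Fq q \<pi> \<Longrightarrow> b \<in> coord_ring_Fq q \<pi> \<Longrightarrow> \<phi> (a + b) = \<phi> a + \<phi> b"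
  and phi_mult: "a \<in> coord_ring_Fq q \<pi> \<Longrightarrow> b \<in> coord_ring_Fq q \<pi> \<Longrightarrow> \<phi> (a * b) = tmult q (\<phi> a) (\<phi> b)"
  and phi_const: "c \<in> Fq q \<Longrightarrow> \<phi> (C c) = [:c:]"
  using drinfeld by (auto simp: sign_normalized_drinfeld_rank2_def)

lemma degree_phi: "\<phi> X \<noteq> 0" "degree (\<phi> X) = 4" "\<phi> Y \<noteq> 0" "degree (\<phi> Y) = 6"
  using drinfeld by (auto simp: sign_normalized_drinfeld_rank2_def)

definition x_op :: "'l poly \<Rightarrow> 'l poly" where
  "x_op w = tmult q w (\<phi> X)"

definition y_op :: "'l poly \<Rightarrow> 'l poly" where
  "y_op w = tmult q w (\<phi> Y)"

abbreviation x_act :: "'l poly \<Rightarrow> 'l poly \<Rightarrow> 'l poly" where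
  "x_act \<equiv> poly_act Polynomial.smult x_op"

abbreviation xy_act :: "'l poly poly \<Rightarrow> 'l poly \<Rightarrow> 'l poly" where
  "xy_act \<equiv> poly_act x_act y_op"

lemma in_Fq_simps: "(0::'l) \<in> Fq q" "(1::'l) \<in> Fq q" "(c::'l) \<in> Fq q \<Longrightarrow> - c \<in> Fq q"
proof -
  show "(0::'l) \<in> Fq q" "(1::'l) \<in> Fq q" by (simp_all add: Fq_def)
  show "- c \<in> Fq q" if "c \<in> Fq q" for c :: 'l
    using that frob_add[of c "- c"] by (simp add: Fq_def eq_neg_iff_add_eq_0 add.commute)
qed

definition Fq_poly :: "'l poly \<Rightarrow> bool" where
  "Fq_poly f \<longleftrightarrow> (\<forall>i. coeff f i \<in> Fq q)"

lemma Fq_poly_simps [simp]: "Fq_poly 0" "Fq_poly (pCons c f) \<longleftrightarrow> c \<in> Fq q \<and> Fq_poly f"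
  by (auto simp: Fq_poly_def in_Fq_simps coeff_pCons split: nat.split)

lemma Fq_polys_simps [simp]:
  "(0 :: 'l poly poly) \<in> Fq_polys q" "pCons f F \<in> Fq_polys q \<longleftrightarrow> Fq_poly f \<and> F \<in> Fq_polys q"
  by (auto simp: Fq_polys_def Fq_poly_def in_Fq_simps coeff_pCons split: nat.splits)

lemma in_coord_ring_Fq:
  "F \<in> Fq_polys q \<Longrightarrow> \<pi> F \<in> coord_ring_Fq q \<pi>" "Fq_poly f \<Longrightarrow> emb f \<in> coord_ring_Fq q \<pi>"
  "X \<in> coord_ring_Fq q \<pi>" "Y \<in> coord_ring_Fq q \<pi>" "c \<in> Fq q \<Longrightarrow> C c \<in> coord_ring_Fq q \<pi>"
proof -
  show 1: "\<pi> F \<in> coord_ring_Fq q \<pi>" if "F \<in> Fq_polys q" for F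
    using that by (simp add: coord_ring_Fq_def)
  show "Fq_poly f \<Longrightarrow> emb f \<in> coord_ring_Fq q \<pi>"
    unfolding emb_def by (rule 1) simp
  show "X \<in> coord_ring_Fq q \<pi>" "Y \<in> coord_ring_Fq q \<pi>"
    unfolding x_A_def y_A_def by (rule 1; simp add: in_Fq_simps one_pCons)+
  show "c \<in> Fq q \<Longrightarrow> C c \<in> coord_ring_Fq q \<pi>"
    unfolding const_A_def by (rule 1) simp
qed

lemma x_mult_in: "Fq_poly f \<Longrightarrow> X * emb f \<in> coord_ring_Fq q \<pi>"
  using in_coord_ring_Fq(2)[of "pCons 0 f"] by (simp add: emb_pCons in_Fq_simps)

lemma y_mult_in: "F \<in> Fq_polys q \<Longrightarrow> Y * \<pi> F \<in> coord_ring_Fq q \<pi>"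
  using in_coord_ring_Fq(1)[of "pCons 0 F"] by (simp add: pi_pCons)

lemma phi_xy_commute: "tmult q (\<phi> X) (\<phi> Y) = tmult q (\<phi> Y) (\<phi> X)"
  using phi_mult in_coord_ring_Fq by (metis mult.commute)

sublocale x: module_endomorphism "Polynomial.smult :: 'l \<Rightarrow> 'l poly \<Rightarrow> 'l poly" x_op
  by unfold_locales (simp_all add: x_op_def tmult_add_left tmult_smult_left smult_add_left smult_add_right)

lemma y_op_x_act: "y_op (x_act f w) = x_act f (y_op w)"
proof (induction f arbitrary: w)
  case 0
  show ?case by (simp add: y_op_def)
next
  case (pCons c f)
  have "y_op (x_op w) = x_op (y_op w)" for w
    by (simp add: x_op_def y_op_def tmult_assoc phi_xy_commute)
  then show ?case
    using pCons by (simp add: x.act_pCons) (simp add: y_op_def tmult_add_left tmult_smult_left)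
qed

sublocale xy: module_endomorphism x_act y_op
proof -
  interpret Modules.module x_act by (rule x.module_act)
  show "module_endomorphism x_act y_op"
    by (unfold_locales, simp_all add: y_op_x_act) (simp add: y_op_def tmult_add_left)
qed

lemma phi_0: "\<phi> 0 = 0"
  using phi_add[of 0 0] in_coord_ring_Fq(1)[of 0] by (simp only: Fq_polys_simps pi_hom' add_0_left add_cancel_right_right simp_thms)

lemma x_act_Fq: "Fq_poly f \<Longrightarrow> x_act f w = tmult q w (\<phi> (emb f))"
proof (induction f arbitrary: w)
  case 0
  show ?case by (simp add: phi_0 tmult_0_right)
next
  case (pCons c f)
  then show ?case
    unfolding x.act_pCons
    by (simp add: emb_pCons phi_add phi_mult phi_const in_coord_ring_Fq x_mult_in
        tmult_add_right tmult_const_right tmult_assoc) (simp add: x_op_def tmult_assoc)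
qed

text \<open>
  For coefficients in \<open>F\<^sub>q\<close> the action is right multiplication by the value of \<open>\<phi>\<close>, because such
  coefficients commute with \<open>\<tau>\<close>. It applies to the Weierstrass polynomial, which therefore acts by
  0, and to the monomials occurring in the definition of the action of A.
\<close>

lemma xy_act_Fq: "F \<in> Fq_polys q \<Longrightarrow> xy_act F w = tmult q w (\<phi> (\<pi> F))"
proof (induction F arbitrary: w)
  case 0
  show ?case by (simp add: phi_0 tmult_0_right)
next
  case (pCons f F)
  then show ?case
    unfolding xy.act_pCons
    by (simp add: pi_pCons phi_add phi_mult in_coord_ring_Fq y_mult_in x_act_Fq
        tmult_add_right) (simp add: y_op_def tmult_assoc)
qed

lemma xy_act_kernel:
  assumes "\<pi> F = \<pi> G"
  shows "xy_act F w = xy_act G w"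
proof -
  have "\<pi> (F - G) = 0" using assms by simp
  then obtain H where "F - G = weierstrass_poly E * H"
    unfolding pi_eq_0_iff by (rule dvdE)
  then have F: "F = H * weierstrass_poly E + G"
    by (simp add: diff_eq_eq mult.commute)
  have "weierstrass_poly E \<in> Fq_polys q"
    using curve_Fq by (simp add: weierstrass_poly_def in_Fq_simps one_pCons)
  moreover have "\<pi> (weierstrass_poly E) = 0"
    by (simp add: pi_eq_0_iff)
  ultimately have "xy_act (weierstrass_poly E) w = 0"
    by (simp add: xy_act_Fq phi_0 tmult_0_right)
  moreover have "xy_act H 0 = 0"
    using xy.act_add_right[of H 0 0] by (simp only: add_0_left add_cancel_right_right)
  ultimately show ?thesis
    unfolding F by (simp add: xy.act_add_left xy.act_mult)
qed

abbreviation "act \<equiv> motive_act q \<pi> \<phi>"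

lemma motive_act_pi: "act (\<pi> F) w = xy_act F w"
proof -
  have "tmult q w (\<phi> (X ^ i * Y ^ j)) = (x_op ^^ i) ((y_op ^^ j) w)" for w i j
  proof -
    have "Fq_poly (monom 1 i)"
      by (simp add: Fq_poly_def in_Fq_simps)
    moreover from this have "monom (monom (1::'l) i) j \<in> Fq_polys q"
      using in_Fq_simps by (auto simp: Fq_polys_def Fq_poly_def)
    moreover have "\<pi> (monom (monom 1 i) j) = X ^ i * Y ^ j"
    proof -
      have "emb (monom 1 i) = X ^ i"
        by (induction i) (simp_all add: monom_0 monom_Suc emb_pCons flip: one_pCons)
      then show ?thesis
        by (induction j) (simp_all add: monom_0 monom_Suc pi_pCons mult_ac)
    qed
    moreover have "x_act (monom 1 i) w = (x_op ^^ i) w" for w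
      by (induction i arbitrary: w)
        (simp_all add: monom_0 monom_Suc x.act_pCons funpow_Suc_right del: funpow.simps)
    then have "xy_act (monom (monom 1 i) j) w = (x_op ^^ i) ((y_op ^^ j) w)"
      by (induction j arbitrary: w)
        (simp_all add: monom_0 monom_Suc xy.act_pCons xy.act_const funpow_Suc_right del: funpow.simps)
    ultimately show ?thesis
      by (metis xy_act_Fq)
  qed
  then have "act (\<pi> F) w = xy_act (inv_into UNIV \<pi> (\<pi> F)) w"
    by (simp add: motive_act_def poly_act_def Let_def)
  also have "\<dots> = xy_act F w"
    by (rule xy_act_kernel) (simp add: f_inv_into_f)
  finally show ?thesis .
qed

lemma module_motive_act: "Modules.module act"
proof -
  have s: "\<exists>F. g = \<pi> F" for g
    using pi_surj by (auto simp: surj_def)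
  interpret xy': Modules.module xy_act by (rule xy.module_act)
  show ?thesis
  proof
    fix g h v w
    obtain F G where "g = \<pi> F" "h = \<pi> G" using s by metis
    then show "act g (v + w) = act g v + act g w" "act (g + h) w = act g w + act h w"
      "act g (act h w) = act (g * h) w"
      by (simp_all add: motive_act_pi xy'.scale_right_distrib xy'.scale_left_distrib
          flip: pi_hom)
    show "act 1 w = w"
      using motive_act_pi[of 1 w] by simp
  qed
qed

lemma act_emb: "act (emb f) w = x_act f w"
  by (simp add: emb_def motive_act_pi xy.act_const)

lemma act_C: "act (C c) w = Polynomial.smult c w"
  by (simp add: C_emb act_emb x.act_const)

lemma act_Y: "act Y w = y_op w"
proof -
  have "x_act 1 w = w" for w
    using x.act_const[of 1 w] by (simp add: one_pCons)
  then show ?thesis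
    unfolding y_A_def motive_act_pi by (simp add: xy.act_pCons one_pCons)
qed

section \<open>Degrees in the motive\<close>

lemma degree_x_act:
  "f \<noteq> 0 \<Longrightarrow> w \<noteq> 0 \<Longrightarrow> x_act f w \<noteq> 0 \<and> degree (x_act f w) = 4 * degree f + degree w"
proof (induction f arbitrary: w)
  case (pCons c f)
  show ?case
  proof (cases "f = 0")
    case True
    then show ?thesis using pCons by (simp add: x.act_pCons)
  next
    case False
    have x: "x_op w \<noteq> 0" "degree (x_op w) = degree w + 4"
      using degree_tmult[OF \<open>w \<noteq> 0\<close> degree_phi(1)] degree_phi(2) by (simp_all add: x_op_def)
    have deg: "x_act f (x_op w) \<noteq> 0" "degree (x_act f (x_op w)) = 4 * degree f + (degree w + 4)"
      using pCons.IH[OF False x(1)] x(2) by simp_all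
    moreover have "degree (Polynomial.smult c w) < degree (x_act f (x_op w))"
      using deg degree_smult_le[of c w] by simp
    ultimately show ?thesis
      using False by (auto simp: x.act_pCons degree_add_eq_right add_eq_0_iff)
  qed
qed simp

lemma degree_y_op: "w \<noteq> 0 \<Longrightarrow> y_op w \<noteq> 0 \<and> degree (y_op w) = degree w + 6"
  using degree_tmult[OF _ degree_phi(3)] degree_phi(4) by (simp add: y_op_def)

text \<open>
  On nonzero twisted polynomials, x raises the degree by 4 and y by 6. In \<open>u(x) + v(x) y\<close> the two
  parts raise it by amounts that differ modulo 4, so there is no cancellation. Hence the motive
  is torsion-free, and the elements \<open>1\<close> and \<open>\<tau>\<close>, of degrees of different parity, are independent
  over A.
\<close>

lemma act_parity:
  assumes "g \<noteq> 0" "w \<noteq> 0"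
  shows "act g w \<noteq> 0" "even (degree (act g w)) \<longleftrightarrow> even (degree w)"
proof -
  interpret Modules.module act by (rule module_motive_act)
  obtain u v where g: "g = emb u + Y * emb v" by (rule A_cases)
  have eq: "act g w = x_act u w + x_act v (y_op w)"
    by (simp add: g scale_left_distrib act_emb act_Y y_op_x_act flip: scale_scale)
  note y = degree_y_op[OF assms(2)]
  have "act g w \<noteq> 0 \<and> (even (degree (act g w)) \<longleftrightarrow> even (degree w))"
  proof (cases "u = 0 \<or> v = 0")
    case True
    then show ?thesis
      using assms g y degree_x_act[of u w] degree_x_act[of v "y_op w"] unfolding eq by auto
  next
    case False
    then have d: "x_act u w \<noteq> 0" "degree (x_act u w) = 4 * degree u + degree w"
      "x_act v (y_op w) \<noteq> 0" "degree (x_act v (y_op w)) = 4 * degree v + degree w + 6"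
      using assms y degree_x_act[of u w] degree_x_act[of v "y_op w"] by auto
    have "4 * degree u \<noteq> 4 * degree v + 6"
      by presburger
    then consider "degree (x_act u w) < degree (x_act v (y_op w))"
      | "degree (x_act v (y_op w)) < degree (x_act u w)"
      unfolding d by linarith
    then show ?thesis
      unfolding eq using d
      by cases (auto simp: degree_add_eq_right degree_add_eq_left add_eq_0_iff)
  qed
  then show "act g w \<noteq> 0" "even (degree (act g w)) \<longleftrightarrow> even (degree w)" by blast+
qed

lemma act_monomial_degree:
  assumes "n \<noteq> 2" "even n" "w \<noteq> 0"
  shows "\<exists>g. act g w \<noteq> 0 \<and> degree (act g w) = n + degree w"
proof (cases "4 dvd n")
  case True
  then obtain k where "n = 4 * k" by blast
  then show ?thesis
    using degree_x_act[of "monom 1 k" w] assms(3)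
    by (intro exI[of _ "emb (monom 1 k)"]) (simp add: act_emb degree_monom_eq)
next
  case False
  then have "n \<ge> 6 \<and> 4 dvd (n - 6)"
    using assms(1,2) by presburger
  then obtain k where k: "n = 4 * k + 6"
    by (metis dvd_def le_add_diff_inverse2)
  interpret Modules.module act by (rule module_motive_act)
  show ?thesis
    using degree_x_act[of "monom 1 k" "y_op w"] degree_y_op[OF assms(3)] k
    by (intro exI[of _ "emb (monom 1 k) * Y"]) (simp add: act_emb act_Y degree_monom_eq flip: scale_scale)
qed

lemma reduce_degree:
  fixes v w :: "'l poly"
  assumes "w \<noteq> 0" "v \<noteq> 0" "degree v = degree w"
  obtains c where "w - Polynomial.smult c v = 0 \<or> degree (w - Polynomial.smult c v) < degree w"
proof -
  let ?c = "lead_coeff w / lead_coeff v"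
  let ?r = "w - Polynomial.smult ?c v"
  have "coeff ?r (degree w) = 0"
    using assms(2) by (simp flip: assms(3))
  moreover have "degree ?r \<le> degree w"
    using assms(3) by (intro degree_diff_le) simp_all
  ultimately have "?r = 0 \<or> degree ?r < degree w"
    by (metis leading_coeff_0_iff le_neq_implies_less)
  then show thesis by (rule that)
qed

text \<open>
  Multiples of 1 have the degrees 0, 4, 6, 8, ..., multiples of \<open>\<tau>\<close> have the degrees 1, 5, 7, 9,
  ..., so that only 2 and 3 are missing.
\<close>

lemma motive_generators:
  "\<exists>a b c d. w = act a 1 + act b [:0, 1:] + Polynomial.smult c (monom 1 2) + Polynomial.smult d (monom 1 3)"
proof (induction "degree w" arbitrary: w rule: less_induct)
  case less
  interpret Modules.module act by (rule module_motive_act)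
  let ?P = "\<lambda>w. \<exists>a b c d. w = act a 1 + act b [:0, 1:] + Polynomial.smult c (monom 1 2) + Polynomial.smult d (monom 1 3)"
  have P0: "?P 0"
    by (intro exI[of _ 0]) simp
  have add: "?P (v + w)" if "?P v" "?P w" for v w
  proof -
    obtain a b c d where v: "v = act a 1 + act b [:0, 1:] + Polynomial.smult c (monom 1 2) + Polynomial.smult d (monom 1 3)"
      using \<open>?P v\<close> by blast
    obtain a' b' c' d' where w: "w = act a' 1 + act b' [:0, 1:] + Polynomial.smult c' (monom 1 2) + Polynomial.smult d' (monom 1 3)"
      using \<open>?P w\<close> by blast
    show ?thesis
      unfolding v w
      by (intro exI[of _ "a + a'"] exI[of _ "b + b'"] exI[of _ "c + c'"] exI[of _ "d + d'"])
        (simp add: scale_left_distrib smult_add_left)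
  qed
  have main: "?P w" if v: "v \<noteq> 0" "degree v = degree w" "\<And>c. ?P (Polynomial.smult c v)" and "w \<noteq> 0" for v
  proof -
    obtain c where c: "w - Polynomial.smult c v = 0 \<or> degree (w - Polynomial.smult c v) < degree w"
      using reduce_degree[OF \<open>w \<noteq> 0\<close> v(1,2)] .
    have "?P (w - Polynomial.smult c v)"
      using c less.hyps P0 by metis
    from add[OF this v(3)[of c]] show ?thesis by simp
  qed
  have scaled: "Polynomial.smult c (act a v) = act (C c * a) v" for c a v
    by (simp add: act_C flip: scale_scale)
  have P1: "?P (act a 1)" for a
    by (intro exI[of _ a] exI[of _ 0]) simp
  have P\<tau>: "?P (act a [:0, 1:])" for a
    by (intro exI[of _ 0] exI[of _ a]) simp
  have P2: "?P (Polynomial.smult c (monom 1 2))" and P3: "?P (Polynomial.smult c (monom 1 3))" for c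
    by (rule exI[of _ 0], rule exI[of _ 0], rule exI[of _ c], rule exI[of _ 0], simp)
      (rule exI[of _ 0], rule exI[of _ 0], rule exI[of _ 0], rule exI[of _ c], simp)
  show ?case
  proof (cases "w = 0")
    case True
    then show ?thesis using P0 by simp
  next
    case False
    consider "degree w = 2" | "degree w = 3" | "degree w \<noteq> 2" "even (degree w)"
      | "degree w \<noteq> 3" "odd (degree w)" by blast
    then show ?thesis
    proof cases
      case 1
      show ?thesis
        using 1 by (intro main[of "monom 1 2"] False P2) (simp_all add: degree_monom_eq)
    next
      case 2
      show ?thesis
        using 2 by (intro main[of "monom 1 3"] False P3) (simp_all add: degree_monom_eq)
    next
      case 3
      then obtain g where "act g 1 \<noteq> 0" "degree (act g 1) = degree w"
        using act_monomial_degree[of "degree w" 1] by auto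
      then show ?thesis
        using P1 by (intro main[of "act g 1"] False) (simp_all add: scaled)
    next
      case 4
      then have "degree w - 1 \<noteq> 2" "even (degree w - 1)" "degree w - 1 + 1 = degree w"
        using odd_pos by auto
      then obtain g where "act g [:0, 1:] \<noteq> 0" "degree (act g [:0, 1:]) = degree w"
        using act_monomial_degree[of "degree w - 1" "[:0, 1:]"] by auto
      then show ?thesis
        using P\<tau> by (intro main[of "act g [:0, 1:]"] False) (simp_all add: scaled)
    qed
  qed
qed

lemma dependence_of_three:
  fixes c0 c1 c2 d0 d1 d2 :: 'l
  shows "\<exists>k0 k1 k2. (k0 \<noteq> 0 \<or> k1 \<noteq> 0 \<or> k2 \<noteq> 0) \<and>
    k0 * c0 + k1 * c1 + k2 * c2 = 0 \<and> k0 * d0 + k1 * d1 + k2 * d2 = 0"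
proof (cases "c0 * d1 - c1 * d0 = 0")
  case False
  then show ?thesis
    by (intro exI[of _ "c1 * d2 - c2 * d1"] exI[of _ "c2 * d0 - c0 * d2"] exI[of _ "c0 * d1 - c1 * d0"])
      (simp add: algebra_simps)
next
  case det: True
  consider "c0 \<noteq> 0 \<or> c1 \<noteq> 0" | "c0 = 0" "c1 = 0" "d0 \<noteq> 0 \<or> d1 \<noteq> 0" | "c0 = 0" "c1 = 0" "d0 = 0" "d1 = 0"
    by blast
  then show ?thesis
  proof cases
    case 1
    then show ?thesis
      using det by (intro exI[of _ c1] exI[of _ "- c0"] exI[of _ 0]) (auto simp: mult.commute)
  next
    case 2
    then show ?thesis
      by (intro exI[of _ d1] exI[of _ "- d0"] exI[of _ 0]) (auto simp: mult.commute)
  next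
    case 3
    then show ?thesis by (intro exI[of _ 1] exI[of _ 0]) simp
  qed
qed

text \<open>
  The motive has dimension at most 2 over L modulo the multiples of 1 and \<open>\<tau>\<close>; so the classes of
  w, \<open>x w\<close> and \<open>x\<^sup>2 w\<close> are linearly dependent.
\<close>

lemma motive_torsion: "\<exists>d a b. d \<noteq> 0 \<and> act d w = act a 1 + act b [:0, 1:]"
proof -
  interpret Modules.module act by (rule module_motive_act)
  define f where "f = (\<lambda>i. act (X ^ i) w)"
  have "\<forall>i. \<exists>a b c d. f i = act a 1 + act b [:0, 1:] + Polynomial.smult c (monom 1 2) + Polynomial.smult d (monom 1 3)"
    using motive_generators by blast
  then obtain a b c d where f: "\<And>i. f i = act (a i) 1 + act (b i) [:0, 1:] +
      Polynomial.smult (c i) (monom 1 2) + Polynomial.smult (d i) (monom 1 3)"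
    by metis
  obtain k0 k1 k2 where k: "k0 \<noteq> 0 \<or> k1 \<noteq> 0 \<or> k2 \<noteq> 0"
    "k0 * c 0 + k1 * c 1 + k2 * c 2 = 0" "k0 * d 0 + k1 * d 1 + k2 * d 2 = 0"
    using dependence_of_three by blast
  let ?D = "emb [:k0, k1, k2:]"
  have D: "?D = C k0 * X ^ 0 + C k1 * X ^ 1 + C k2 * X ^ 2"
    by (simp add: emb_pCons algebra_simps power2_eq_square)
  have "act ?D w = Polynomial.smult k0 (f 0) + Polynomial.smult k1 (f 1) + Polynomial.smult k2 (f 2)"
    unfolding D f_def by (simp only: scale_left_distrib act_C flip: scale_scale)
  also have "\<dots> = act (C k0 * a 0 + C k1 * a 1 + C k2 * a 2) 1 + act (C k0 * b 0 + C k1 * b 1 + C k2 * b 2) [:0, 1:]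
      + Polynomial.smult (k0 * c 0 + k1 * c 1 + k2 * c 2) (monom 1 2)
      + Polynomial.smult (k0 * d 0 + k1 * d 1 + k2 * d 2) (monom 1 3)"
    unfolding f by (simp add: scale_left_distrib smult_add_left smult_add_right act_C flip: scale_scale)
  finally have "act ?D w = act (C k0 * a 0 + C k1 * a 1 + C k2 * a 2) 1
      + act (C k0 * b 0 + C k1 * b 1 + C k2 * b 2) [:0, 1:]"
    unfolding k(2,3) by simp
  moreover have "?D \<noteq> 0" using k(1) by simp
  ultimately show ?thesis by blast
qed

lemma motive_independent:
  assumes "act a 1 + act b [:0, 1:] = 0"
  shows "a = 0 \<and> b = 0"
proof (rule ccontr)
  interpret Modules.module act by (rule module_motive_act)
  assume "\<not> (a = 0 \<and> b = 0)"
  then have ab: "a \<noteq> 0" "b \<noteq> 0"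
    using assms act_parity(1)[of a 1] act_parity(1)[of b "[:0, 1:]"] by auto
  have "act a 1 = - act b [:0, 1:]"
    using assms by (simp add: eq_neg_iff_add_eq_0)
  then have "degree (act a 1) = degree (act b [:0, 1:])"
    by simp
  then show False
    using act_parity(2)[OF ab(1), of 1] act_parity(2)[OF ab(2), of "[:0, 1:]"] by simp
qed

text \<open>
  The elements of the motive that lie in the line \<open>K \<cdot> 1\<close>.
\<close>

definition saturation :: "'l poly set" where
  "saturation = {w. \<exists>d a. d \<noteq> 0 \<and> act d w = act a 1}"

text \<open>
  All these elements have even degree, and every even degree except 2 is the degree of a
  multiple of 1. Hence, modulo the multiples of 1, at most one dimension is left, represented by
  an element of degree 2.
\<close>

lemma saturation_generators:
  obtains m where "m \<in> saturation" "\<And>w. w \<in> saturation \<Longrightarrow> \<exists>a c. w = act a 1 + act (C c) m"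
proof -
  interpret Modules.module act by (rule module_motive_act)
  have even: "even (degree w)" if "w \<in> saturation" for w
  proof (cases "w = 0")
    case False
    obtain d a where d: "d \<noteq> 0" "act d w = act a 1"
      using \<open>w \<in> saturation\<close> by (auto simp: saturation_def)
    then have "a \<noteq> 0"
      using act_parity(1)[OF d(1) False] by auto
    then show ?thesis
      using act_parity(2)[OF d(1) False] act_parity(2)[of a 1] d(2) by simp
  qed simp
  have closed: "w - act a v \<in> saturation" if wv: "w \<in> saturation" "v \<in> saturation" for a v w
  proof -
    obtain d r where d: "d \<noteq> 0" "act d w = act r 1"
      using wv(1) by (auto simp: saturation_def)
    obtain d' r' where d': "d' \<noteq> 0" "act d' v = act r' 1"
      using wv(2) by (auto simp: saturation_def)
    have "act (d * d') (w - act a v) = act d' (act d w) - act (d * a) (act d' v)"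
      by (simp add: scale_right_diff_distrib mult_ac)
    also have "\<dots> = act (d' * r - d * a * r') 1"
      unfolding d(2) d'(2) by (simp add: scale_left_diff_distrib)
    finally show ?thesis
      using d(1) d'(1) unfolding saturation_def by (intro CollectI exI[of _ "d * d'"] exI) auto
  qed
  have one: "1 \<in> saturation"
    unfolding saturation_def by (auto intro!: exI[of _ 1])
  have red: "\<exists>a. w - act a 1 = 0 \<or> degree (w - act a 1) = 2 \<and> degree w \<ge> 2" if "w \<in> saturation" for w
    using that
  proof (induction "degree w" arbitrary: w rule: less_induct)
    case less
    show ?case
    proof (cases "w = 0 \<or> degree w = 2")
      case True
      then show ?thesis by (intro exI[of _ 0]) auto
    next
      case False
      then obtain g where g: "act g 1 \<noteq> 0" "degree (act g 1) = degree w"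
        using act_monomial_degree[of "degree w" 1] even[OF less.prems] by auto
      obtain c where c: "w - Polynomial.smult c (act g 1) = 0 \<or> degree (w - Polynomial.smult c (act g 1)) < degree w"
        using reduce_degree[of w "act g 1"] False g by metis
      have e: "Polynomial.smult c (act g 1) = act (C c * g) 1"
        by (simp add: act_C flip: scale_scale)
      show ?thesis
      proof (cases "w - act (C c * g) 1 = 0")
        case True
        then show ?thesis by blast
      next
        case False
        then have lt: "degree (w - act (C c * g) 1) < degree w"
          using c by (simp add: e)
        obtain a where "w - act (C c * g) 1 - act a 1 = 0 \<or>
            degree (w - act (C c * g) 1 - act a 1) = 2 \<and> degree (w - act (C c * g) 1) \<ge> 2"
          using less.hyps[OF lt closed[OF less.prems one]] by blast
        then show ?thesis
          using lt by (intro exI[of _ "C c * g + a"]) (auto simp: scale_left_distrib diff_diff_eq)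
      qed
    qed
  qed
  show thesis
  proof (cases "\<exists>m\<in>saturation. m \<noteq> 0 \<and> degree m = 2")
    case False
    have zero: "0 \<in> saturation"
      using closed[OF one one, of 1] by simp
    show ?thesis
    proof (rule that[OF zero])
      fix w assume w: "w \<in> saturation"
      obtain a where "w - act a 1 = 0 \<or> degree (w - act a 1) = 2"
        using red[OF w] by blast
      then have "w = act a 1"
        using False closed[OF w one, of a] by auto
      then show "\<exists>a c. w = act a 1 + act (C c) 0" by auto
    qed
  next
    case True
    then obtain m where m: "m \<in> saturation" "m \<noteq> 0" "degree m = 2" by blast
    show ?thesis
    proof (rule that[OF m(1)])
      fix w assume w: "w \<in> saturation"
      obtain a where a: "w - act a 1 = 0 \<or> degree (w - act a 1) = 2"
        using red[OF w] by blast
      show "\<exists>a c. w = act a 1 + act (C c) m"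
      proof (cases "w - act a 1 = 0")
        case True
        then show ?thesis by (intro exI[of _ a] exI[of _ 0]) simp
      next
        case False
        let ?v = "w - act a 1"
        obtain c where c: "?v - act (C c) m = 0 \<or> degree (?v - act (C c) m) < 2"
          using reduce_degree[of ?v m] False a m by (metis act_C)
        have "?v - act (C c) m \<in> saturation"
          by (intro closed w one m)
        moreover have "degree (?v - act (C c) m) < 2"
          using c by (elim disjE) (simp_all only: degree_0 zero_less_numeral)
        ultimately obtain b where "?v - act (C c) m - act b 1 = 0"
          using red leD by blast
        then have "w = act (a + b) 1 + act (C c) m"
          by (simp add: scale_left_distrib algebra_simps)
        then show ?thesis by blast
      qed
    qed
  qed
qed

end

section \<open>Coordinates on a torsion-free module of rank two\<close>

locale rank_two_module = Modules.module act
  for act :: "'a::idom \<Rightarrow> 'm::ab_group_add \<Rightarrow> 'm" +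
  fixes e0 e1 :: 'm
  assumes torsion_free: "act a m = 0 \<Longrightarrow> a = 0 \<or> m = 0"
    and independent: "act a e0 + act b e1 = 0 \<Longrightarrow> a = 0 \<and> b = 0"
    and denominators: "\<exists>d a b. d \<noteq> 0 \<and> act d m = act a e0 + act b e1"
begin

text \<open>
  The coordinates of m in the basis \<open>e0, e1\<close> after tensoring with K.
\<close>

definition coords :: "'m \<Rightarrow> 'a fract \<times> 'a fract" where
  "coords m = (SOME w. \<exists>d a b. d \<noteq> 0 \<and> act d m = act a e0 + act b e1 \<and>
     w = (to_fract a / to_fract d, to_fract b / to_fract d))"

lemma coords_eq:
  assumes "d \<noteq> 0" "act d m = act a e0 + act b e1"
  shows "coords m = (to_fract a / to_fract d, to_fract b / to_fract d)"
proof -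
  have "\<exists>d' a' b'. d' \<noteq> 0 \<and> act d' m = act a' e0 + act b' e1 \<and>
      coords m = (to_fract a' / to_fract d', to_fract b' / to_fract d')"
    unfolding coords_def by (rule someI_ex) (use assms in blast)
  then obtain d' a' b' where d': "d' \<noteq> 0" "act d' m = act a' e0 + act b' e1"
    "coords m = (to_fract a' / to_fract d', to_fract b' / to_fract d')"
    by blast
  have "act (d * a' - d' * a) e0 + act (d * b' - d' * b) e1 = act d (act d' m) - act d' (act d m)"
    unfolding assms(2) d'(2) by (simp add: scale_left_diff_distrib scale_right_distrib)
  also have "\<dots> = 0"
    by (simp add: mult.commute)
  finally have "d * a' = d' * a" "d * b' = d' * b"
    using independent by fastforce+
  then have "to_fract d * to_fract a' = to_fract d' * to_fract a" "to_fract d * to_fract b' = to_fract d' * to_fract b"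
    by (simp_all flip: to_fract_mult)
  then show ?thesis
    using assms(1) d'(1) by (simp add: d'(3) frac_eq_eq mult.commute)
qed

lemma coords_add: "coords (m + n) = coords m + coords n"
proof -
  obtain d a b where d: "d \<noteq> 0" "act d m = act a e0 + act b e1" using denominators by blast
  obtain d' a' b' where d': "d' \<noteq> 0" "act d' n = act a' e0 + act b' e1" using denominators by blast
  have "act (d * d') (m + n) = act d' (act d m) + act d (act d' n)"
    by (simp add: scale_right_distrib mult.commute)
  also have "\<dots> = act (d' * a + d * a') e0 + act (d' * b + d * b') e1"
    unfolding d(2) d'(2) by (simp add: scale_right_distrib scale_left_distrib)
  finally have "act (d * d') (m + n) = act (d' * a + d * a') e0 + act (d' * b + d * b') e1" .
  from coords_eq[OF _ this] show ?thesis
    using d(1) d'(1) by (simp add: coords_eq[OF d] coords_eq[OF d'] add_frac_eq mult.commute)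
qed

lemma coords_scale: "coords (act r m) = vscale (to_fract r) (coords m)"
proof -
  obtain d a b where d: "d \<noteq> 0" "act d m = act a e0 + act b e1" using denominators by blast
  have "act d (act r m) = act r (act d m)"
    by (simp add: mult.commute)
  also have "\<dots> = act (r * a) e0 + act (r * b) e1"
    unfolding d(2) by (simp add: scale_right_distrib)
  finally show ?thesis
    using coords_eq[OF d] coords_eq[OF d(1)] by (simp add: vscale_def)
qed

lemma coords_eq_0: "coords m = 0 \<Longrightarrow> m = 0"
proof -
  assume z: "coords m = 0"
  obtain d a b where d: "d \<noteq> 0" "act d m = act a e0 + act b e1" using denominators by blast
  then have "a = 0" "b = 0"
    using coords_eq[OF d] z by (simp_all add: zero_prod_def)
  then show "m = 0"
    using d torsion_free[of d m] by simp
qed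

lemma coords_diff: "coords (m - n) = coords m - coords n"
  using coords_add[of "m - n" n] by simp

lemma coords_inj: "coords m = coords n \<Longrightarrow> m = n"
  using coords_eq_0[of "m - n"] by (simp add: coords_diff)

lemma coords_basis: "coords e0 = (1, 0)" "coords e1 = (0, 1)"
  using coords_eq[of 1 e0 1 0] coords_eq[of 1 e1 0 1] by simp_all

lemma subspace_range_coords: "plane.subspace (range coords)"
proof -
  have "coords 0 = 0"
    using coords_diff[of 0 0] by simp
  then show ?thesis
    unfolding plane.subspace_def
    by (auto simp flip: coords_add coords_scale)
qed

end

section \<open>Extension of scalars\<close>

text \<open>
  Arithmetic of the cosets that represent the elements of both kinds of quotients.
\<close>

lemma fspan_cosets:
  fixes R :: "('s \<Rightarrow>\<^sub>0 'r::comm_ring_1) set"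
  assumes R: "R = fspan G"
  shows "0 \<in> R" "r \<in> R \<Longrightarrow> s \<in> R \<Longrightarrow> r + s \<in> R" "r \<in> R \<Longrightarrow> fscale c r \<in> R" "r \<in> R \<Longrightarrow> - r \<in> R"
    "g \<in> G \<Longrightarrow> g \<in> R"
    "{v. v - u \<in> R} = {v. v - u' \<in> R} \<longleftrightarrow> u - u' \<in> R"
    "coset_plus {v. v - u \<in> R} {v. v - u' \<in> R} = {v. v - (u + u') \<in> R}"
    "coset_plus (fscale c ` {v. v - u \<in> R}) R = {v. v - fscale c u \<in> R}"
proof -
  interpret F: Modules.module "fscale :: 'r \<Rightarrow> ('s \<Rightarrow>\<^sub>0 'r) \<Rightarrow> _" by (rule module_fscale)
  have R': "R = F.span G" by (simp add: R fspan_def)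
  show zero: "0 \<in> R" by (simp add: R' F.span_zero)
  show add: "r + s \<in> R" if "r \<in> R" "s \<in> R" for r s using that by (simp add: R' F.span_add)
  show scale: "fscale c r \<in> R" if "r \<in> R" for c r using that by (simp add: R' F.span_scale)
  show neg: "- r \<in> R" if "r \<in> R" for r using that by (simp add: R' F.span_neg)
  show "g \<in> R" if "g \<in> G" using that by (simp add: R' F.span_base)
  have diff: "r - s \<in> R" if "r \<in> R" "s \<in> R" for r s using add[OF that(1) neg[OF that(2)]] by simp
  show "{v. v - u \<in> R} = {v. v - u' \<in> R} \<longleftrightarrow> u - u' \<in> R" for u u'
  proof
    assume "{v. v - u \<in> R} = {v. v - u' \<in> R}"
    moreover have "u \<in> {v. v - u \<in> R}" using zero by simp
    ultimately show "u - u' \<in> R" by blast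
  next
    assume uu: "u - u' \<in> R"
    have "v - u' \<in> R" if "v - u \<in> R" for v
      using add[OF that uu] by simp
    moreover have "v - u \<in> R" if "v - u' \<in> R" for v
      using diff[OF that uu] by simp
    ultimately show "{v. v - u \<in> R} = {v. v - u' \<in> R}" by blast
  qed
  show "coset_plus {v. v - u \<in> R} {v. v - u' \<in> R} = {v. v - (u + u') \<in> R}" for u u'
  proof (intro equalityI subsetI)
    fix v assume "v \<in> coset_plus {v. v - u \<in> R} {v. v - u' \<in> R}"
    then obtain c d where cd: "v = c + d" "c - u \<in> R" "d - u' \<in> R"
      by (auto simp: coset_plus_def)
    show "v \<in> {v. v - (u + u') \<in> R}"
      using add[OF cd(2,3)] by (simp add: cd(1) add_diff_add)
  next
    fix v assume "v \<in> {v. v - (u + u') \<in> R}"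
    then have "v = u + (v - u)" "u - u \<in> R" "(v - u) - u' \<in> R"
      using zero by (simp_all add: diff_diff_eq)
    then show "v \<in> coset_plus {v. v - u \<in> R} {v. v - u' \<in> R}"
      unfolding coset_plus_def by blast
  qed
  show "coset_plus (fscale c ` {v. v - u \<in> R}) R = {v. v - fscale c u \<in> R}"
  proof (intro equalityI subsetI)
    fix v assume "v \<in> coset_plus (fscale c ` {v. v - u \<in> R}) R"
    then obtain w r where wr: "v = fscale c w + r" "w - u \<in> R" "r \<in> R"
      by (auto simp: coset_plus_def)
    have "v - fscale c u = fscale c (w - u) + r"
      by (simp add: wr(1) F.scale_right_diff_distrib)
    then show "v \<in> {v. v - fscale c u \<in> R}"
      using add[OF scale[OF wr(2)] wr(3)] by simp
  next
    fix v assume v: "v \<in> {v. v - fscale c u \<in> R}"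
    have "v = fscale c u + (v - fscale c u)" by simp
    then show "v \<in> coset_plus (fscale c ` {v. v - u \<in> R}) R"
      using v zero unfolding coset_plus_def by fastforce
  qed
qed

text \<open>
  The linear extension of f to the free module. Extensions of scalars and exterior squares are
  quotients of free modules by spans of relations; a map out of them is given by an f for which
  the relations evaluate to 0.
\<close>

definition eval_formal :: "('s \<Rightarrow> 'k) \<Rightarrow> ('r \<Rightarrow> 'k) \<Rightarrow> ('s \<Rightarrow>\<^sub>0 'r::zero) \<Rightarrow> 'k::comm_ring_1" where
  "eval_formal f \<iota> u = (\<Sum>s\<in>Poly_Mapping.keys u. \<iota> (Poly_Mapping.lookup u s) * f s)"

locale formal_evaluation =
  fixes f :: "'s \<Rightarrow> 'k::comm_ring_1" and \<iota> :: "'r::comm_ring_1 \<Rightarrow> 'k"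
  assumes hom_add: "\<iota> (a + b) = \<iota> a + \<iota> b" and hom_mult: "\<iota> (a * b) = \<iota> a * \<iota> b"
    and hom_one: "\<iota> 1 = 1"
begin

lemma hom_0: "\<iota> 0 = 0"
  using hom_add[of 0 0] by (simp only: add_0_left add_cancel_right_right)

lemma eval_superset:
  "finite A \<Longrightarrow> Poly_Mapping.keys u \<subseteq> A \<Longrightarrow>
    eval_formal f \<iota> u = (\<Sum>s\<in>A. \<iota> (Poly_Mapping.lookup u s) * f s)"
  unfolding eval_formal_def
  by (rule sum.mono_neutral_left) (auto simp: hom_0 in_keys_iff)

lemma eval_add: "eval_formal f \<iota> (u + v) = eval_formal f \<iota> u + eval_formal f \<iota> v"
proof -
  let ?A = "Poly_Mapping.keys u \<union> Poly_Mapping.keys v"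
  have "eval_formal f \<iota> (u + v) = (\<Sum>s\<in>?A. \<iota> (Poly_Mapping.lookup (u + v) s) * f s)"
    by (rule eval_superset) (simp_all add: keys_add)
  then show ?thesis
    by (simp add: eval_superset[of ?A u] eval_superset[of ?A v] lookup_add hom_add distrib_right sum.distrib)
qed

lemma eval_scale: "eval_formal f \<iota> (fscale c u) = \<iota> c * eval_formal f \<iota> u"
proof -
  have "eval_formal f \<iota> (fscale c u) =
      (\<Sum>s\<in>Poly_Mapping.keys u. \<iota> (Poly_Mapping.lookup (fscale c u) s) * f s)"
    by (rule eval_superset) (auto simp: in_keys_iff lookup_fscale)
  then show ?thesis
    by (simp add: eval_formal_def lookup_fscale hom_mult sum_distrib_left mult.assoc)
qed

lemma eval_single: "eval_formal f \<iota> (Poly_Mapping.single s c) = \<iota> c * f s"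
  by (simp add: eval_formal_def hom_0)

lemma eval_0: "eval_formal f \<iota> 0 = 0"
  by (simp add: eval_formal_def)

lemma eval_diff: "eval_formal f \<iota> (u - v) = eval_formal f \<iota> u - eval_formal f \<iota> v"
  using eval_add[of "u - v" v] by simp

lemma eval_fspan:
  assumes "\<And>g. g \<in> G \<Longrightarrow> eval_formal f \<iota> g = 0" "u \<in> fspan G"
  shows "eval_formal f \<iota> u = 0"
proof -
  interpret F: Modules.module "fscale :: 'r \<Rightarrow> ('s \<Rightarrow>\<^sub>0 'r) \<Rightarrow> _" by (rule module_fscale)
  have "fspan G \<subseteq> {u. eval_formal f \<iota> u = 0}"
    unfolding fspan_def
    by (rule F.span_minimal) (auto simp: assms(1) F.subspace_def eval_add eval_scale eval_0)
  then show ?thesis using assms(2) by blast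
qed

end

lemma tensor_eq_iff: "tensor N g n = tensor N g' n' \<longleftrightarrow>
    Poly_Mapping.single n g - Poly_Mapping.single n' g' \<in> base_rels N"
  unfolding tensor_def base_class_def by (rule fspan_cosets(6)) (simp add: base_rels_def)

lemma tensor_functional:
  assumes add: "\<And>m n. m \<in> carrier N \<Longrightarrow> n \<in> carrier N \<Longrightarrow> f (m \<oplus>\<^bsub>N\<^esub> n) = f m + f n"
    and scale: "\<And>a n. n \<in> carrier N \<Longrightarrow> f (a \<odot>\<^bsub>N\<^esub> n) = to_fract a * f n"
    and eq: "tensor N g n = tensor N g' n'"
  shows "g * f n = g' * f n'"
proof -
  interpret formal_evaluation f "\<lambda>x. x" by unfold_locales simp_all
  have "eval_formal f (\<lambda>x. x) (Poly_Mapping.single n g - Poly_Mapping.single n' g') = 0"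
    using eq unfolding tensor_eq_iff base_rels_def
    by (rule eval_fspan[rotated]) (auto simp: eval_diff eval_single add scale)
  then show ?thesis
    by (simp add: eval_diff eval_single)
qed

lemma tensor_scale:
  fixes N :: "('a::idom, 'n) module"
  assumes "n \<in> carrier N"
  shows "tensor N g (a \<odot>\<^bsub>N\<^esub> n) = tensor N (g * to_fract a) n"
proof -
  interpret F: Modules.module "fscale :: 'a fract \<Rightarrow> ('n \<Rightarrow>\<^sub>0 'a fract) \<Rightarrow> _" by (rule module_fscale)
  note R = fspan_cosets[OF base_rels_def[of N]]
  have "Poly_Mapping.single (a \<odot>\<^bsub>N\<^esub> n) 1 - Poly_Mapping.single n (to_fract a) \<in> base_rels N"
    using assms by (intro R(5)) blast
  then have "fscale g (Poly_Mapping.single (a \<odot>\<^bsub>N\<^esub> n) 1 - Poly_Mapping.single n (to_fract a)) \<in> base_rels N"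
    by (rule R(3))
  then show ?thesis
    unfolding tensor_eq_iff by (simp add: F.scale_right_diff_distrib) (simp add: fscale_def)
qed

lemma tensor_add:
  assumes "m \<in> carrier N" "n \<in> carrier N"
  shows "tensor N 1 (m \<oplus>\<^bsub>N\<^esub> n) = coset_plus (tensor N 1 m) (tensor N 1 n)"
proof -
  note R = fspan_cosets[OF base_rels_def[of N]]
  have "Poly_Mapping.single (m \<oplus>\<^bsub>N\<^esub> n) 1 - Poly_Mapping.single m 1 - Poly_Mapping.single n 1 \<in> base_rels N"
    using assms by (intro R(5)) blast
  then show ?thesis
    unfolding tensor_def base_class_def R(7) R(6) by (simp add: diff_diff_eq)
qed

section \<open>The exterior square\<close>

definition wedge_formal :: "('m \<Rightarrow> 'a fract \<times> 'a fract) \<Rightarrow> ('m \<times> 'm \<Rightarrow>\<^sub>0 'a::idom) \<Rightarrow> 'a fract" where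
  "wedge_formal \<kappa> = eval_formal (\<lambda>(m, n). wedge (\<kappa> m) (\<kappa> n)) to_fract"

lemma formal_evaluation_wedge:
  "formal_evaluation (to_fract :: 'a::idom \<Rightarrow> 'a fract)"
  by unfold_locales simp_all

lemma wedge_formal_ext_rels:
  fixes M :: "('a::idom, 'm) module"
  assumes add: "\<And>m n. \<kappa> (m \<oplus>\<^bsub>M\<^esub> n) = \<kappa> m + \<kappa> n"
    and scale: "\<And>a m. \<kappa> (a \<odot>\<^bsub>M\<^esub> m) = vscale (to_fract a) (\<kappa> m)"
    and "u - v \<in> ext_rels M"
  shows "wedge_formal \<kappa> u = wedge_formal \<kappa> v"
proof -
  interpret formal_evaluation "\<lambda>(m, n). wedge (\<kappa> m) (\<kappa> n)" to_fract by (rule formal_evaluation_wedge)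
  have "wedge_formal \<kappa> (u - v) = 0"
    using assms(3) unfolding ext_rels_def wedge_formal_def
    by (rule eval_fspan[rotated])
      (auto simp: eval_diff eval_single add scale wedge_simps)
  then show ?thesis
    by (simp add: wedge_formal_def eval_diff)
qed

lemma range_wedge_formal: "range (wedge_formal \<kappa>) = wedge_ideal (range \<kappa>)"
proof -
  interpret formal_evaluation "\<lambda>(m, n). wedge (\<kappa> m) (\<kappa> n)" to_fract by (rule formal_evaluation_wedge)
  have "(case s of (m, n) \<Rightarrow> wedge (\<kappa> m) (\<kappa> n)) \<in> {wedge m n |m n. m \<in> range \<kappa> \<and> n \<in> range \<kappa>}" for s
    by (cases s, simp only: prod.case, blast)
  then have "wedge_formal \<kappa> u \<in> wedge_ideal (range \<kappa>)" for u
    unfolding wedge_formal_def eval_formal_def wedge_ideal_def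
    by (intro frac.span_sum frac.span_scale frac.span_base)
  moreover have "frac.subspace (range (wedge_formal \<kappa>))"
    unfolding wedge_formal_def
    by (rule frac_subspaceI, metis eval_0 rangeI)
      (auto simp: image_iff simp flip: eval_add eval_scale)
  then have "wedge_ideal (range \<kappa>) \<subseteq> range (wedge_formal \<kappa>)"
    unfolding wedge_ideal_def
  proof (rule frac.span_minimal[rotated])
    have "wedge (\<kappa> m) (\<kappa> n) = wedge_formal \<kappa> (Poly_Mapping.single (m, n) 1)" for m n
      by (simp add: wedge_formal_def eval_single)
    then show "{wedge m n |m n. m \<in> range \<kappa> \<and> n \<in> range \<kappa>} \<subseteq> range (wedge_formal \<kappa>)"
      by auto
  qed
  ultimately show ?thesis by blast
qed

text \<open>
  The determinant \<open>m \<and> n \<mapsto> \<kappa> m \<and> \<kappa> n\<close> is a linear functional on the exterior square, with image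
  the ideal of the lattice, and it extends to K-linear combinations. It sends \<open>I S\<^sub>0\<close> to \<open>c I\<close>, where
  c is the value at \<open>S\<^sub>0\<close>.
\<close>

lemma wedge_ideal_of_ext_square:
  fixes M :: "('a::idom, 'm) module"
  assumes carrier: "carrier M = UNIV"
    and add: "\<And>m n. \<kappa> (m \<oplus>\<^bsub>M\<^esub> n) = \<kappa> m + \<kappa> n"
    and scale: "\<And>a m. \<kappa> (a \<odot>\<^bsub>M\<^esub> m) = vscale (to_fract a) (\<kappa> m)"
    and S0: "S0 \<in> carrier (ext_square M)"
    and eq: "lattice_of (ext_square M) = ideal_times (ext_square M) I S0"
  shows "\<exists>c. wedge_ideal (range \<kappa>) = (*) c ` I"
proof -
  let ?N = "ext_square M"
  interpret formal_evaluation "\<lambda>(m, n). wedge (\<kappa> m) (\<kappa> n)" to_fract by (rule formal_evaluation_wedge)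
  note R = fspan_cosets[OF ext_rels_def[of M]]
  have carrier_N: "carrier ?N = range (ext_class M)"
    by (auto simp: ext_square_def carrier)
  define f where "f = (\<lambda>C. wedge_formal \<kappa> (SOME u. C = ext_class M u))"
  have f: "f (ext_class M u) = wedge_formal \<kappa> u" for u
  proof -
    have "ext_class M u = ext_class M (SOME v. ext_class M u = ext_class M v)"
      by (rule someI[of _ u]) (rule refl)
    then have "u - (SOME v. ext_class M u = ext_class M v) \<in> ext_rels M"
      unfolding ext_class_def R(6) .
    then show ?thesis
      unfolding f_def using wedge_formal_ext_rels[OF add scale] by metis
  qed
  have N_add: "ext_class M u \<oplus>\<^bsub>?N\<^esub> ext_class M v = ext_class M (u + v)" for u v
    unfolding ext_class_def by (simp add: ext_square_def R(7))
  have N_scale: "a \<odot>\<^bsub>?N\<^esub> ext_class M u = ext_class M (fscale a u)" for a u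
    unfolding ext_class_def by (simp add: ext_square_def R(8))
  have f_add: "f (C \<oplus>\<^bsub>?N\<^esub> D) = f C + f D" if "C \<in> carrier ?N" "D \<in> carrier ?N" for C D
    using that unfolding carrier_N by (auto simp: N_add f) (simp add: wedge_formal_def eval_add)
  have f_scale: "f (a \<odot>\<^bsub>?N\<^esub> C) = to_fract a * f C" if "C \<in> carrier ?N" for a C
    using that unfolding carrier_N by (auto simp: N_scale f) (simp add: wedge_formal_def eval_scale)
  note func = tensor_functional[OF f_add f_scale]
  have "range (wedge_formal \<kappa>) = f ` carrier ?N"
    unfolding carrier_N by (auto simp: f image_image)
  also have "\<dots> = (*) (f S0) ` I"
  proof (intro equalityI subsetI)
    fix w assume "w \<in> f ` carrier ?N"
    then obtain C where C: "C \<in> carrier ?N" "w = f C" by blast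
    then have "tensor ?N 1 C \<in> ideal_times ?N I S0"
      using eq by (auto simp: lattice_of_def)
    then obtain g where "g \<in> I" "tensor ?N 1 C = tensor ?N g S0"
      by (auto simp: ideal_times_def)
    then show "w \<in> (*) (f S0) ` I"
      using func[of 1 C g S0] by (auto simp: C(2) mult.commute)
  next
    fix w assume "w \<in> (*) (f S0) ` I"
    then obtain g where g: "g \<in> I" "w = f S0 * g" by blast
    then have "tensor ?N g S0 \<in> lattice_of ?N"
      unfolding eq by (auto simp: ideal_times_def)
    then obtain C where "C \<in> carrier ?N" "tensor ?N g S0 = tensor ?N 1 C"
      by (auto simp: lattice_of_def)
    then show "w \<in> f ` carrier ?N"
      using func[of g S0 1 C] by (auto simp: g(2) mult.commute)
  qed
  finally show ?thesis
    unfolding range_wedge_formal by blast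
qed

text \<open>
  A decomposition of the lattice in \<open>K\<^sup>2\<close> gives one of the image of N in its extension of scalars.
  Equalities of tensors come from clearing denominators inside N, where the coordinates are
  injective; that the sum is direct comes from the two coordinate functionals on the extension
  of scalars.
\<close>

lemma direct_sum_from_coordinates:
  fixes N :: "('a::idom, 'm::ab_group_add) module"
  assumes carrier: "carrier N = UNIV" and add: "\<And>m n. m \<oplus>\<^bsub>N\<^esub> n = m + n"
    and coords: "rank_two_module (\<lambda>a m. a \<odot>\<^bsub>N\<^esub> m) e0 e1"
    and \<kappa>: "\<kappa> = rank_two_module.coords (\<lambda>a m. a \<odot>\<^bsub>N\<^esub> m) e0 e1"
    and indep: "wedge (\<kappa> E1) (\<kappa> E2) \<noteq> 0"
    and range: "range \<kappa> = {vscale a (\<kappa> E1) + vscale g (\<kappa> E2) | a g. a \<in> A_in_K \<and> g \<in> I}"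
    and "0 \<in> I"
  shows "internal_direct_sum N (lattice_of N) (ideal_times N A_in_K E1) (ideal_times N I E2)"
proof -
  interpret rank_two_module "\<lambda>a m. a \<odot>\<^bsub>N\<^esub> m" e0 e1 by (rule coords)
  have tensor_eq: "tensor N 1 m = tensor N g n" if m: "\<kappa> m = vscale g (\<kappa> n)" for g m n
  proof -
    obtain r d where d: "d \<noteq> 0" "to_fract d * g = to_fract r"
      by (rule fract_cases_quotient)
    have "\<kappa> (d \<odot>\<^bsub>N\<^esub> m) = \<kappa> (r \<odot>\<^bsub>N\<^esub> n)"
      using m d(2) by (simp add: \<kappa> coords_scale vscale_simps)
    then have "d \<odot>\<^bsub>N\<^esub> m = r \<odot>\<^bsub>N\<^esub> n"
      unfolding \<kappa> by (rule coords_inj)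
    then have "tensor N (1 / to_fract d) (d \<odot>\<^bsub>N\<^esub> m) = tensor N (1 / to_fract d) (r \<odot>\<^bsub>N\<^esub> n)"
      by simp
    moreover have "1 / to_fract d * to_fract d = 1" "1 / to_fract d * to_fract r = g"
      using d by (simp_all add: field_simps)
    ultimately show ?thesis
      by (simp add: tensor_scale carrier)
  qed
  have sum: "tensor N 1 m = coset_plus (tensor N a E1) (tensor N g E2)"
    if m: "\<kappa> m = vscale a (\<kappa> E1) + vscale g (\<kappa> E2)" and a: "a \<in> A_in_K" for m a g
  proof -
    obtain a' where a': "a = to_fract a'" using a by (auto simp: A_in_K_iff)
    let ?n = "a' \<odot>\<^bsub>N\<^esub> E1"
    have "\<kappa> ?n = vscale a (\<kappa> E1)" "\<kappa> (m - ?n) = vscale g (\<kappa> E2)"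
      using m by (simp_all add: \<kappa> coords_diff coords_scale a')
    then have "tensor N 1 ?n = tensor N a E1" "tensor N 1 (m - ?n) = tensor N g E2"
      by (simp_all add: tensor_eq)
    then show ?thesis
      using tensor_add[of ?n N "m - ?n"] by (simp add: carrier add)
  qed
  have zero: "tensor N 0 n = base_class N 0" for n
    by (simp add: tensor_def)
  have "lattice_of N = {coset_plus P Q | P Q. P \<in> ideal_times N A_in_K E1 \<and> Q \<in> ideal_times N I E2}"
  proof (intro equalityI subsetI)
    fix P assume "P \<in> lattice_of N"
    then obtain m where m: "P = tensor N 1 m" by (auto simp: lattice_of_def)
    obtain a g where "a \<in> A_in_K" "g \<in> I" "\<kappa> m = vscale a (\<kappa> E1) + vscale g (\<kappa> E2)"
      using range by blast
    then show "P \<in> {coset_plus P Q | P Q. P \<in> ideal_times N A_in_K E1 \<and> Q \<in> ideal_times N I E2}"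
      using sum m unfolding ideal_times_def by blast
  next
    fix P assume "P \<in> {coset_plus P Q | P Q. P \<in> ideal_times N A_in_K E1 \<and> Q \<in> ideal_times N I E2}"
    then obtain a g where ag: "a \<in> A_in_K" "g \<in> I" "P = coset_plus (tensor N a E1) (tensor N g E2)"
      unfolding ideal_times_def by blast
    then have "vscale a (\<kappa> E1) + vscale g (\<kappa> E2) \<in> range \<kappa>"
      unfolding range by blast
    then obtain m where "\<kappa> m = vscale a (\<kappa> E1) + vscale g (\<kappa> E2)"
      by (metis rangeE)
    then have "P = tensor N 1 m"
      using sum ag by simp
    then show "P \<in> lattice_of N"
      by (simp add: lattice_of_def carrier)
  qed
  moreover have "ideal_times N A_in_K E1 \<inter> ideal_times N I E2 = {base_class N 0}"
  proof (intro equalityI subsetI)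
    fix P assume "P \<in> ideal_times N A_in_K E1 \<inter> ideal_times N I E2"
    then obtain a g where P: "P = tensor N a E1" "tensor N a E1 = tensor N g E2"
      by (auto simp: ideal_times_def)
    have "a * fst (\<kappa> E1) = g * fst (\<kappa> E2)" "a * snd (\<kappa> E1) = g * snd (\<kappa> E2)"
      by (rule tensor_functional[OF _ _ P(2)]; simp add: add \<kappa> coords_add coords_scale vscale_def)+
    then have "a * wedge (\<kappa> E1) (\<kappa> E2) = 0"
      by (simp add: wedge_def right_diff_distrib flip: mult.assoc)
    then have "a = 0" using indep by simp
    then show "P \<in> {base_class N 0}" using P(1) zero by simp
  next
    fix P assume "P \<in> {base_class N 0}"
    then show "P \<in> ideal_times N A_in_K E1 \<inter> ideal_times N I E2"
      using zero \<open>0 \<in> I\<close> zero_in_A unfolding ideal_times_def by (metis IntI imageI singletonD)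
  qed
  ultimately show ?thesis
    unfolding internal_direct_sum_def by blast
qed

section \<open>The decomposition of the motive\<close>

lemma ideal_mult_rescale:
  fixes c :: "'a::idom fract"
  assumes "c \<noteq> 0"
  shows "ideal_mult ((*) c ` S) ((*) (1 / c) ` T) = ideal_mult S T"
proof (rule antisym)
  have eq: "(c * s) * (1 / c * t) = s * t" for s t
    using assms by simp
  show "ideal_mult ((*) c ` S) ((*) (1 / c) ` T) \<subseteq> ideal_mult S T"
    unfolding ideal_mult_subset_iff[OF subspace_ideal_mult]
    using ideal_multI by (auto simp only: ball_simps eq)
  have "s * t \<in> ideal_mult ((*) c ` S) ((*) (1 / c) ` T)" if "s \<in> S" "t \<in> T" for s t
    unfolding eq[of s t, symmetric] using that by (intro ideal_multI imageI)
  then show "ideal_mult S T \<subseteq> ideal_mult ((*) c ` S) ((*) (1 / c) ` T)"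
    unfolding ideal_mult_subset_iff[OF subspace_ideal_mult] by blast
qed

context drinfeld_motive
begin

lemma rank_two_motive: "rank_two_module act 1 [:0, 1:]"
proof -
  interpret Modules.module act by (rule module_motive_act)
  show ?thesis
    using act_parity(1) motive_independent motive_torsion by unfold_locales blast+
qed

sublocale rank_two_module act 1 "[:0, 1:]"
  by (rule rank_two_motive)

text \<open>
  The saturation of \<open>A \<cdot> 1\<close> exceeds it by at most one dimension.
\<close>

lemma coeff_ideal_one:
  defines "S \<equiv> coeff_ideal (range coords) (1, 0)"
  shows "S = A_in_K \<or> (\<exists>a b. on_curve E (Affine a b) \<and> S = point_inverse a b)"
proof -
  obtain m where m: "m \<in> saturation" and gen: "\<And>w. w \<in> saturation \<Longrightarrow> \<exists>a c. w = act a 1 + act (C c) m"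
    by (rule saturation_generators) blast
  obtain d a where da: "d \<noteq> 0" "act d m = act a 1"
    using m by (auto simp: saturation_def)
  define u where "u = to_fract a / to_fract d"
  have \<kappa>m: "coords m = (u, 0)"
    using coords_eq[OF da(1), of m a 0] da(2) by (simp add: u_def)
  have sub: "frac.subspace S"
    unfolding S_def by (intro subspace_coeff_ideal subspace_range_coords)
  have S: "g \<in> S \<longleftrightarrow> (\<exists>w. coords w = (g, 0))" for g
    by (auto simp: S_def coeff_ideal_def vscale_def image_iff) metis
  show ?thesis
  proof (rule colength_one_ideal[OF sub])
    show "1 \<in> S" "u \<in> S"
      unfolding S using coords_basis(1) \<kappa>m by blast+
    fix g assume "g \<in> S"
    then obtain w where w: "coords w = (g, 0)" unfolding S by blast
    obtain n d where nd: "d \<noteq> 0" "to_fract d * g = to_fract n"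
      by (rule fract_cases_quotient)
    have "coords (act d w) = coords (act n 1)"
      by (simp add: coords_scale w coords_basis vscale_def nd(2))
    then have "w \<in> saturation"
      unfolding saturation_def using nd(1) coords_inj by blast
    then obtain r c where "w = act r 1 + act (C c) m"
      using gen by blast
    then have "coords w = vscale (to_fract r) (1, 0) + vscale (to_fract (C c)) (u, 0)"
      by (simp add: coords_add coords_scale coords_basis \<kappa>m)
    then have "g = to_fract r + to_fract (C c) * u"
      by (simp add: w vscale_def)
    then show "\<exists>r c. g = to_fract r + to_fract (C c) * u" by blast
  qed
qed

text \<open>
  Steinitz's theorem writes the lattice as \<open>A e' + W g\<close> with W the ideal of all \<open>m \<and> n\<close>. Here
  \<open>W = c V\<^sup>-\<^sup>1\<close>, with \<open>c \<noteq> 0\<close> because \<open>1 \<and> \<tau> = 1\<close>, and \<open>c g\<close> lies in the lattice because 1 is in \<open>V\<^sup>-\<^sup>1\<close>.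
\<close>

lemma motive_decomposition:
  assumes V: "on_curve E (Affine \<alpha> \<beta>)"
    and c: "wedge_ideal (range coords) = (*) c ` point_inverse \<alpha> \<beta>"
  shows "\<exists>E1 E2. internal_direct_sum (motive q \<pi> \<phi>) (lattice_of (motive q \<pi> \<phi>))
    (ideal_times (motive q \<pi> \<phi>) A_in_K E1)
    (ideal_times (motive q \<pi> \<phi>) (point_inverse \<alpha> \<beta>) E2)"
proof -
  let ?\<Lambda> = "range coords"
  note L = subspace_range_coords
  have w1: "wedge (coords 1) (coords [:0, 1:]) = 1"
    by (simp add: coords_basis wedge_def)
  then have "1 \<in> wedge_ideal ?\<Lambda>"
    unfolding wedge_ideal_def by (intro frac.span_base) (metis (mono_tags, lifting) mem_Collect_eq rangeI)
  then have "c \<noteq> 0"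
    unfolding c by auto
  have e: "(1, 0) \<in> ?\<Lambda>"
    using coords_basis(1) by (metis rangeI)
  have "\<exists>B'. ideal_mult (coeff_ideal ?\<Lambda> (1, 0)) B' = A_in_K"
    using coeff_ideal_one point_inverse_invertible ideal_mult_one[OF subspace_A] by metis
  then obtain B' where B': "ideal_mult (coeff_ideal ?\<Lambda> (1, 0)) B' = A_in_K" ..
  have J': "ideal_mult (wedge_ideal ?\<Lambda>) ((*) (1 / c) ` point_ideal \<alpha> \<beta>) = A_in_K"
    unfolding c ideal_mult_rescale[OF \<open>c \<noteq> 0\<close>] by (rule point_inverse_invertible[OF V])
  have "\<exists>e'\<in>?\<Lambda>. \<exists>g. wedge e' g = 1 \<and>
    ?\<Lambda> = {vscale a e' + vscale w g | a w. a \<in> A_in_K \<and> w \<in> wedge_ideal ?\<Lambda>}"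
    using w1
    by (intro steinitz_rank_two[where m = "coords [:0, 1:]", OF proper_ideal_denominator L e _ _ B' J' comaximal_generators[OF coeff_ideal_one]])
      (auto simp: coords_basis(1))
  then obtain E1 g where g: "wedge (coords E1) g = 1"
    and eq: "?\<Lambda> = {vscale a (coords E1) + vscale w g | a w. a \<in> A_in_K \<and> w \<in> (*) c ` point_inverse \<alpha> \<beta>}"
    unfolding c by blast
  have "vscale 0 (coords E1) + vscale (c * 1) g \<in> ?\<Lambda>"
    unfolding eq using point_inverse_one zero_in_A by blast
  then obtain E2 where E2: "coords E2 = vscale c g"
    by (auto simp: vscale_simps)
  have "wedge (coords E1) (coords E2) \<noteq> 0"
    using g \<open>c \<noteq> 0\<close> by (simp add: E2 wedge_simps)
  moreover have "?\<Lambda> = {vscale a (coords E1) + vscale w (coords E2) | a w. a \<in> A_in_K \<and> w \<in> point_inverse \<alpha> \<beta>}"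
    by (subst eq) (auto simp: E2 vscale_simps mult.commute)
  moreover have "0 \<in> point_inverse \<alpha> \<beta>"
    using frac.subspace_0[OF subspace_point_inverse] .
  ultimately have "internal_direct_sum (motive q \<pi> \<phi>) (lattice_of (motive q \<pi> \<phi>))
    (ideal_times (motive q \<pi> \<phi>) A_in_K E1)
    (ideal_times (motive q \<pi> \<phi>) (point_inverse \<alpha> \<beta>) E2)"
    using rank_two_motive
    by (intro direct_sum_from_coordinates[where \<kappa> = coords and ?e0.0 = 1 and ?e1.0 = "[:0, 1:]"])
      (simp_all add: motive_def)
  then show ?thesis by blast
qed

end

theorem theorem1:
  fixes q :: nat and E :: "'l::alg_closed_field weierstrass"
    and \<pi> :: "'l poly poly \<Rightarrow> 'a::idom"
    and \<theta> \<eta> \<alpha> \<beta> :: 'l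
    and \<phi> :: "'a \<Rightarrow> 'l poly"
  assumes "prime CHAR('l)" and "\<exists>n>0. q = CHAR('l) ^ n"
    and "elliptic_curve_over_Fq q E"
    and "coordinate_ring E \<pi>"
    and "generic_point q \<pi> \<theta> \<eta>"
    and "sign_normalized_drinfeld_rank2 q \<pi> \<theta> \<eta> \<phi>"
    and "attached_point q E \<pi> \<theta> \<eta> \<phi> \<alpha> \<beta>"
  shows "\<exists>E1 \<in> carrier (motive q \<pi> \<phi>). \<exists>E2 \<in> carrier (motive q \<pi> \<phi>).
    internal_direct_sum (motive q \<pi> \<phi>)
      (lattice_of (motive q \<pi> \<phi>))
      (ideal_times (motive q \<pi> \<phi>) A_in_K E1)
      (ideal_times (motive q \<pi> \<phi>)
        (inverse_ideal E \<pi> (point_divisor (Affine \<alpha> \<beta>))) E2)"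
proof -
  interpret drinfeld_motive E \<pi> q \<theta> \<eta> \<phi>
    using assms unfolding elliptic_curve_over_Fq_def by unfold_locales blast+
  let ?M = "motive q \<pi> \<phi>"
  obtain S0 where V: "on_curve E (Affine \<alpha> \<beta>)" and S0: "S0 \<in> carrier (ext_square ?M)"
    and lattice: "lattice_of (ext_square ?M) =
      ideal_times (ext_square ?M) (inverse_ideal E \<pi> (point_divisor (Affine \<alpha> \<beta>))) S0"
    using assms(7) by (auto simp: attached_point_def Let_def)
  have "\<exists>c. wedge_ideal (range coords) = (*) c ` inverse_ideal E \<pi> (point_divisor (Affine \<alpha> \<beta>))"
    by (rule wedge_ideal_of_ext_square[OF _ _ _ S0 lattice])
      (simp_all add: motive_def coords_add coords_scale)
  then show ?thesis
    using motive_decomposition[OF V] unfolding inverse_ideal_point[OF V]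
    by (auto simp: motive_def)
qed

end
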